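(* Let $(X,d,\mu)$ be a compact, connected, variable Ahlfors regular metric measure space with more than one point satisfying the strong variable time regularity condition (with exponent $\beta$ the local time exponent) and the time comparability condition, and let $x_0\in X$. Then, given a sequence of positive numbers $(r_k)$ decreasing to $0$, there exists a subsequence $(r_{k_j})$ such that the continuous time processes $\mathbf x(r_{k_j})$ started at $x_0$ converge weakly, as $j\to\infty$, to a continuous time process $\mathbf x$ which has continuous paths in the sense that its law $\mathbb P^{x_0}$ satisfies $\mathbb P^{x_0}(\mathcal C)=1$.
   Context: $B_r(x)$ is the open ball and $B_r[x]=\{y:d(x,y)\le r\}$ the closed ball. Variable Ahlfors regular: $\mu$ is a Borel measure and there are a bounded $\alpha:X\to(0,\infty)$ and $C>1$ with $\frac1C r^{\alpha(x)}\le\mu(B_r(x))\le Cr^{\alpha(x)}$ for all $x\in X$, $0<r\le\mathrm{diam}(X)/2$. Local time exponent. For $r>0$ let $v_r(x)=\mu(B_r(x))$, $a_r(x)=\frac1{\mu(B_r(x))}\int_{B_r(x)}\bigl(1+\frac{v_r(x)}{v_r(y)}\bigr)d\mu(y)$ and $w_r(x,y)=\frac{1}{a_r(x)\mu(B_r(x))}\chi_{B_r(x)}(y)\bigl(1+\frac{v_r(x)}{v_r(y)}\bigr)$. Let $(\mathbf y(r)_k)_{k\ge0}$ be the discrete time Markov chain on $X$ with transition density $w_r(x,\cdot)$ with respect to $\mu$. For a closed ball $B$ let $E^+_{r,B}=\sup_{y\in B}\mathbb E^y[\inf\{k\ge 0:\mathbf y(r)_k\notin B\}]$. For $\gamma>0$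 let $T_\gamma(B)=\limsup_{r\to0^+}E^+_{r,B}r^\gamma$, $\beta(B)=\sup\{\gamma>0:T_\gamma(B)=\infty\}\in[0,\infty]$ (with $\sup\emptyset=0$), and $\beta(x)=\inf_{R>0}\beta(B_R[x])$. It is assumed that $\beta$ is bounded above on $X$. Continuous time walk. For $r>0$ let $d_r(x)=\mu(B_r(x))r^{\beta(x)}$, $q_r(x)=\frac1{\mu(B_r(x))}\int_{B_r(x)}\bigl(1+\frac{d_r(x)}{d_r(y)}\bigr)d\mu(y)$, $p_r(x,y)=\frac{1}{q_r(x)\mu(B_r(x))}\chi_{B_r(x)}(y)\bigl(1+\frac{d_r(x)}{d_r(y)}\bigr)$. Then $\mathbf x(r)=(\mathbf x(r)_t)_{t\ge0}$ is the pure jump Markov process on $X$, with right continuous paths having left limits, that waits at $x$ an exponentially distributed time of mean $r^{\beta(x)}$ and then jumps to a point chosen with density $p_r(x,\cdot)$ with respect to $\mu$. For a closed ball $B$ let $\phi_{r,B}(x)=\mathbb E^x[\inf\{t:\mathbf x(r)_t\notin B\}]$ and $\phi^+_{r,B}=\sup_{y\in B}\phi_{r,B}(y)$. Strong variable time regularity with exponent $\beta$: there exist $C>0$ and $r_0>0$ such that for all $x\in X$, $0<R<\mathrm{diam}(X)/2$ and $0<r<\min\{r_0,R\}$, $\frac1C R^{\beta(x)}\le\phi^+_{r,B_R[x]}\le CR^{\beta(x)}$. Time comparability condition: there exist constants $0<R_0<\mathrm{diam}(X)/2$, $0<r_0<R_0$, $c>0$ such that for all $0<r<r_0$, $x\in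 X$ and $0<R<\mathrm{diam}(X)/2$, with $B=B_R[x]$, $c\,\phi^+_{r,B}\le\phi_{r,B}(x)$. $\mathcal D$ is the space of c\`adl\`ag (right continuous with left limits) paths $[0,\infty)\to X$ with the Skorohod J1 topology (a Polish space), $\mathcal C\subset\mathcal D$ the set of continuous paths. Weak convergence of processes means weak convergence of their laws as Borel probability measures on $\mathcal D$. *)

theory Defs
  imports "HOL-Probability.Probability"
begin

section \<open>The space\<close>

definition variable_ahlfors_regular :: "'a::metric_space measure \<Rightarrow> bool" where
  "variable_ahlfors_regular \<mu> \<longleftrightarrow>
     sets \<mu> = sets borel \<and>
     (\<exists>(\<alpha> :: 'a \<Rightarrow> real) C.
        (\<forall>x. 0 < \<alpha> x) \<and> bounded (range \<alpha>) \<and> 1 < C \<and>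
        (\<forall>x r. 0 < r \<and> r \<le> diameter (UNIV :: 'a set) / 2 \<longrightarrow>
           ennreal (1 / C * r powr \<alpha> x) \<le> emeasure \<mu> (ball x r) \<and>
           emeasure \<mu> (ball x r) \<le> ennreal (C * r powr \<alpha> x)))"

text \<open>
  A compact metric space is complete and second countable, so that the sort
  \<^class>\<open>polish_space\<close> is no restriction for such spaces.
\<close>

lemma compact_metric_space_polish:
  assumes "compact (UNIV :: 'a::metric_space set)"
  shows "uniform_space_class.complete (UNIV :: 'a set)"
    and "\<exists>B :: 'a set set. countable B \<and> topological_basis B"
proof -
  show "uniform_space_class.complete (UNIV :: 'a set)"
    using assms by (rule compact_imp_complete)
  have "\<exists>k. finite k \<and> (UNIV :: 'a set) \<subseteq> (\<Union>x\<in>k. ball x (inverse (real (Suc n))))" for n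
    using assms unfolding compact_eq_totally_bounded by (metis inverse_positive_iff_positive of_nat_0_less_iff zero_less_Suc)
  then obtain k where k: "\<And>n. finite (k n)"
      "\<And>n. (UNIV :: 'a set) \<subseteq> (\<Union>x\<in>k n. ball x (inverse (real (Suc n))))"
    by metis
  define B where "B = (\<Union>n. (\<lambda>x. ball x (inverse (real (Suc n)))) ` k n)"
  have "countable B"
    unfolding B_def by (intro countable_UN countable_image countable_finite[OF k(1)] countableI_type)
  moreover have "topological_basis B"
  proof (rule topological_basisI)
    show "open b" if "b \<in> B" for b
      using that by (auto simp: B_def)
    fix U :: "'a set" and x assume "open U" "x \<in> U"
    then obtain e where e: "e > 0" "ball x e \<subseteq> U"
      using open_contains_ball by blast
    obtain n where n: "inverse (real (Suc n)) < e / 2"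
      using reals_Archimedean[of "e / 2"] e by auto
    obtain z where z: "z \<in> k n" "x \<in> ball z (inverse (real (Suc n)))"
      using k(2)[of n] by blast
    have "ball z (inverse (real (Suc n))) \<subseteq> ball x e"
    proof
      fix y assume y: "y \<in> ball z (inverse (real (Suc n)))"
      have "dist x y \<le> dist z x + dist z y"
        by (metis dist_commute dist_triangle)
      then show "y \<in> ball x e" using n y z(2) by auto
    qed
    moreover have "ball z (inverse (real (Suc n))) \<in> B"
      using z(1) by (auto simp: B_def)
    ultimately show "\<exists>V\<in>B. x \<in> V \<and> V \<subseteq> U"
      using z(2) e(2) by blast
  qed
  ultimately show "\<exists>B :: 'a set set. countable B \<and> topological_basis B"
    by blast
qed

section \<open>Path space with the Skorohod J1 topology\<close>

text \<open>
  A path on \<open>[0,\<infinity>)\<close> is represented by its extension to the real line that is constant on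
  \<open>(-\<infinity>,0]\<close>.
\<close>

typedef (overloaded) ('a::metric_space) cadlag =
  "{f :: real \<Rightarrow> 'a. (\<forall>t<0. f t = f 0) \<and>
      (\<forall>t\<ge>0. continuous (at_right t) f) \<and>
      (\<forall>t>0. \<exists>l. (f \<longlongrightarrow> l) (at_left t))}"
  morphisms path_at Cadlag
  by (rule exI[of _ "\<lambda>_. undefined"]) (auto intro: tendsto_const)

setup_lifting type_definition_cadlag

definition time_changes :: "(real \<Rightarrow> real) set" where
  "time_changes = {l. strict_mono_on {0..} l \<and> l ` {0..} = {0..}}"

definition J1_nbhd :: "'a::metric_space cadlag \<Rightarrow> real \<Rightarrow> 'a cadlag set" where
  "J1_nbhd \<omega> e = {\<eta>. \<exists>l\<in>time_changes.
     (\<forall>s\<ge>0. \<bar>l s - s\<bar> \<le> e) \<and> (\<forall>s\<in>{0..1 / e}. dist (path_at \<eta> (l s)) (path_at \<omega> s) \<le> e)}"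

text \<open>
  The sets \<open>J1_nbhd \<omega> e\<close>, \<open>e > 0\<close>, form a neighbourhood base at \<open>\<omega>\<close>
  (lemma \<open>eventually_nhds_cadlag\<close>), and a sequence converges if and only if it does so in the
  sense usually taken to characterise J1 convergence on \<open>[0,\<infinity>)\<close>
  (lemma \<open>LIMSEQ_cadlag_iff\<close>).
\<close>

lemma J1_nbhd_mono:
  assumes "0 < e" "e \<le> e'"
  shows "J1_nbhd \<omega> e \<subseteq> J1_nbhd \<omega> e'"
proof -
  have "1 / e' \<le> 1 / e" using assms by (simp add: frac_le)
  then have sub: "{0..1 / e'} \<subseteq> {0..1 / e}" by auto
  show ?thesis
  proof
    fix \<eta> assume "\<eta> \<in> J1_nbhd \<omega> e"
    then obtain l where l: "l \<in> time_changes" "\<forall>s\<ge>0. \<bar>l s - s\<bar> \<le> e"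
        "\<forall>s\<in>{0..1 / e}. dist (path_at \<eta> (l s)) (path_at \<omega> s) \<le> e"
      unfolding J1_nbhd_def by blast
    have "\<forall>s\<ge>0. \<bar>l s - s\<bar> \<le> e'"
      using l(2) assms(2) by (meson order_trans)
    moreover have "\<forall>s\<in>{0..1 / e'}. dist (path_at \<eta> (l s)) (path_at \<omega> s) \<le> e'"
      using l(3) sub assms(2) by (meson order_trans subsetD)
    ultimately show "\<eta> \<in> J1_nbhd \<omega> e'"
      unfolding J1_nbhd_def using l(1) by blast
  qed
qed

instantiation cadlag :: (metric_space) topological_space
begin

definition open_cadlag :: "'a cadlag set \<Rightarrow> bool" where
  "open_cadlag U \<longleftrightarrow> (\<forall>\<omega>\<in>U. \<exists>e>0. J1_nbhd \<omega> e \<subseteq> U)"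

instance
proof
  show "open (UNIV :: 'a cadlag set)"
    by (auto simp: open_cadlag_def intro: exI[of _ 1])
  fix S T :: "'a cadlag set" assume S: "open S" and T: "open T"
  show "open (S \<inter> T)"
    unfolding open_cadlag_def
  proof
    fix \<omega> assume "\<omega> \<in> S \<inter> T"
    then obtain d e where "d > 0" "J1_nbhd \<omega> d \<subseteq> S" "e > 0" "J1_nbhd \<omega> e \<subseteq> T"
      using S T unfolding open_cadlag_def by blast
    then show "\<exists>e>0. J1_nbhd \<omega> e \<subseteq> S \<inter> T"
      using J1_nbhd_mono[of "min d e" d \<omega>] J1_nbhd_mono[of "min d e" e \<omega>]
      by (intro exI[of _ "min d e"]) auto
  qed
next
  fix K :: "'a cadlag set set" assume "\<forall>S\<in>K. open S"
  then show "open (\<Union>K)"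
    unfolding open_cadlag_def by (meson Union_iff Union_upper subset_trans)
qed

end

lemma mem_J1_nbhd: "0 < e \<Longrightarrow> \<omega> \<in> J1_nbhd \<omega> e"
  unfolding J1_nbhd_def mem_Collect_eq
  by (rule bexI[of _ "\<lambda>s. s"]) (simp_all add: time_changes_def strict_mono_on_def)

lemma J1_nbhd_compose:
  assumes e: "0 < e" and \<eta>: "\<eta> \<in> J1_nbhd \<omega> (e / 2)"
  shows "\<exists>d>0. J1_nbhd \<eta> d \<subseteq> J1_nbhd \<omega> e"
proof -
  define d where "d = min (e / 2) (1 / (1 / e + e))"
  have d: "0 < d" "d \<le> e / 2" "1 / e + e \<le> 1 / d"
  proof -
    have *: "0 < 1 / e + e" using e by (simp add: add_pos_pos)
    then show "0 < d" "d \<le> e / 2" using e by (auto simp: d_def)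
    have "d \<le> 1 / (1 / e + e)" by (simp add: d_def)
    then have "d * (1 / e + e) \<le> 1" using * by (subst (asm) pos_le_divide_eq) auto
    then show "1 / e + e \<le> 1 / d"
      using \<open>0 < d\<close> by (subst pos_le_divide_eq) (auto simp: mult.commute)
  qed
  obtain l where l: "l \<in> time_changes" "\<And>s. s \<ge> 0 \<Longrightarrow> \<bar>l s - s\<bar> \<le> e / 2"
      "\<And>s. s \<in> {0..1 / (e / 2)} \<Longrightarrow> dist (path_at \<eta> (l s)) (path_at \<omega> s) \<le> e / 2"
    using \<eta> unfolding J1_nbhd_def by blast
  have lpos: "l s \<ge> 0" if "s \<ge> 0" for s
    using l(1) that unfolding time_changes_def by auto
  have "J1_nbhd \<eta> d \<subseteq> J1_nbhd \<omega> e"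
  proof
    fix \<zeta> assume "\<zeta> \<in> J1_nbhd \<eta> d"
    then obtain m where m: "m \<in> time_changes" "\<And>s. s \<ge> 0 \<Longrightarrow> \<bar>m s - s\<bar> \<le> d"
      "\<And>s. s \<in> {0..1 / d} \<Longrightarrow> dist (path_at \<zeta> (m s)) (path_at \<eta> s) \<le> d"
      unfolding J1_nbhd_def by blast
    have "m \<circ> l \<in> time_changes"
    proof -
      have "(m \<circ> l) ` {0..} = {0..}"
        using l(1) m(1) unfolding time_changes_def image_comp[symmetric] by simp
      moreover have "strict_mono_on {0..} (m \<circ> l)"
        using l(1) m(1) lpos unfolding time_changes_def strict_mono_on_def by simp
      ultimately show ?thesis unfolding time_changes_def by simp
    qed
    moreover have "\<bar>(m \<circ> l) s - s\<bar> \<le> e" if "s \<ge> 0" for s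
      using m(2)[OF lpos[OF that]] l(2)[OF that] d(2) unfolding comp_def by linarith
    moreover have "dist (path_at \<zeta> ((m \<circ> l) s)) (path_at \<omega> s) \<le> e" if s: "s \<in> {0..1 / e}" for s
    proof -
      have "1 / e \<le> 1 / (e / 2)" using e by (simp add: field_simps)
      then have 1: "dist (path_at \<eta> (l s)) (path_at \<omega> s) \<le> e / 2"
        using s by (intro l(3)) auto
      have "l s \<le> 1 / d"
      proof -
        have "s \<ge> 0" "s \<le> 1 / e" using s by auto
        with l(2)[of s] e have "l s \<le> 1 / e + e" by linarith
        with d(3) show ?thesis by linarith
      qed
      then have "dist (path_at \<zeta> (m (l s))) (path_at \<eta> (l s)) \<le> d"
        using s by (intro m(3)) (auto intro: lpos)
      with 1 d(2) show ?thesis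
        using dist_triangle[of "path_at \<zeta> (m (l s))" "path_at \<omega> s" "path_at \<eta> (l s)"]
        unfolding comp_def by linarith
    qed
    ultimately show "\<zeta> \<in> J1_nbhd \<omega> e"
      unfolding J1_nbhd_def by blast
  qed
  with d(1) show ?thesis by blast
qed

lemma eventually_nhds_cadlag:
  "eventually Q (nhds \<omega>) \<longleftrightarrow> (\<exists>e>0. \<forall>\<eta>\<in>J1_nbhd \<omega> e. Q \<eta>)"
proof
  assume "eventually Q (nhds \<omega>)"
  then obtain U where "open U" "\<omega> \<in> U" "\<forall>\<eta>\<in>U. Q \<eta>"
    unfolding eventually_nhds by blast
  then show "\<exists>e>0. \<forall>\<eta>\<in>J1_nbhd \<omega> e. Q \<eta>"
    unfolding open_cadlag_def by blast
next
  assume "\<exists>e>0. \<forall>\<eta>\<in>J1_nbhd \<omega> e. Q \<eta>"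
  then obtain e where e: "e > 0" "\<forall>\<eta>\<in>J1_nbhd \<omega> e. Q \<eta>" by blast
  define U where "U = {\<eta>. \<exists>d>0. J1_nbhd \<eta> d \<subseteq> J1_nbhd \<omega> e}"
  have "open U"
    unfolding open_cadlag_def
  proof
    fix \<eta> assume "\<eta> \<in> U"
    then obtain d where d: "d > 0" "J1_nbhd \<eta> d \<subseteq> J1_nbhd \<omega> e" by (auto simp: U_def)
    then have "J1_nbhd \<eta> (d / 2) \<subseteq> U"
      using J1_nbhd_compose[of d _ \<eta>] unfolding U_def by blast
    then show "\<exists>e>0. J1_nbhd \<eta> e \<subseteq> U"
      using d(1) half_gt_zero by blast
  qed
  moreover have "\<omega> \<in> U" using e(1) by (auto simp: U_def)
  moreover have "\<forall>\<eta>\<in>U. Q \<eta>"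
    using e(2) mem_J1_nbhd unfolding U_def by blast
  ultimately show "eventually Q (nhds \<omega>)"
    unfolding eventually_nhds by blast
qed

lemma LIMSEQ_cadlag_iff:
  fixes X :: "nat \<Rightarrow> 'a::metric_space cadlag"
  shows "X \<longlonglongrightarrow> \<omega> \<longleftrightarrow>
    (\<exists>l. (\<forall>n. l n \<in> time_changes) \<and>
         uniform_limit {0..} l (\<lambda>s. s) sequentially \<and>
         (\<forall>N. uniform_limit {0..N} (\<lambda>n s. path_at (X n) (l n s)) (path_at \<omega>) sequentially))"
proof -
  have iff: "X \<longlonglongrightarrow> \<omega> \<longleftrightarrow> (\<forall>e>0. \<forall>\<^sub>F n in sequentially. X n \<in> J1_nbhd \<omega> e)"
  proof
    assume *: "X \<longlonglongrightarrow> \<omega>"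
    show "\<forall>e>0. \<forall>\<^sub>F n in sequentially. X n \<in> J1_nbhd \<omega> e"
    proof (intro allI impI)
      fix e :: real assume "e > 0"
      then have "eventually (\<lambda>\<eta>. \<eta> \<in> J1_nbhd \<omega> e) (nhds \<omega>)"
        unfolding eventually_nhds_cadlag by blast
      then show "\<forall>\<^sub>F n in sequentially. X n \<in> J1_nbhd \<omega> e"
        using * unfolding filterlim_iff by blast
    qed
  next
    assume *: "\<forall>e>0. \<forall>\<^sub>F n in sequentially. X n \<in> J1_nbhd \<omega> e"
    show "X \<longlonglongrightarrow> \<omega>"
      unfolding filterlim_iff eventually_nhds_cadlag
    proof (intro allI impI)
      fix Q assume "\<exists>e>0. \<forall>\<eta>\<in>J1_nbhd \<omega> e. Q \<eta>"
      then obtain e where "e > 0" "\<forall>\<eta>\<in>J1_nbhd \<omega> e. Q \<eta>" by blast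
      with * show "\<forall>\<^sub>F n in sequentially. Q (X n)"
        by (meson eventually_mono)
    qed
  qed
  show ?thesis
  proof
    assume "X \<longlonglongrightarrow> \<omega>"
    then have ev: "\<forall>\<^sub>F n in sequentially. X n \<in> J1_nbhd \<omega> e" if "e > 0" for e
      using that iff by blast
    define E where "E n = {e. 0 < e \<and> X n \<in> J1_nbhd \<omega> e}" for n
    have bdd: "bdd_below (E n)" for n
      by (intro bdd_belowI[of _ 0]) (auto simp: E_def)
    have "\<exists>l\<in>time_changes. E n \<noteq> {} \<longrightarrow> (\<exists>e\<in>E n. e \<le> Inf (E n) + inverse (real (Suc n)) \<and>
        (\<forall>s\<ge>0. \<bar>l s - s\<bar> \<le> e) \<and> (\<forall>s\<in>{0..1 / e}. dist (path_at (X n) (l s)) (path_at \<omega> s) \<le> e))" for n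
    proof (cases "E n = {}")
      case True
      then show ?thesis
        by (auto intro!: bexI[of _ "\<lambda>s. s"] simp: time_changes_def strict_mono_on_def)
    next
      case False
      then obtain e where "e \<in> E n" "e < Inf (E n) + inverse (real (Suc n))"
        using cInf_lessD[of "E n" "Inf (E n) + inverse (real (Suc n))"] by auto
      moreover from this(1) obtain l where "l \<in> time_changes" "\<forall>s\<ge>0. \<bar>l s - s\<bar> \<le> e"
          "\<forall>s\<in>{0..1 / e}. dist (path_at (X n) (l s)) (path_at \<omega> s) \<le> e"
        unfolding E_def J1_nbhd_def by blast
      ultimately show ?thesis by (meson less_imp_le)
    qed
    then obtain l where l: "\<And>n. l n \<in> time_changes"
      "\<And>n. E n \<noteq> {} \<Longrightarrow> \<exists>e\<in>E n. e \<le> Inf (E n) + inverse (real (Suc n)) \<and>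
        (\<forall>s\<ge>0. \<bar>l n s - s\<bar> \<le> e) \<and> (\<forall>s\<in>{0..1 / e}. dist (path_at (X n) (l n s)) (path_at \<omega> s) \<le> e)"
      by metis
    have key: "\<forall>\<^sub>F n in sequentially. (\<forall>s\<ge>0. \<bar>l n s - s\<bar> < e) \<and>
        (\<forall>s\<in>{0..N}. dist (path_at (X n) (l n s)) (path_at \<omega> s) < e)" if e: "e > 0" for e N
    proof -
      define d where "d = min (e / 4) (1 / (4 * (\<bar>N\<bar> + 1)))"
      have d: "0 < d" "2 * d < e" "N \<le> 1 / (2 * d)"
      proof -
        show "0 < d" "2 * d < e" using e by (auto simp: d_def)
        have "d \<le> 1 / (4 * (\<bar>N\<bar> + 1))" by (simp add: d_def)
        then have "d * (4 * (\<bar>N\<bar> + 1)) \<le> 1"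
          by (simp add: pos_le_divide_eq)
        moreover have "N * (2 * d) \<le> d * (4 * (\<bar>N\<bar> + 1))"
        proof -
          have "N * 2 \<le> 4 * (\<bar>N\<bar> + 1)" by simp
          from mult_left_mono[OF this, of d] \<open>0 < d\<close> show ?thesis by (simp add: algebra_simps)
        qed
        ultimately have "N * (2 * d) \<le> 1" by (rule order_trans[rotated])
        then show "N \<le> 1 / (2 * d)" using \<open>0 < d\<close> by (subst pos_le_divide_eq) auto
      qed
      have "\<forall>\<^sub>F n in sequentially. inverse (real (Suc n)) < d"
        using LIMSEQ_inverse_real_of_nat d(1) by (rule order_tendstoD)
      with ev[OF d(1)] show ?thesis
      proof eventually_elim
        case (elim n)
        then have "d \<in> E n" using d(1) by (simp add: E_def)
        then have "Inf (E n) \<le> d" using bdd by (rule cInf_lower)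
        obtain e' where e': "e' \<in> E n" "e' \<le> Inf (E n) + inverse (real (Suc n))"
          "\<forall>s\<ge>0. \<bar>l n s - s\<bar> \<le> e'"
          "\<forall>s\<in>{0..1 / e'}. dist (path_at (X n) (l n s)) (path_at \<omega> s) \<le> e'"
          using l(2)[of n] \<open>d \<in> E n\<close> by blast
        have "0 < e'" using e'(1) by (simp add: E_def)
        have "e' \<le> 2 * d" using e'(2) \<open>Inf (E n) \<le> d\<close> elim(2) by linarith
        then have "1 / (2 * d) \<le> 1 / e'" using \<open>0 < e'\<close> by (simp add: frac_le)
        then have "N \<le> 1 / e'" using d(3) by linarith
        have "e' < e" using \<open>e' \<le> 2 * d\<close> d(2) by linarith
        show ?case
        proof (intro conjI allI ballI impI)
          fix s :: real assume "s \<ge> 0"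
          then show "\<bar>l n s - s\<bar> < e"
            using e'(3) \<open>e' < e\<close> by (meson le_less_trans)
        next
          fix s assume "s \<in> {0..N}"
          then have "s \<in> {0..1 / e'}" using \<open>N \<le> 1 / e'\<close> by auto
          then show "dist (path_at (X n) (l n s)) (path_at \<omega> s) < e"
            using e'(4) \<open>e' < e\<close> by (meson le_less_trans)
        qed
      qed
    qed
    show "\<exists>l. (\<forall>n. l n \<in> time_changes) \<and>
         uniform_limit {0..} l (\<lambda>s. s) sequentially \<and>
         (\<forall>N. uniform_limit {0..N} (\<lambda>n s. path_at (X n) (l n s)) (path_at \<omega>) sequentially)"
    proof (intro exI conjI allI)
      show "l n \<in> time_changes" for n by (rule l(1))
      show "uniform_limit {0..} l (\<lambda>s. s) sequentially"
        unfolding uniform_limit_iff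
      proof (intro allI impI)
        fix e :: real assume "e > 0"
        from key[OF this, of 0]
        show "\<forall>\<^sub>F n in sequentially. \<forall>s\<in>{0..}. dist (l n s) s < e"
          by eventually_elim (auto simp: dist_real_def)
      qed
      show "uniform_limit {0..N} (\<lambda>n s. path_at (X n) (l n s)) (path_at \<omega>) sequentially" for N
        unfolding uniform_limit_iff
      proof (intro allI impI)
        fix e :: real assume "e > 0"
        from key[OF this, of N]
        show "\<forall>\<^sub>F n in sequentially. \<forall>s\<in>{0..N}. dist (path_at (X n) (l n s)) (path_at \<omega> s) < e"
          by eventually_elim blast
      qed
    qed
  next
    assume "\<exists>l. (\<forall>n. l n \<in> time_changes) \<and>
         uniform_limit {0..} l (\<lambda>s. s) sequentially \<and>
         (\<forall>N. uniform_limit {0..N} (\<lambda>n s. path_at (X n) (l n s)) (path_at \<omega>) sequentially)"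
    then obtain l where l: "\<And>n. l n \<in> time_changes"
      "uniform_limit {0..} l (\<lambda>s. s) sequentially"
      "\<And>N. uniform_limit {0..N} (\<lambda>n s. path_at (X n) (l n s)) (path_at \<omega>) sequentially"
      by blast
    show "X \<longlonglongrightarrow> \<omega>"
      unfolding iff
    proof (intro allI impI)
      fix e :: real assume e: "e > 0"
      from l(2) e have "\<forall>\<^sub>F n in sequentially. \<forall>s\<in>{0..}. dist (l n s) s < e"
        unfolding uniform_limit_iff by blast
      moreover from l(3)[of "1 / e"] e
      have "\<forall>\<^sub>F n in sequentially. \<forall>s\<in>{0..1 / e}. dist (path_at (X n) (l n s)) (path_at \<omega> s) < e"
        unfolding uniform_limit_iff by blast
      ultimately show "\<forall>\<^sub>F n in sequentially. X n \<in> J1_nbhd \<omega> e"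
      proof eventually_elim
        case (elim n)
        have "\<forall>s\<ge>0. \<bar>l n s - s\<bar> \<le> e"
          using elim(1) unfolding dist_real_def by (meson atLeast_iff less_imp_le)
        moreover have "\<forall>s\<in>{0..1 / e}. dist (path_at (X n) (l n s)) (path_at \<omega> s) \<le> e"
          using elim(2) by (meson less_imp_le)
        ultimately show ?case
          unfolding J1_nbhd_def using l(1)[of n] by blast
      qed
    qed
  qed
qed

definition continuous_paths :: "'a::metric_space cadlag set" where
  "continuous_paths = {\<omega>. continuous_on {0..} (path_at \<omega>)}"

definition exit_time :: "'a::metric_space set \<Rightarrow> 'a cadlag \<Rightarrow> ennreal" where
  "exit_time B \<omega> = (INF t\<in>{t. 0 \<le> t \<and> path_at \<omega> t \<notin> B}. ennreal t)"

definition weakly_converges ::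
    "(nat \<Rightarrow> 'b::topological_space measure) \<Rightarrow> 'b measure \<Rightarrow> bool" where
  "weakly_converges M N \<longleftrightarrow>
     (\<forall>n. prob_space (M n) \<and> sets (M n) = sets borel) \<and>
     prob_space N \<and> sets N = sets borel \<and>
     (\<forall>f :: 'b \<Rightarrow> real. continuous_on UNIV f \<and> bounded (range f) \<longrightarrow>
        (\<lambda>n. \<integral>x. f x \<partial>M n) \<longlonglongrightarrow> (\<integral>x. f x \<partial>N))"

section \<open>Markov chains and jump processes\<close>

text \<open>
  Law on sequences of the chain started at \<open>x\<close> with transition kernel \<open>K\<close>, by the
  Ionescu-Tulcea theorem: \<open>chain_step K x n \<xi>\<close> is the law of the \<open>n\<close>-th state given the previous
  states \<open>\<xi> 0, ..., \<xi> (n - 1)\<close>.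
\<close>

primrec chain_step ::
    "('a::topological_space \<Rightarrow> 'a measure) \<Rightarrow> 'a \<Rightarrow> nat \<Rightarrow> (nat \<Rightarrow> 'a) \<Rightarrow> 'a measure" where
  "chain_step K x 0 = (\<lambda>\<xi>. return borel x)"
| "chain_step K x (Suc n) = (\<lambda>\<xi>. K (\<xi> n))"

definition chain_law ::
    "('a::topological_space \<Rightarrow> 'a measure) \<Rightarrow> 'a \<Rightarrow> (nat \<Rightarrow> 'a) measure" where
  "chain_law K x =
     projective_family.lim UNIV (Ionescu_Tulcea.CI (chain_step K x) (\<lambda>_. borel)) (\<lambda>_. borel)"

lemma Ionescu_Tulcea_chain_step:
  assumes K [measurable]: "K \<in> borel \<rightarrow>\<^sub>M subprob_algebra borel"
    and prob: "\<And>y. prob_space (K y)"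
  shows "Ionescu_Tulcea (chain_step K x) (\<lambda>_. borel)"
proof (rule Ionescu_Tulcea.intro)
  show "chain_step K x n \<in> Pi\<^sub>M {0..<n} (\<lambda>_. borel) \<rightarrow>\<^sub>M subprob_algebra borel" for n
  proof (cases n)
    case 0
    then show ?thesis
      by (simp add: space_subprob_algebra prob_space_return prob_space_imp_subprob_space)
  next
    case (Suc m)
    then show ?thesis
      by simp
  qed
  show "prob_space (chain_step K x n \<xi>)" if "\<xi> \<in> space (Pi\<^sub>M {0..<n} (\<lambda>_. borel))" for n \<xi>
    by (cases n) (auto simp: prob prob_space_return)
qed

text \<open>
  The path that stays in \<open>y n\<close> for the time \<open>h (y n) * e n\<close> and then moves on to \<open>y (Suc n)\<close>.
  Where this does not define a path on all of \<open>[0,\<infinity>)\<close>, the value is the constant path \<open>y 0\<close>;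
  this concerns a null set in the definition of \<open>walk_law\<close> below.
\<close>

definition jump_time :: "('a \<Rightarrow> real) \<Rightarrow> (nat \<Rightarrow> 'a) \<Rightarrow> (nat \<Rightarrow> real) \<Rightarrow> nat \<Rightarrow> real" where
  "jump_time h y e n = (\<Sum>i<n. h (y i) * e i)"

definition jump_fun :: "('a \<Rightarrow> real) \<Rightarrow> (nat \<Rightarrow> 'a) \<Rightarrow> (nat \<Rightarrow> real) \<Rightarrow> real \<Rightarrow> 'a" where
  "jump_fun h y e t =
     (if (\<forall>n. 0 < h (y n) * e n) \<and> filterlim (jump_time h y e) at_top sequentially
      then y (LEAST n. max t 0 < jump_time h y e (Suc n))
      else y 0)"

lemma cadlag_jump_fun:
  fixes h :: "'a::metric_space \<Rightarrow> real" and y :: "nat \<Rightarrow> 'a" and e :: "nat \<Rightarrow> real"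
  defines "f \<equiv> jump_fun h y e"
  shows "(\<forall>t<0. f t = f 0) \<and> (\<forall>t\<ge>0. continuous (at_right t) f) \<and>
    (\<forall>t>0. \<exists>l. (f \<longlongrightarrow> l) (at_left t))"
proof (cases "(\<forall>n. 0 < h (y n) * e n) \<and> filterlim (jump_time h y e) at_top sequentially")
  case False
  then have "f = (\<lambda>t. y 0)" by (auto simp: f_def jump_fun_def fun_eq_iff)
  then show ?thesis by (auto intro: tendsto_const)
next
  case True
  define T where "T = jump_time h y e"
  have f: "f t = y (LEAST n. max t 0 < T (Suc n))" for t
    using True by (simp add: f_def jump_fun_def T_def)
  have T0: "T 0 = 0" by (simp add: T_def jump_time_def)
  have "T n < T (Suc n)" for n
    using True by (simp add: T_def jump_time_def)
  then have mono: "strict_mono T" by (simp add: strict_mono_Suc_iff)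
  have unb: "\<exists>n. t < T n" for t
    using True unfolding T_def[symmetric] filterlim_at_top_dense eventually_sequentially by blast
  have val: "f t = y n" if "T n \<le> max t 0" "max t 0 < T (Suc n)" for t n
  proof -
    have "(LEAST n. max t 0 < T (Suc n)) = n"
    proof (rule Least_equality)
      fix m assume "max t 0 < T (Suc m)"
      then have "T n < T (Suc m)" using that(1) by linarith
      then show "n \<le> m" using mono by (simp add: strict_mono_less)
    qed (fact that(2))
    then show ?thesis by (simp add: f)
  qed
  have ind: "\<exists>n. T n \<le> t \<and> t < T (Suc n)" if "t \<ge> 0" for t
  proof -
    define m where "m = (LEAST m. t < T m)"
    have m: "t < T m" unfolding m_def using unb by (rule LeastI_ex)
    then have "m \<noteq> 0" using T0 that by (intro notI) simp
    then obtain n where n: "m = Suc n" by (cases m) auto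
    then have "\<not> t < T n" unfolding m_def by (intro not_less_Least) simp
    then show ?thesis using m n by (intro exI[of _ n]) auto
  qed
  show ?thesis
  proof (intro conjI allI impI)
    show "f t = f 0" if "t < 0" for t using that by (simp add: f)
  next
    fix t :: real assume "t \<ge> 0"
    then obtain n where n: "T n \<le> t" "t < T (Suc n)" using ind by blast
    have "eventually (\<lambda>s. f s = y n) (at_right t)"
      unfolding eventually_at_right[OF n(2)] using n \<open>t \<ge> 0\<close>
      by (intro exI[of _ "T (Suc n)"]) (auto intro!: val)
    moreover have "f t = y n" using n \<open>t \<ge> 0\<close> by (intro val) auto
    ultimately show "continuous (at_right t) f"
      unfolding continuous_within by (simp add: tendsto_eventually)
  next
    fix t :: real assume t: "t > 0"
    then obtain n where n: "T n \<le> t" "t < T (Suc n)" using ind[of t] by auto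
    have "\<exists>m. T m < t \<and> t \<le> T (Suc m)"
    proof (cases "T n = t")
      case True
      then have "n \<noteq> 0" using t T0 by (intro notI) simp
      then obtain m where "n = Suc m" by (cases n) auto
      then show ?thesis using True strict_monoD[OF mono, of m n] by auto
    next
      case False
      then show ?thesis using n by (intro exI[of _ n]) auto
    qed
    then obtain m where m: "T m < t" "t \<le> T (Suc m)" by blast
    have "0 \<le> T m" using T0 strict_mono_leD[OF mono, of 0 m] by simp
    have "eventually (\<lambda>s. f s = y m) (at_left t)"
      unfolding eventually_at_left[OF m(1)] using m \<open>0 \<le> T m\<close>
      by (intro exI[of _ "T m"]) (auto intro!: val)
    then show "\<exists>l. (f \<longlongrightarrow> l) (at_left t)"
      by (intro exI[of _ "y m"]) (simp add: tendsto_eventually)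
  qed
qed

lift_definition jump_path ::
    "('a::metric_space \<Rightarrow> real) \<Rightarrow> (nat \<Rightarrow> 'a) \<Rightarrow> (nat \<Rightarrow> real) \<Rightarrow> 'a cadlag" is jump_fun
  by (rule cadlag_jump_fun)

section \<open>The discrete walks and the local time exponent\<close>

definition ball_mass :: "'a::metric_space measure \<Rightarrow> real \<Rightarrow> 'a \<Rightarrow> real" where
  "ball_mass \<mu> r x = measure \<mu> (ball x r)"

text \<open>
  Both families of transition densities have the same form; \<open>g\<close> is \<open>v\<^sub>r\<close> for the discrete time
  chain and \<open>d\<^sub>r\<close> for the continuous time walk.
\<close>

definition step_norm :: "'a::metric_space measure \<Rightarrow> ('a \<Rightarrow> real) \<Rightarrow> real \<Rightarrow> 'a \<Rightarrow> real" where
  "step_norm \<mu> g r x = 1 / ball_mass \<mu> r x * (LINT y:ball x r|\<mu>. 1 + g x / g y)"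

definition step_density ::
    "'a::metric_space measure \<Rightarrow> ('a \<Rightarrow> real) \<Rightarrow> real \<Rightarrow> 'a \<Rightarrow> 'a \<Rightarrow> real" where
  "step_density \<mu> g r x y =
     1 / (step_norm \<mu> g r x * ball_mass \<mu> r x) * indicator (ball x r) y * (1 + g x / g y)"

definition step_kernel ::
    "'a::metric_space measure \<Rightarrow> ('a \<Rightarrow> real) \<Rightarrow> real \<Rightarrow> 'a \<Rightarrow> 'a measure" where
  "step_kernel \<mu> g r x = density \<mu> (\<lambda>y. ennreal (step_density \<mu> g r x y))"

definition discrete_walk_law ::
    "'a::metric_space measure \<Rightarrow> real \<Rightarrow> 'a \<Rightarrow> (nat \<Rightarrow> 'a) measure" where
  "discrete_walk_law \<mu> r = chain_law (step_kernel \<mu> (ball_mass \<mu> r) r)"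

definition discrete_exit_time :: "'a set \<Rightarrow> (nat \<Rightarrow> 'a) \<Rightarrow> ennreal" where
  "discrete_exit_time B \<xi> = (INF k\<in>{k. \<xi> k \<notin> B}. of_nat k)"

definition max_mean_exit_steps :: "'a::metric_space measure \<Rightarrow> real \<Rightarrow> 'a set \<Rightarrow> ennreal" where
  "max_mean_exit_steps \<mu> r B =
     (SUP y\<in>B. \<integral>\<^sup>+\<xi>. discrete_exit_time B \<xi> \<partial>discrete_walk_law \<mu> r y)"

definition ball_time_exponent :: "'a::metric_space measure \<Rightarrow> 'a set \<Rightarrow> ennreal" where
  "ball_time_exponent \<mu> B =
     (SUP \<gamma>\<in>{\<gamma>::real. 0 < \<gamma> \<and>
         Limsup (at_right 0) (\<lambda>r. max_mean_exit_steps \<mu> r B * ennreal (r powr \<gamma>)) = \<infinity>}.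
       ennreal \<gamma>)"

definition local_time_exponent :: "'a::metric_space measure \<Rightarrow> 'a \<Rightarrow> ennreal" where
  "local_time_exponent \<mu> x = (INF R\<in>{0<..}. ball_time_exponent \<mu> (cball x R))"

text \<open>Real-valued version, for use when \<^const>\<open>local_time_exponent\<close> is bounded.\<close>

definition time_exponent :: "'a::metric_space measure \<Rightarrow> 'a \<Rightarrow> real" where
  "time_exponent \<mu> x = enn2real (local_time_exponent \<mu> x)"

section \<open>The continuous time walk\<close>

definition walk_weight ::
    "'a::metric_space measure \<Rightarrow> ('a \<Rightarrow> real) \<Rightarrow> real \<Rightarrow> 'a \<Rightarrow> real" where
  "walk_weight \<mu> \<beta> r x = ball_mass \<mu> r x * r powr \<beta> x"

text \<open>
  The embedded jump chain and the unit exponential variables are independent; rescaling the latter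
  gives an exponentially distributed holding time of mean \<open>r powr \<beta> x\<close> in the state \<open>x\<close>.
\<close>

definition walk_law ::
    "'a::metric_space measure \<Rightarrow> ('a \<Rightarrow> real) \<Rightarrow> real \<Rightarrow> 'a \<Rightarrow> 'a cadlag measure" where
  "walk_law \<mu> \<beta> r x =
     distr
       (chain_law (step_kernel \<mu> (walk_weight \<mu> \<beta> r) r) x \<Otimes>\<^sub>M
         Pi\<^sub>M UNIV (\<lambda>_. density lborel (exponential_density 1)))
       borel
       (\<lambda>(y, e). jump_path (\<lambda>z. r powr \<beta> z) y e)"

definition mean_exit_time ::
    "'a::metric_space measure \<Rightarrow> ('a \<Rightarrow> real) \<Rightarrow> real \<Rightarrow> 'a set \<Rightarrow> 'a \<Rightarrow> ennreal" where
  "mean_exit_time \<mu> \<beta> r B x = (\<integral>\<^sup>+\<omega>. exit_time B \<omega> \<partial>walk_law \<mu> \<beta> r x)"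

definition max_mean_exit_time ::
    "'a::metric_space measure \<Rightarrow> ('a \<Rightarrow> real) \<Rightarrow> real \<Rightarrow> 'a set \<Rightarrow> ennreal" where
  "max_mean_exit_time \<mu> \<beta> r B = (SUP y\<in>B. mean_exit_time \<mu> \<beta> r B y)"

definition strong_variable_time_regular ::
    "'a::metric_space measure \<Rightarrow> ('a \<Rightarrow> real) \<Rightarrow> bool" where
  "strong_variable_time_regular \<mu> \<beta> \<longleftrightarrow>
     (\<exists>C>0. \<exists>r\<^sub>0>0. \<forall>x R r.
        0 < R \<and> R < diameter (UNIV :: 'a set) / 2 \<and> 0 < r \<and> r < min r\<^sub>0 R \<longrightarrow>
          ennreal (1 / C * R powr \<beta> x) \<le> max_mean_exit_time \<mu> \<beta> r (cball x R) \<and>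
          max_mean_exit_time \<mu> \<beta> r (cball x R) \<le> ennreal (C * R powr \<beta> x))"

definition time_comparable ::
    "'a::metric_space measure \<Rightarrow> ('a \<Rightarrow> real) \<Rightarrow> bool" where
  "time_comparable \<mu> \<beta> \<longleftrightarrow>
     (\<exists>R\<^sub>0 r\<^sub>0 c. 0 < R\<^sub>0 \<and> R\<^sub>0 < diameter (UNIV :: 'a set) / 2 \<and>
        0 < r\<^sub>0 \<and> r\<^sub>0 < R\<^sub>0 \<and> 0 < c \<and>
        (\<forall>r x R. 0 < r \<and> r < r\<^sub>0 \<and> 0 < R \<and> R < diameter (UNIV :: 'a set) / 2 \<longrightarrow>
           ennreal c * max_mean_exit_time \<mu> \<beta> r (cball x R)
             \<le> mean_exit_time \<mu> \<beta> r (cball x R) x))"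

end

theory Submission
  imports Defs
begin

text \<open>
  Let \<open>B\<close> be a ball of radius \<open>\<rho>\<close>, \<open>\<phi>\<close> its mean exit time and \<open>\<phi>\<^sup>+ = sup \<phi>\<close>. For \<open>l * \<phi>\<^sup>+ \<ge> 1\<close>, time
  comparability bounds the Laplace transform at \<open>l\<close> of the exit time from \<open>B\<close>, started at the centre, by some
  \<open>q < 1\<close>, because \<open>1 - l * \<phi> / (1 + l * \<phi>\<^sup>+)\<close> is a supersolution of the equation solved by the Laplace transform.
  Leaving a ball of radius \<open>\<epsilon>\<close> requires leaving \<open>M\<close> balls of radius \<open>\<epsilon> / (2 * M)\<close> in succession, which gives
  the bound \<open>q ^ M\<close> at a frequency \<open>l\<close> that, by time regularity, depends on \<open>M\<close> only. Now cut the walk into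
  successive excursions out of \<open>\<epsilon>\<close>-balls. Discounting at a fixed rate, the expected number of excursions
  is at most a geometric series, and each of them is shorter than \<open>1 / l\<close> with probability at most
  \<open>exp 1 * q ^ M\<close>. Hence the moduli of continuity of the walks tend to \<open>0\<close> in probability, uniformly in small \<open>r\<close>.

  The walks restricted to rational times live on the compact metrisable space of maps from the rationals
  to \<open>X\<close>, where a subsequence of their laws converges weakly (by coding the space in the Cantor set and Helly's
  theorem). The moduli of continuity show that the limit is carried by locally uniformly continuous maps and that
  the convergence holds on the path space.
\<close>

section \<open>Weak compactness on compact metric spaces\<close>

text \<open>Regularity and comparability speak of mean exit times only; they bound a Laplace
  transform by some \<open>q < 1\<close> and give no rate. This \<open>q\<close> depends on the
  comparability constant and not on the radius, which is what makes chaining profitable. The price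
  is a frequency that grows with \<open>M\<close>, and charging it over the whole horizon N could
  cost more than \<open>q ^ M\<close> gains. Hence two rates: a low one, obtained with a single
  ball, discounts the time before an excursion starts; the high one is charged only for the
  excursion itself.

  In the limit the obstacle is that evaluation at a fixed time is Borel but not continuous for J1,
  so weak convergence on the product space does not pass to path space by continuous mapping. What
  helps is that jumps are no longer than r: the ordinary modulus of continuity becomes small, not
  merely the J1 modulus, and a path is then uniformly close to a step path read off from finitely
  many rational times.\<close>

lemma cantor_sum_less:
  fixes a b :: "nat \<Rightarrow> real"
  defines "S \<equiv> \<lambda>a. \<Sum>i. 2 * a i / 3 ^ Suc i"
  assumes a: "\<And>i. a i \<in> {0, 1}" and b: "\<And>i. b i \<in> {0, 1}"
    and close: "\<bar>S a - S b\<bar> < 1 / 3 ^ n" and i: "i < n"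
  shows "a i = b i"
proof (rule ccontr)
  assume "a i \<noteq> b i"
  \<comment> \<open>At the first disagreement the digits differ by 2 / 3^(j+1), while all later
    digits together contribute at most 1 / 3^(j+1). The sums are therefore at least 1 / 3^(j+1)
    apart.\<close>
  define j where "j = (LEAST i. a i \<noteq> b i)"
  have j: "a j \<noteq> b j" "\<And>k. k < j \<Longrightarrow> a k = b k" "j \<le> i"
    using LeastI[of "\<lambda>i. a i \<noteq> b i", OF \<open>a i \<noteq> b i\<close>] not_less_Least Least_le[of "\<lambda>i. a i \<noteq> b i", OF \<open>a i \<noteq> b i\<close>]
    unfolding j_def by blast+
  have geo: "summable (\<lambda>i. 2 / 3 ^ Suc i :: real)"
    using summable_mult[OF summable_geometric[of "1/3 :: real"], of "2/3"] by (simp add: power_divide)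
  define d where "d = (\<lambda>i. 2 * (a i - b i) / 3 ^ Suc i)"
  have dle: "\<bar>d i\<bar> \<le> 2 / 3 ^ Suc i" for i
    using a[of i] b[of i] by (auto simp: d_def)
  have sd: "summable d"
    by (rule summable_comparison_test'[OF geo, of 0]) (use dle in auto)
  have sS: "summable (\<lambda>i. 2 * a i / 3 ^ Suc i)" if "\<And>i. a i \<in> {0,1}" for a :: "nat \<Rightarrow> real"
  proof (rule summable_comparison_test'[OF geo, of 0])
    show "norm (2 * a n / 3 ^ Suc n) \<le> 2 / 3 ^ Suc n" for n
      using that[of n] by auto
  qed
  have "S a - S b = suminf d"
    unfolding S_def d_def by (subst suminf_diff[OF sS[OF a] sS[OF b]]) (simp add: field_simps)
  also have "\<dots> = (\<Sum>i. d (i + Suc j)) + (\<Sum>i<Suc j. d i)"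
    by (rule suminf_split_initial_segment[OF sd])
  also have "(\<Sum>i<Suc j. d i) = d j"
    using j(2) by (simp add: d_def)
  finally have eq: "S a - S b = (\<Sum>i. d (i + Suc j)) + d j" .
  have "\<bar>\<Sum>i. d (i + Suc j)\<bar> \<le> (\<Sum>i. 2 / 3 ^ Suc (i + Suc j))"
  proof -
    have s: "summable (\<lambda>i. 2 / 3 ^ Suc (i + Suc j) :: real)"
      using summable_ignore_initial_segment[OF geo, of "Suc j"] by simp
    have s2: "summable (\<lambda>i. \<bar>d (i + Suc j)\<bar>)"
    proof (rule summable_comparison_test'[OF s, of 0])
      show "norm \<bar>d (n + Suc j)\<bar> \<le> 2 / 3 ^ Suc (n + Suc j)" for n
        using dle[of "n + Suc j"] by simp
    qed
    have "\<bar>\<Sum>i. d (i + Suc j)\<bar> \<le> (\<Sum>i. \<bar>d (i + Suc j)\<bar>)"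
      by (rule summable_rabs[OF s2])
    also have "\<dots> \<le> (\<Sum>i. 2 / 3 ^ Suc (i + Suc j))"
      by (rule suminf_le[OF dle s2 s])
    finally show ?thesis .
  qed
  also have "(\<Sum>i. 2 / 3 ^ Suc (i + Suc j)) = (1 / 3 ^ Suc j :: real)"
  proof -
    have "(\<lambda>i. 2 / 3 ^ (Suc (Suc j)) * (1/3 :: real) ^ i) sums (2 / 3 ^ (Suc (Suc j)) * (1 / (1 - 1/3)))"
      by (intro sums_mult geometric_sums) auto
    then have "(\<lambda>i. 2 / 3 ^ Suc (i + Suc j)) sums (1 / 3 ^ Suc j :: real)"
      by (simp add: power_add power_divide mult.assoc mult.commute mult.left_commute)
    then show ?thesis by (rule sums_unique[symmetric])
  qed
  finally have 1: "\<bar>\<Sum>i. d (i + Suc j)\<bar> \<le> 1 / 3 ^ Suc j" .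
  have 2: "\<bar>d j\<bar> = 2 / 3 ^ Suc j"
    using j(1) a[of j] b[of j] by (auto simp: d_def)
  have "1 / 3 ^ Suc j \<le> \<bar>S a - S b\<bar>"
    using eq 1 2 by (simp add: abs_if split: if_splits)
  moreover have "(1 / 3 ^ n :: real) \<le> 1 / 3 ^ Suc j"
    using i j(3) by (intro divide_left_mono power_increasing) auto
  ultimately show False using close by linarith
qed

text \<open>The ternary code of the membership of \<open>x\<close> in the sets of a countable base: nearby codes agree on
  finitely many base sets, among them a cover by small ones.\<close>

lemma compact_Borel_real_code:
  assumes "compact (UNIV :: 'b::polish_space set)"
  obtains c :: "'b::polish_space \<Rightarrow> real" where "c \<in> borel_measurable borel" "range c \<subseteq> {0..1}"
    "\<And>e. e > 0 \<Longrightarrow> \<exists>d>0. \<forall>x y. \<bar>c x - c y\<bar> < d \<longrightarrow> dist x y < e"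
proof -
  obtain B :: "'b set set" where B: "countable B" "topological_basis B"
    using ex_countable_basis by blast
  \<comment> \<open>Adding the empty set makes the enumerated family nonempty, as
    \<open>from_nat_into\<close> requires.\<close>
  define b where "b = from_nat_into (insert {} B)"
  have rb: "range b = insert {} B"
    unfolding b_def by (rule range_from_nat_into) (use B in auto)
  have ob: "open (b i)" for i
    using rb B(2) topological_basis_open by (metis open_empty insertE rangeI)
  define c where "c = (\<lambda>x. \<Sum>i. 2 * indicator (b i) x / 3 ^ Suc i :: real)"
  have geo: "(\<lambda>i. 2 / 3 ^ Suc i :: real) sums 1"
  proof -
    have "(\<lambda>i. 2 / 3 * (1/3 :: real) ^ i) sums (2 / 3 * (1 / (1 - 1/3)))"
      by (intro sums_mult geometric_sums) auto
    then show ?thesis by (simp add: power_divide)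
  qed
  have le: "2 * indicator (b i) x / 3 ^ Suc i \<le> (2 / 3 ^ Suc i :: real)" for i x
    by (auto simp: indicator_def)
  have sc: "summable (\<lambda>i. 2 * indicator (b i) x / 3 ^ Suc i :: real)" for x
    by (rule summable_comparison_test'[OF sums_summable[OF geo], of 0]) (use le in \<open>auto simp: indicator_def\<close>)
  have "c \<in> borel_measurable borel"
    unfolding c_def using ob
    by (intro borel_measurable_suminf borel_measurable_divide borel_measurable_times
        borel_measurable_indicator borel_measurable_const borel_open)
  moreover have "range c \<subseteq> {0..1}"
  proof -
    have "c x \<le> (\<Sum>i. 2 / 3 ^ Suc i)" for x
      unfolding c_def by (rule suminf_le[OF le sc sums_summable[OF geo]])
    moreover have "0 \<le> c x" for x
      unfolding c_def by (intro suminf_nonneg sc) auto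
    ultimately show ?thesis
      using sums_unique[OF geo] by auto
  qed
  moreover have "\<exists>d>0. \<forall>x y. \<bar>c x - c y\<bar> < d \<longrightarrow> dist x y < e" if e: "e > 0" for e
  proof -
    have "\<exists>i. x \<in> b i \<and> b i \<subseteq> ball x (e/2)" for x
    proof -
      obtain V where "V \<in> B" "x \<in> V" "V \<subseteq> ball x (e/2)"
        using topological_basisE[OF B(2), of "ball x (e/2)" x] e by auto
      then show ?thesis using rb by (metis UNIV_I imageE insertI2)
    qed
    then obtain k where k: "\<And>x. x \<in> b (k x)" "\<And>x. b (k x) \<subseteq> ball x (e/2)"
      by metis
    have "UNIV \<subseteq> \<Union>(range (\<lambda>x. b (k x)))" using k(1) by auto
    then obtain F where F: "F \<subseteq> range (\<lambda>x. b (k x))" "finite F" "UNIV \<subseteq> \<Union>F"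
      by (rule compactE[OF assms]) (use ob in auto)
    then obtain D where D: "finite D" "F = (\<lambda>x. b (k x)) ` D"
      using finite_subset_image[OF F(2), of "\<lambda>x. b (k x)" UNIV] F(1) by auto
    define n where "n = Suc (Max (insert 0 (k ` D)))"
    have kn: "k x < n" if "x \<in> D" for x
      using that D(1) unfolding n_def by (simp add: less_Suc_eq_le)
    have "dist x y < e" if "\<bar>c x - c y\<bar> < 1 / 3 ^ n" for x y
    proof -
      obtain z where z: "z \<in> D" "x \<in> b (k z)" using F(3) D by blast
      have "indicator (b (k z)) x = (indicator (b (k z)) y :: real)"
        using that unfolding c_def
        using kn[OF z(1)]
        by (intro cantor_sum_less[where a = "\<lambda>i. indicator (b i) x" and b = "\<lambda>i. indicator (b i) y" and n = n])
           (auto simp: indicator_def)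
      with z(2) have "y \<in> b (k z)" by (auto simp: indicator_def split: if_splits)
      with z k(2)[of z] have "x \<in> ball z (e/2)" "y \<in> ball z (e/2)" by auto
      then show ?thesis
        using dist_triangle_half_l[of x z e y] by (auto simp: dist_commute)
    qed
    then show ?thesis
      by (intro exI[of _ "1 / 3 ^ n"]) auto
  qed
  ultimately show thesis using that by blast
qed

text \<open>The code is only Borel, but its inverse is uniformly continuous on the range. This is
  the direction that matters: test functions on the space become continuous functions of the code,
  and Helly's theorem on the line suffices.\<close>

theorem weakly_sequentially_compact:
  fixes M :: "nat \<Rightarrow> 'b::polish_space measure"
  assumes comp: "compact (UNIV :: 'b set)"
    and M: "\<And>n. prob_space (M n)" "\<And>n. sets (M n) = sets borel"
  obtains s Q where "strict_mono (s :: nat \<Rightarrow> nat)" "weakly_converges (M \<circ> s) Q"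
proof -
  obtain c :: "'b \<Rightarrow> real" where c[measurable]: "c \<in> borel_measurable borel" and rc: "range c \<subseteq> {0..1}"
    and cu: "\<And>e. e > 0 \<Longrightarrow> \<exists>d>0. \<forall>x y. \<bar>c x - c y\<bar> < d \<longrightarrow> dist x y < e"
    using compact_Borel_real_code[OF comp] by blast
  have inj: "inj c"
  proof (rule injI, rule ccontr)
    fix x y assume "c x = c y" "x \<noteq> y"
    moreover from \<open>x \<noteq> y\<close> obtain d where "0 < d" "\<And>x' y'. \<bar>c x' - c y'\<bar> < d \<Longrightarrow> dist x' y' < dist x y"
      using cu[of "dist x y"] by auto
    ultimately show False by force
  qed
  define K where "K = closure (range c)"
  have Kne: "K \<noteq> {}" by (simp add: K_def)
  have Kcl: "closed K" by (simp add: K_def)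
  have "uniformly_continuous_on (range c) (inv c)"
    unfolding uniformly_continuous_on_def
  proof (intro allI impI)
    fix e :: real assume "e > 0"
    then obtain d where "d > 0" "\<And>x y. \<bar>c x - c y\<bar> < d \<Longrightarrow> dist x y < e" using cu by blast
    then show "\<exists>d>0. \<forall>x\<in>range c. \<forall>x'\<in>range c. dist x' x < d \<longrightarrow> dist (inv c x') (inv c x) < e"
      using inj by (intro exI[of _ d]) (auto simp: dist_real_def)
  qed
  \<comment> \<open>The range need not be closed, so a limit law may charge points outside it; the
    inverse has to be extended to the closure.\<close>
  then obtain g where g: "uniformly_continuous_on K g" "\<And>x. x \<in> range c \<Longrightarrow> inv c x = g x"
    using uniformly_continuous_on_extension_on_closure unfolding K_def by metis
  have gc: "g (c y) = y" for y
    using g(2)[of "c y"] inj by simp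
  have contg: "continuous_on K g" using g(1) by (rule uniformly_continuous_imp_continuous)
  have cK: "c y \<in> K" for y unfolding K_def by (rule closure_subset[THEN subsetD]) simp
  define \<nu> where "\<nu> n = distr (M n) borel c" for n
  have [measurable_cong]: "sets (M n) = sets borel" for n by (rule M(2))
  have rd: "real_distribution (\<nu> n)" for n
    unfolding \<nu>_def by (intro prob_space.real_distribution_distr M(1)) simp
  have "tight \<nu>"
    unfolding tight_def
  proof (intro conjI allI impI rd)
    fix e :: real assume "e > 0"
    have "measure (\<nu> n) {-1<..1} = 1" for n
    proof -
      have "c y \<in> {-1<..1}" for y
        using subsetD[OF rc rangeI[of c y]] by simp
      then have "c -` {-1<..1} = UNIV" by blast
      then show ?thesis
        unfolding \<nu>_def by (subst measure_distr) (auto simp: prob_space.prob_space[OF M(1)])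
    qed
    then show "\<exists>a b::real. a < b \<and> (\<forall>n. measure (\<nu> n) {a<..b} > 1 - e)"
      using \<open>e > 0\<close> by (intro exI[of _ "-1"] exI[of _ 1]) auto
  qed
  then obtain s N where s: "strict_mono s" and N: "real_distribution N" and w: "weak_conv_m (\<nu> \<circ> id \<circ> s) N"
    using tight_imp_convergent_subsubsequence[of \<nu> id] strict_mono_id by blast
  interpret N: real_distribution N by (rule N)
  interpret \<nu>s: real_distribution "(\<nu> \<circ> id \<circ> s) n" for n using rd by simp
  have conv: "(\<lambda>n. integral\<^sup>L (\<nu> (s n)) f) \<longlonglongrightarrow> integral\<^sup>L N f"
    if "continuous_on UNIV f" "\<And>x. \<bar>f x\<bar> \<le> B" for f :: "real \<Rightarrow> real" and B
    using weak_conv_imp_integral_bdd_continuous_conv[OF \<nu>s.real_distribution_axioms N w, of f B] that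
    by (auto simp: continuous_on_eq_continuous_at)
  \<comment> \<open>The truncated distance to \<open>K\<close> is a bounded continuous function
    whose integral vanishes under every image law, hence under the limit.\<close>
  have NK: "AE x in N. x \<in> K"
  proof -
    have ci: "continuous_on UNIV (\<lambda>x. min 1 (infdist x K))" by (intro continuous_intros)
    have "(\<lambda>n. integral\<^sup>L (\<nu> (s n)) (\<lambda>x. min 1 (infdist x K))) \<longlonglongrightarrow> integral\<^sup>L N (\<lambda>x. min 1 (infdist x K))"
    proof (rule conv[OF ci, of 1])
      show "\<bar>min 1 (infdist x K)\<bar> \<le> 1" for x
        using infdist_nonneg[of x K] by linarith
    qed
    moreover have "integral\<^sup>L (\<nu> (s n)) (\<lambda>x. min 1 (infdist x K)) = 0" for n
      unfolding \<nu>_def using cK borel_measurable_continuous_onI[OF ci]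
      by (subst integral_distr) (auto simp: infdist_zero)
    ultimately have "integral\<^sup>L N (\<lambda>x. min 1 (infdist x K)) = 0"
      by (simp add: LIMSEQ_const_iff)
    moreover have "integrable N (\<lambda>x. min 1 (infdist x K))"
    proof (rule N.integrable_const_bound[of _ 1])
      have "norm (min 1 (infdist x K)) \<le> 1" for x
        using infdist_nonneg[of x K] unfolding real_norm_def by linarith
      then show "AE x in N. norm (min 1 (infdist x K)) \<le> 1" by simp
    qed (use borel_measurable_continuous_onI[OF ci] in simp)
    ultimately have "AE x in N. min 1 (infdist x K) = 0"
      by (subst (asm) integral_nonneg_eq_0_iff_AE) (auto simp: infdist_nonneg)
    then show ?thesis
    proof eventually_elim
      case (elim x)
      then have "infdist x K = 0" by (simp add: min_def split: if_splits)
      then show ?case using in_closed_iff_infdist_zero[OF Kcl Kne] by blast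
    qed
  qed
  define \<gamma> where "\<gamma> x = (if x \<in> K then g x else undefined)" for x
  have [measurable]: "\<gamma> \<in> borel \<rightarrow>\<^sub>M borel"
    unfolding \<gamma>_def by (rule borel_measurable_continuous_on_if) (use Kcl contg in auto)
  define Q where "Q = distr N borel \<gamma>"
  have "weakly_converges (M \<circ> s) Q"
    unfolding weakly_converges_def
  proof (intro conjI allI impI)
    show "prob_space ((M \<circ> s) n)" "sets ((M \<circ> s) n) = sets borel" for n
      using M by auto
    show "prob_space Q" unfolding Q_def by (intro N.prob_space_distr) simp
    show "sets Q = sets borel" by (simp add: Q_def)
    fix f :: "'b \<Rightarrow> real" assume f: "continuous_on UNIV f \<and> bounded (range f)"
    then obtain B where B: "\<And>x. \<bar>f x\<bar> \<le> B" by (auto simp: bounded_iff)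
    have B0: "0 \<le> B" using B[of undefined] by linarith
    have fm[measurable]: "f \<in> borel_measurable borel" using f by (intro borel_measurable_continuous_onI) auto
    have "continuous_on K (\<lambda>x. f (g x))"
      by (rule continuous_on_compose2[OF _ contg, of UNIV]) (use f in auto)
    \<comment> \<open>\<open>f\<close> composed with \<open>g\<close> is continuous on the closed
      set \<open>K\<close> only. A Tietze extension is a test function on the line, and all the laws
      involved see it on \<open>K\<close> alone.\<close>
    then obtain F where F: "continuous_on UNIV F" "\<And>x. x \<in> K \<Longrightarrow> F x = f (g x)" "\<And>x. norm (F x) \<le> B"
      using Tietze[of K "\<lambda>x. f (g x)" UNIV B] Kcl B B0 by auto
    have Fm[measurable]: "F \<in> borel_measurable borel" using F(1) by (rule borel_measurable_continuous_onI)
    have "(\<lambda>n. integral\<^sup>L (\<nu> (s n)) F) \<longlonglongrightarrow> integral\<^sup>L N F"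
      by (rule conv[OF F(1)]) (use F(3) in auto)
    moreover have "integral\<^sup>L (\<nu> (s n)) F = integral\<^sup>L (M (s n)) f" for n
      unfolding \<nu>_def by (subst integral_distr) (auto simp: F(2)[OF cK] gc)
    moreover have "integral\<^sup>L N F = integral\<^sup>L N (\<lambda>x. f (\<gamma> x))"
    proof (rule integral_cong_AE)
      show "AE x in N. F x = f (\<gamma> x)"
        using NK by eventually_elim (simp add: F(2) \<gamma>_def)
    qed measurable
    then have "integral\<^sup>L N F = integral\<^sup>L Q f"
      unfolding Q_def by (subst integral_distr) auto
    ultimately show "(\<lambda>n. integral\<^sup>L ((M \<circ> s) n) f) \<longlonglongrightarrow> integral\<^sup>L Q f" by simp
  qed
  with s show thesis by (rule that)
qed

section \<open>Borel structure of the path space\<close>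

lemma path_at_neg: "t < 0 \<Longrightarrow> path_at \<omega> t = path_at \<omega> 0"
  using path_at[of \<omega>] by auto

lemma path_at_right: "0 \<le> t \<Longrightarrow> (path_at \<omega> \<longlongrightarrow> path_at \<omega> t) (at_right t)"
  using path_at[of \<omega>] by (auto simp: continuous_within)

lemma time_changes_nonneg: "l \<in> time_changes \<Longrightarrow> 0 \<le> s \<Longrightarrow> 0 \<le> l s"
  unfolding time_changes_def by auto

text \<open>A small J1 neighbourhood moves the instant s and the value there only slightly; openness
  of \<open>I\<close> absorbs the first shift and openness of \<open>A\<close> the second.\<close>

lemma open_hitting:
  assumes "open I" "open A"
  shows "open {\<omega>. \<exists>s\<ge>0. s \<in> I \<and> path_at \<omega> s \<in> A}"
  unfolding open_cadlag_def
proof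
  fix \<omega> assume "\<omega> \<in> {\<omega>. \<exists>s\<ge>0. s \<in> I \<and> path_at \<omega> s \<in> A}"
  then obtain s where s: "0 \<le> s" "s \<in> I" "path_at \<omega> s \<in> A" by blast
  obtain e1 where e1: "e1 > 0" "ball s e1 \<subseteq> I" using assms(1) s(2) open_contains_ball by blast
  obtain e2 where e2: "e2 > 0" "ball (path_at \<omega> s) e2 \<subseteq> A" using assms(2) s(3) open_contains_ball by blast
  \<comment> \<open>The last term ensures s \<le> 1/e, so that s lies in the window on which
    \<open>J1_nbhd\<close> controls values.\<close>
  define e where "e = min (min (e1/2) (e2/2)) (1 / (1 + s))"
  have e: "0 < e" "e < e1" "e < e2" "s \<le> 1 / e"
  proof -
    show "0 < e" "e < e1" "e < e2" using e1 e2 s(1) by (auto simp: e_def min_less_iff_disj)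
    have "1 / (1 / (1 + s)) \<le> 1 / e"
      using \<open>0 < e\<close> by (intro divide_left_mono) (use s(1) in \<open>auto simp: e_def\<close>)
    then show "s \<le> 1 / e" by simp
  qed
  have "J1_nbhd \<omega> e \<subseteq> {\<omega>. \<exists>s\<ge>0. s \<in> I \<and> path_at \<omega> s \<in> A}"
  proof
    fix \<eta> assume "\<eta> \<in> J1_nbhd \<omega> e"
    then obtain l where l: "l \<in> time_changes" "\<bar>l s - s\<bar> \<le> e" "dist (path_at \<eta> (l s)) (path_at \<omega> s) \<le> e"
      unfolding J1_nbhd_def using s(1) e(4) by auto
    have "l s \<in> ball s e1" "path_at \<eta> (l s) \<in> ball (path_at \<omega> s) e2"
      using l(2,3) e(2,3) by (auto simp: dist_real_def dist_commute)
    with e1(2) e2(2) time_changes_nonneg[OF l(1) s(1)]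
    show "\<eta> \<in> {\<omega>. \<exists>s\<ge>0. s \<in> I \<and> path_at \<omega> s \<in> A}" by blast
  qed
  with e(1) show "\<exists>e>0. J1_nbhd \<omega> e \<subseteq> {\<omega>. \<exists>s\<ge>0. s \<in> I \<and> path_at \<omega> s \<in> A}" by blast
qed

text \<open>Leaving \<open>B\<close> before c means hitting the open complement during an open set
  of times.\<close>

lemma borel_measurable_exit_time:
  assumes "closed B"
  shows "exit_time B \<in> borel_measurable borel"
proof (rule borel_measurableI_less)
  fix c :: ennreal
  have "open {s. ennreal s < c}"
    by (intro open_Collect_less continuous_on_ennreal continuous_on_const continuous_on_id)
  then have "open {\<omega>. \<exists>s\<ge>0. s \<in> {s. ennreal s < c} \<and> path_at \<omega> s \<in> - B}"
    using assms by (intro open_hitting) auto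
  also have "{\<omega>. \<exists>s\<ge>0. s \<in> {s. ennreal s < c} \<and> path_at \<omega> s \<in> - B} = {\<omega> \<in> space borel. exit_time B \<omega> < c}"
    by (auto simp: exit_time_def INF_less_iff)
  finally show "{\<omega> \<in> space borel. exit_time B \<omega> < c} \<in> sets borel" by (rule borel_open)
qed

text \<open>By right continuity the value at t is recovered from visits to open neighbourhoods of
  \<open>F\<close> in short open intervals after t, events covered by \<open>open_hitting\<close>.
  \<open>F\<close> must be nonempty because \<open>infdist\<close> to the empty set is 0.\<close>

lemma path_at_closed_iff:
  fixes F :: "'a::metric_space set"
  assumes F: "closed F" "F \<noteq> {}" and t: "0 \<le> t"
  shows "path_at \<omega> t \<in> F \<longleftrightarrow> (\<forall>m n :: nat. \<exists>s\<ge>0. s \<in> {t<..<t + 1 / Suc n} \<and> path_at \<omega> s \<in> {x. infdist x F < 1 / Suc m})"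
proof
  assume *: "path_at \<omega> t \<in> F"
  show "\<forall>m n :: nat. \<exists>s\<ge>0. s \<in> {t<..<t + 1 / Suc n} \<and> path_at \<omega> s \<in> {x. infdist x F < 1 / Suc m}"
  proof (intro allI)
    fix m n :: nat
    have "eventually (\<lambda>s. dist (path_at \<omega> s) (path_at \<omega> t) < 1 / Suc m) (at_right t)"
      using path_at_right[OF t, of \<omega>] by (rule tendstoD) simp
    moreover have "eventually (\<lambda>s. s \<in> {t<..<t + 1 / Suc n}) (at_right t)"
      by (rule eventually_at_right_real) simp
    ultimately have "eventually (\<lambda>s. s \<in> {t<..<t + 1 / Suc n} \<and> infdist (path_at \<omega> s) F < 1 / Suc m) (at_right t)"
      by eventually_elim (use infdist_le[OF *] in \<open>auto intro: le_less_trans\<close>)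
    then obtain s where "s \<in> {t<..<t + 1 / Suc n}" "infdist (path_at \<omega> s) F < 1 / Suc m"
      using eventually_happens by fastforce
    then show "\<exists>s\<ge>0. s \<in> {t<..<t + 1 / Suc n} \<and> path_at \<omega> s \<in> {x. infdist x F < 1 / Suc m}"
      using t by (intro exI[of _ s]) auto
  qed
next
  assume *: "\<forall>m n :: nat. \<exists>s\<ge>0. s \<in> {t<..<t + 1 / Suc n} \<and> path_at \<omega> s \<in> {x. infdist x F < 1 / Suc m}"
  have "infdist (path_at \<omega> t) F \<le> 0 + e" if e: "e > 0" for e
  proof -
    obtain m :: nat where m: "1 / Suc m < e/2" using nat_approx_posE[of "e/2"] e by auto
    have "eventually (\<lambda>s. dist (path_at \<omega> s) (path_at \<omega> t) < e/2) (at_right t)"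
      using path_at_right[OF t, of \<omega>] by (rule tendstoD) (use e in simp)
    then obtain b where b: "b > t" "\<And>s. t < s \<Longrightarrow> s < b \<Longrightarrow> dist (path_at \<omega> s) (path_at \<omega> t) < e/2"
      unfolding eventually_at_right_field by blast
    obtain n :: nat where n: "1 / Suc n < b - t" using nat_approx_posE[of "b - t"] b by auto
    from * obtain s where s: "s \<in> {t<..<t + 1 / Suc n}" "infdist (path_at \<omega> s) F < 1 / Suc m" by blast
    have "infdist (path_at \<omega> t) F \<le> infdist (path_at \<omega> s) F + dist (path_at \<omega> t) (path_at \<omega> s)"
      by (rule infdist_triangle)
    also have "\<dots> \<le> e"
      using b(2)[of s] s m n by (auto simp: dist_commute)
    finally show ?thesis by simp
  qed
  then have "infdist (path_at \<omega> t) F \<le> 0" by (rule field_le_epsilon)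
  then have "infdist (path_at \<omega> t) F = 0" using infdist_nonneg[of "path_at \<omega> t" F] by linarith
  then show "path_at \<omega> t \<in> F" using F in_closed_iff_infdist_zero by blast
qed

lemma measurable_path_at [measurable]:
  "(\<lambda>\<omega> :: 'a::metric_space cadlag. path_at \<omega> t) \<in> borel \<rightarrow>\<^sub>M borel"
proof -
  have *: "(\<lambda>\<omega> :: 'a cadlag. path_at \<omega> t) \<in> borel \<rightarrow>\<^sub>M borel" if t: "0 \<le> t" for t
  proof (rule borel_measurableI)
    fix S :: "'a set" assume S: "open S"
    show "(\<lambda>\<omega>. path_at \<omega> t) -` S \<inter> space borel \<in> sets borel"
    proof (cases "S = UNIV")
      case True then show ?thesis by simp
    next
      case False
      define F where "F = - S"
      have F: "closed F" "F \<noteq> {}" using S False by (auto simp: F_def)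
      have "{\<omega>. path_at \<omega> t \<in> F} = (\<Inter>m. \<Inter>n. {\<omega>. \<exists>s\<ge>0. s \<in> {t<..<t + 1 / real (Suc n)} \<and> path_at \<omega> s \<in> {x. infdist x F < 1 / real (Suc m)}})"
        using path_at_closed_iff[OF F t] by auto
      moreover have "open {\<omega>. \<exists>s\<ge>0. s \<in> {t<..<t + 1 / real (Suc n)} \<and> path_at \<omega> s \<in> {x. infdist x F < 1 / real (Suc m)}}" for m n
        by (intro open_hitting open_greaterThanLessThan open_Collect_less continuous_intros)
      ultimately have "{\<omega>. path_at \<omega> t \<in> F} \<in> sets borel"
        by (auto intro!: sets.countable_INT borel_open)
      then have "- {\<omega>. path_at \<omega> t \<in> F} \<in> sets borel" by (rule borel_comp)
      moreover have "- {\<omega>. path_at \<omega> t \<in> F} = (\<lambda>\<omega>. path_at \<omega> t) -` S \<inter> space borel"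
        by (auto simp: F_def)
      ultimately show ?thesis by simp
    qed
  qed
  show ?thesis
  proof (cases "0 \<le> t")
    case False
    then have "(\<lambda>\<omega> :: 'a cadlag. path_at \<omega> t) = (\<lambda>\<omega>. path_at \<omega> 0)" by (intro ext path_at_neg) simp
    then show ?thesis using *[of 0] by simp
  qed (rule *)
qed

section \<open>Restriction to rational times and moduli of continuity\<close>

definition on_rats :: "'a::metric_space cadlag \<Rightarrow> rat \<Rightarrow> 'a" where
  "on_rats \<omega> q = path_at \<omega> (of_rat q)"

lemma measurable_on_rats [measurable]:
  "(on_rats :: 'a::polish_space cadlag \<Rightarrow> _) \<in> borel \<rightarrow>\<^sub>M borel"
  unfolding on_rats_def[abs_def] by (rule measurable_coordinatewise_then_product) measurable

text \<open>The complement says that the modulus of continuity on [0,N] at scale d is at most e. The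
  strict inequality \<open>e < dist (x p) (x q)\<close> makes the set open, so that bounds on its
  probability survive weak limits.\<close>

definition oscillating :: "nat \<Rightarrow> real \<Rightarrow> real \<Rightarrow> (rat \<Rightarrow> 'a::metric_space) set" where
  "oscillating N d e = {x. \<exists>p q. 0 \<le> p \<and> 0 \<le> q \<and> p \<le> of_nat N \<and> q \<le> of_nat N \<and>
     \<bar>of_rat p - of_rat q\<bar> < d \<and> e < dist (x p) (x q)}"

lemma open_oscillating: "open (oscillating N d e)"
proof -
  have "open {x :: rat \<Rightarrow> 'a. e < dist (x p) (x q)}" for p q
    by (intro open_Collect_less continuous_intros continuous_on_product_coordinates)
  then have "open (\<Union>(p, q)\<in>{(p, q). 0 \<le> p \<and> 0 \<le> q \<and> p \<le> of_nat N \<and> q \<le> of_nat N \<and>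
     \<bar>of_rat p - of_rat q\<bar> < d}. {x :: rat \<Rightarrow> 'a. e < dist (x p) (x q)})"
    by (intro open_UN) auto
  also have "\<dots> = oscillating N d e"
    by (auto simp: oscillating_def)
  finally show ?thesis .
qed

lemma sets_oscillating [measurable]: "oscillating N d e \<in> sets borel"
  by (intro borel_open open_oscillating)

lemma oscillating_mono: "d \<le> d' \<Longrightarrow> e' \<le> e \<Longrightarrow> oscillating N d e \<subseteq> oscillating N d' e'"
  unfolding oscillating_def by (auto, meson le_less_trans less_le_trans)

lemma not_oscillatingD:
  assumes "x \<notin> oscillating N d e" "0 \<le> p" "0 \<le> q" "p \<le> of_nat N" "q \<le> of_nat N" "\<bar>of_rat p - of_rat q\<bar> < d"
  shows "dist (x p) (x q) \<le> e"
  using assms unfolding oscillating_def by force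

definition locally_unif_cont :: "(rat \<Rightarrow> 'a::metric_space) set" where
  "locally_unif_cont = {x. \<forall>N k. \<exists>m. x \<notin> oscillating N (1 / real (Suc m)) (1 / real (Suc k))}"

lemma sets_locally_unif_cont [measurable]: "locally_unif_cont \<in> sets borel"
proof -
  have "locally_unif_cont = (\<Inter>N k. \<Union>m. - oscillating N (1 / real (Suc m)) (1 / real (Suc k)))"
    by (auto simp: locally_unif_cont_def)
  also have "\<dots> \<in> sets borel"
    by (intro sets.countable_INT sets.countable_UN image_subsetI borel_comp sets_oscillating) auto
  finally show ?thesis .
qed

lemma locally_unif_contE:
  assumes "x \<in> locally_unif_cont" "e > 0"
  obtains d where "d > 0" "x \<notin> oscillating N d e"
proof -
  obtain k :: nat where k: "1 / Suc k < e" using nat_approx_posE assms(2) by blast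
  obtain m where "x \<notin> oscillating N (1 / real (Suc m)) (1 / real (Suc k))"
    using assms(1) unfolding locally_unif_cont_def by blast
  then show thesis
    using k oscillating_mono[of "1 / real (Suc m)" "1 / real (Suc m)" "1 / real (Suc k)" e N]
    by (intro that[of "1 / real (Suc m)"]) auto
qed

lemma locally_unif_contI:
  assumes "\<And>N e. e > 0 \<Longrightarrow> \<exists>d>0. x \<notin> oscillating N d e"
  shows "x \<in> locally_unif_cont"
  unfolding locally_unif_cont_def
proof (intro CollectI allI)
  fix N k
  obtain d where d: "d > 0" "x \<notin> oscillating N d (1 / real (Suc k))"
    using assms[of "1 / real (Suc k)" N] by auto
  obtain m :: nat where "1 / Suc m < d" using nat_approx_posE d(1) by blast
  then show "\<exists>m. x \<notin> oscillating N (1 / real (Suc m)) (1 / real (Suc k))"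
    using oscillating_mono[of "1 / real (Suc m)" d "1 / real (Suc k)" "1 / real (Suc k)" N] d(2)
    by (intro exI[of _ m]) auto
qed

section \<open>Step paths on grids and continuous extensions\<close>

definition grid :: "nat \<Rightarrow> real \<Rightarrow> rat" where
  "grid m t = of_int \<lfloor>max 0 t * real (Suc m)\<rfloor> / of_nat (Suc m)"

lemma of_rat_grid: "(of_rat (grid m t) :: real) = of_int \<lfloor>max 0 t * real (Suc m)\<rfloor> / real (Suc m)"
  by (simp add: grid_def of_rat_divide of_rat_add)

lemma grid_nonneg: "0 \<le> grid m t"
  by (simp add: grid_def)

lemma grid_le: "0 \<le> t \<Longrightarrow> of_rat (grid m t) \<le> t"
  unfolding of_rat_grid by (subst pos_divide_le_eq) auto

lemma grid_gt: "0 \<le> t \<Longrightarrow> t < of_rat (grid m t) + 1 / real (Suc m)"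
proof -
  assume "0 \<le> t"
  have "t * real (Suc m) < of_int \<lfloor>t * real (Suc m)\<rfloor> + 1" by linarith
  then show ?thesis
    using \<open>0 \<le> t\<close> unfolding of_rat_grid add_divide_distrib[symmetric] by (subst pos_less_divide_eq) auto
qed

lemma grid_le_nat: "0 \<le> t \<Longrightarrow> t \<le> real N \<Longrightarrow> grid m t \<le> of_nat N"
proof -
  assume "0 \<le> t" "t \<le> real N"
  then have "(of_rat (grid m t) :: real) \<le> of_rat (of_nat N)" using grid_le[of t m] by simp
  then show ?thesis by (simp only: of_rat_less_eq)
qed

lemma cadlag_grid:
  fixes x :: "rat \<Rightarrow> 'a::metric_space" and m :: nat
  defines "f \<equiv> \<lambda>t. x (grid m t)"
  shows "(\<forall>t<0. f t = f 0) \<and> (\<forall>t\<ge>0. continuous (at_right t) f) \<and>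
    (\<forall>t>0. \<exists>l. (f \<longlongrightarrow> l) (at_left t))"
proof (intro conjI allI impI)
  show "f t = f 0" if "t < 0" for t using that by (simp add: f_def grid_def)
next
  fix t :: real assume t: "0 \<le> t"
  define b where "b = (of_int \<lfloor>t * real (Suc m)\<rfloor> + 1) / real (Suc m)"
  have tb: "t < b"
    unfolding b_def by (subst pos_less_divide_eq) linarith+
  have "eventually (\<lambda>s. f s = f t) (at_right t)"
    unfolding eventually_at_right[OF tb]
  proof (intro exI[of _ b] conjI tb allI impI)
    fix s assume s: "t < s" "s < b"
    then have "s * real (Suc m) < of_int \<lfloor>t * real (Suc m)\<rfloor> + 1"
      unfolding b_def by (subst (asm) pos_less_divide_eq) auto
    moreover have "t * real (Suc m) \<le> s * real (Suc m)"
      using s by (intro mult_right_mono) auto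
    ultimately have "\<lfloor>s * real (Suc m)\<rfloor> = \<lfloor>t * real (Suc m)\<rfloor>"
      by linarith
    then show "f s = f t" using s t by (simp add: f_def grid_def)
  qed
  then show "continuous (at_right t) f"
    unfolding continuous_within by (simp add: tendsto_eventually)
next
  fix t :: real assume t: "0 < t"
  \<comment> \<open>Just before t the floor equals the ceiling at t minus 1, also when t itself is a
    grid point.\<close>
  define c where "c = \<lceil>t * real (Suc m)\<rceil> - 1"
  have "0 < t * real (Suc m)" using t by simp
  then have c0: "0 \<le> c" unfolding c_def by linarith
  define b where "b = of_int c / real (Suc m)"
  have b0: "0 \<le> b" using c0 by (simp add: b_def)
  have bt: "b < t"
    unfolding b_def c_def by (subst pos_divide_less_eq) linarith+
  have "eventually (\<lambda>s. f s = x (of_int c / of_nat (Suc m))) (at_left t)"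
    unfolding eventually_at_left[OF bt]
  proof (intro exI[of _ b] conjI bt allI impI)
    fix s assume s: "b < s" "s < t"
    then have "of_int c < s * real (Suc m)"
      unfolding b_def by (subst (asm) pos_divide_less_eq) auto
    moreover have "s * real (Suc m) < t * real (Suc m)"
      using s by (intro mult_strict_right_mono) auto
    ultimately have "\<lfloor>s * real (Suc m)\<rfloor> = c"
      unfolding c_def by linarith
    then show "f s = x (of_int c / of_nat (Suc m))" using s b0 by (simp add: f_def grid_def)
  qed
  then show "\<exists>l. (f \<longlongrightarrow> l) (at_left t)"
    by (intro exI[of _ "x (of_int c / of_nat (Suc m))"]) (simp add: tendsto_eventually)
qed

lift_definition step_path :: "nat \<Rightarrow> (rat \<Rightarrow> 'a::metric_space) \<Rightarrow> 'a cadlag" is "\<lambda>m x t. x (grid m t)"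
  by (rule cadlag_grid)

lemma cadlag_continuous:
  fixes f :: "real \<Rightarrow> 'a::metric_space"
  assumes f: "continuous_on {0..} f"
  defines "g \<equiv> \<lambda>t. f (max 0 t)"
  shows "(\<forall>t<0. g t = g 0) \<and> (\<forall>t\<ge>0. continuous (at_right t) g) \<and>
    (\<forall>t>0. \<exists>l. (g \<longlongrightarrow> l) (at_left t))"
proof -
  have "continuous_on UNIV g"
    unfolding g_def by (rule continuous_on_compose2[OF f]) (auto intro!: continuous_intros)
  then have g: "continuous (at t within A) g" for t A
    by (meson UNIV_I continuous_on_eq_continuous_within continuous_within_subset subset_UNIV)
  then show ?thesis
    by (intro conjI allI impI exI[of _ "g _"]) (simp_all add: continuous_within, simp add: g_def)
qed

text \<open>The value at t is the limit along grid points approaching t from below. These stay in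
  [0,N] together with t, so one modulus bound gives the Cauchy property, continuity of the limit and
  agreement at rationals.\<close>

lemma locally_unif_cont_extension:
  fixes x :: "rat \<Rightarrow> 'a::complete_space"
  assumes x: "x \<in> locally_unif_cont"
  obtains \<omega> where "continuous_on {0..} (path_at \<omega>)" "\<And>q. 0 \<le> q \<Longrightarrow> on_rats \<omega> q = x q"
proof -
  have close: "\<exists>d>0. \<forall>s t m n. 0 \<le> s \<longrightarrow> 0 \<le> t \<longrightarrow> s \<le> real N \<longrightarrow> t \<le> real N \<longrightarrow>
      \<bar>s - t\<bar> + 1 / real (Suc m) + 1 / real (Suc n) < d \<longrightarrow> dist (x (grid m s)) (x (grid n t)) \<le> e" if "e > 0" for N e
  proof -
    obtain d where d: "d > 0" "x \<notin> oscillating N d e"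
      using locally_unif_contE[OF x \<open>e > 0\<close>] by blast
    have "dist (x (grid m s)) (x (grid n t)) \<le> e"
      if "0 \<le> s" "0 \<le> t" "s \<le> real N" "t \<le> real N" "\<bar>s - t\<bar> + 1 / real (Suc m) + 1 / real (Suc n) < d" for s t m n
    proof (rule not_oscillatingD[OF d(2)])
      show "\<bar>of_rat (grid m s) - of_rat (grid n t)\<bar> < d"
        using that(5) grid_le[OF that(1), of m] grid_gt[OF that(1), of m] grid_le[OF that(2), of n] grid_gt[OF that(2), of n]
        unfolding abs_less_iff by linarith
    qed (use that in \<open>auto intro: grid_nonneg grid_le_nat\<close>)
    with d(1) show ?thesis by blast
  qed
  have small: "\<exists>M. \<forall>m\<ge>M. 1 / real (Suc m) < d" if "d > 0" for d :: real
  proof -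
    obtain M :: nat where "1 / Suc M < d" using nat_approx_posE \<open>d > 0\<close> by blast
    moreover have "1 / real (Suc m) \<le> 1 / real (Suc M)" if "m \<ge> M" for m
      using that by (intro divide_left_mono) auto
    ultimately show ?thesis by (meson le_less_trans)
  qed
  have Cau: "Cauchy (\<lambda>m. x (grid m t))" if "0 \<le> t" for t
  proof (rule metric_CauchyI)
    fix e :: real assume "e > 0"
    obtain N :: nat where N: "t \<le> real N" using real_arch_simple by blast
    obtain d where d: "d > 0" "\<And>s t m n. 0 \<le> s \<Longrightarrow> 0 \<le> t \<Longrightarrow> s \<le> real N \<Longrightarrow> t \<le> real N \<Longrightarrow>
      \<bar>s - t\<bar> + 1 / real (Suc m) + 1 / real (Suc n) < d \<Longrightarrow> dist (x (grid m s)) (x (grid n t)) \<le> e/2"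
      using close[of "e/2" N] \<open>e > 0\<close> by auto
    obtain M where M: "\<And>m. m \<ge> M \<Longrightarrow> 1 / real (Suc m) < d/2" using small[of "d/2"] d(1) by auto
    show "\<exists>M. \<forall>m\<ge>M. \<forall>n\<ge>M. dist (x (grid m t)) (x (grid n t)) < e"
    proof (intro exI[of _ M] allI impI)
      fix m n assume "m \<ge> M" "n \<ge> M"
      then have "\<bar>t - t\<bar> + 1 / real (Suc m) + 1 / real (Suc n) < d" using M[of m] M[of n] by linarith
      then have "dist (x (grid m t)) (x (grid n t)) \<le> e/2" by (intro d(2) that N)
      then show "dist (x (grid m t)) (x (grid n t)) < e" using \<open>e > 0\<close> by linarith
    qed
  qed
  define L where "L t = lim (\<lambda>m. x (grid m t))" for t
  have L: "(\<lambda>m. x (grid m t)) \<longlonglongrightarrow> L t" if "0 \<le> t" for t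
    unfolding L_def using Cau[OF that] Cauchy_convergent_iff convergent_LIMSEQ_iff by blast
  have "continuous_on {0..} L"
    unfolding continuous_on_iff
  proof (intro ballI allI impI)
    fix s e :: real assume s: "s \<in> {0..}" and e: "0 < e"
    obtain N :: nat where N: "s + 1 \<le> real N" using real_arch_simple by blast
    obtain d where d: "d > 0" "\<And>s t m n. 0 \<le> s \<Longrightarrow> 0 \<le> t \<Longrightarrow> s \<le> real N \<Longrightarrow> t \<le> real N \<Longrightarrow>
      \<bar>s - t\<bar> + 1 / real (Suc m) + 1 / real (Suc n) < d \<Longrightarrow> dist (x (grid m s)) (x (grid n t)) \<le> e/2"
      using close[of "e/2" N] \<open>e > 0\<close> by auto
    obtain M where M: "\<And>m. m \<ge> M \<Longrightarrow> 1 / real (Suc m) < d/4" using small[of "d/4"] d(1) by auto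
    show "\<exists>d>0. \<forall>t\<in>{0..}. dist t s < d \<longrightarrow> dist (L t) (L s) < e"
    proof (intro exI[of _ "min 1 (d/4)"] conjI ballI impI)
      fix t assume t: "t \<in> {0..}" "dist t s < min 1 (d/4)"
      have "dist (L t) (L s) \<le> e/2"
      proof (rule tendsto_upperbound)
        show "(\<lambda>m. dist (x (grid m t)) (x (grid m s))) \<longlonglongrightarrow> dist (L t) (L s)"
          using s t by (intro tendsto_dist L) auto
        show "\<forall>\<^sub>F m in sequentially. dist (x (grid m t)) (x (grid m s)) \<le> e/2"
          unfolding eventually_sequentially
        proof (intro exI[of _ M] allI impI)
          fix m assume "M \<le> m"
          then have "\<bar>t - s\<bar> + 1 / real (Suc m) + 1 / real (Suc m) < d"
            using M[of m] t d(1) unfolding dist_real_def by linarith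
          then show "dist (x (grid m t)) (x (grid m s)) \<le> e/2"
            using t s N by (intro d(2)) (auto simp: dist_real_def)
        qed
      qed simp
      then show "dist (L t) (L s) < e" using e by linarith
    qed (use d in auto)
  qed
  note cL = this
  define \<omega> where "\<omega> = Cadlag (\<lambda>t. L (max 0 t))"
  have p\<omega>: "path_at \<omega> t = L (max 0 t)" for t
    unfolding \<omega>_def using cadlag_continuous[OF cL] by (subst Cadlag_inverse) auto
  show thesis
  proof (rule that[of \<omega>])
    show "continuous_on {0..} (path_at \<omega>)"
      using cL by (simp add: p\<omega>[abs_def] cong: continuous_on_cong_simp)
    fix q :: rat assume q: "0 \<le> q"
    obtain N :: nat where N: "of_rat q \<le> real N" using real_arch_simple by blast
    have "(\<lambda>m. x (grid m (of_rat q))) \<longlonglongrightarrow> x q"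
    proof (rule metric_LIMSEQ_I)
      fix e :: real assume e: "0 < e"
      obtain d where d: "d > 0" "x \<notin> oscillating N d (e/2)"
        using locally_unif_contE[OF x, of "e/2" N] e by auto
      obtain M where M: "\<And>m. m \<ge> M \<Longrightarrow> 1 / real (Suc m) < d" using small[of d] d(1) by auto
      have "q \<le> of_nat N"
        using N by (metis of_rat_less_eq of_rat_of_nat_eq)
      have q0: "(0::real) \<le> of_rat q" using q by simp
      have "dist (x (grid m (of_rat q))) (x q) \<le> e/2" if "m \<ge> M" for m
      proof (rule not_oscillatingD[OF d(2)])
        show "\<bar>of_rat (grid m (of_rat q)) - of_rat q\<bar> < d"
          using M[OF that] grid_le[OF q0, of m] grid_gt[OF q0, of m]
          unfolding abs_less_iff by linarith
      qed (use q N \<open>q \<le> of_nat N\<close> in \<open>auto intro: grid_nonneg grid_le_nat\<close>)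
      then show "\<exists>M. \<forall>m\<ge>M. dist (x (grid m (of_rat q))) (x q) < e"
        using e by (intro exI[of _ M]) (auto intro: le_less_trans[of _ "e/2"])
    qed
    then show "on_rats \<omega> q = x q"
      unfolding on_rats_def p\<omega> using L[of "of_rat q"] q LIMSEQ_unique by (auto simp: max_def)
  qed
qed

section \<open>Weak convergence to a law on continuous paths\<close>

text \<open>A metric for locally uniform convergence. Since this is finer than J1 convergence, it can replace a
  metric for J1 wherever a path is compared with its discretisation on a grid.\<close>

definition udist :: "'a::metric_space cadlag \<Rightarrow> 'a cadlag \<Rightarrow> real" where
  "udist \<omega> \<eta> = (SUP t\<in>{0..}. min (dist (path_at \<omega> t) (path_at \<eta> t)) (1 / (1 + t)))"

lemma bdd_above_udist: "bdd_above ((\<lambda>t. min (dist (path_at \<omega> t) (path_at \<eta> t)) (1 / (1 + t))) ` {0..})"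
  by (rule bdd_aboveI[of _ 1]) (auto simp: min_le_iff_disj)

lemma udist_upper: "0 \<le> t \<Longrightarrow> min (dist (path_at \<omega> t) (path_at \<eta> t)) (1 / (1 + t)) \<le> udist \<omega> \<eta>"
  unfolding udist_def by (rule cSUP_upper[OF _ bdd_above_udist]) simp

lemma udist_least:
  "(\<And>t. 0 \<le> t \<Longrightarrow> min (dist (path_at \<omega> t) (path_at \<eta> t)) (1 / (1 + t)) \<le> c) \<Longrightarrow> udist \<omega> \<eta> \<le> c"
  unfolding udist_def by (rule cSUP_least) auto

lemma udist_nonneg: "0 \<le> udist \<omega> \<eta>"
  by (rule order_trans[OF _ udist_upper[of 0]]) auto

lemma udist_self: "udist \<omega> \<omega> = 0"
  by (intro antisym udist_nonneg udist_least) auto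

lemma udist_commute: "udist \<omega> \<eta> = udist \<eta> \<omega>"
  by (simp add: udist_def dist_commute)

lemma min_add_le:
  fixes a b c w :: real
  assumes "a \<le> b + c" "0 \<le> b" "0 \<le> c" "0 \<le> w"
  shows "min a w \<le> min b w + min c w"
  using assms by linarith

lemma udist_triangle: "udist \<omega> \<zeta> \<le> udist \<omega> \<eta> + udist \<eta> \<zeta>"
proof (rule udist_least)
  fix t :: real assume t: "0 \<le> t"
  have "min (dist (path_at \<omega> t) (path_at \<zeta> t)) (1 / (1 + t)) \<le>
    min (dist (path_at \<omega> t) (path_at \<eta> t)) (1 / (1 + t)) + min (dist (path_at \<eta> t) (path_at \<zeta> t)) (1 / (1 + t))"
    using t by (intro min_add_le dist_triangle) auto
  also have "\<dots> \<le> udist \<omega> \<eta> + udist \<eta> \<zeta>"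
    using udist_upper[OF t] by (intro add_mono)
  finally show "min (dist (path_at \<omega> t) (path_at \<zeta> t)) (1 / (1 + t)) \<le> udist \<omega> \<eta> + udist \<eta> \<zeta>" .
qed

lemma udist_le_max:
  assumes "\<And>t. 0 \<le> t \<Longrightarrow> t < real N \<Longrightarrow> dist (path_at \<omega> t) (path_at \<eta> t) \<le> e"
  shows "udist \<omega> \<eta> \<le> max e (1 / (1 + real N))"
proof (rule udist_least)
  fix t :: real assume t: "0 \<le> t"
  show "min (dist (path_at \<omega> t) (path_at \<eta> t)) (1 / (1 + t)) \<le> max e (1 / (1 + real N))"
  proof (cases "t < real N")
    case True then show ?thesis using assms[OF t] by (auto simp: min_le_iff_disj le_max_iff_disj)
  next
    case False
    then have "1 / (1 + t) \<le> 1 / (1 + real N)" by (intro divide_left_mono) auto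
    then show ?thesis by (auto simp: min_le_iff_disj le_max_iff_disj)
  qed
qed

text \<open>The threshold e/(1+e) is the weight 1/(1+t) at the end t = 1/e of the window of
  \<open>J1_nbhd\<close>. Below it the truncation is inactive on the whole window, and the identity
  serves as time change.\<close>

lemma udist_small_J1_nbhd:
  assumes e: "0 < e" and u: "udist \<omega> \<eta> < e / (1 + e)"
  shows "\<eta> \<in> J1_nbhd \<omega> e"
proof -
  have "dist (path_at \<eta> s) (path_at \<omega> s) \<le> e" if s: "s \<in> {0..1/e}" for s
  proof -
    have s0: "0 \<le> s" "s \<le> 1/e" using s by auto
    have "e / (1 + e) = 1 / (1 + 1/e)" using e by (simp add: field_simps)
    also have "\<dots> \<le> 1 / (1 + s)" using s0 by (intro divide_left_mono) (auto simp: add_pos_nonneg)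
    finally have "min (dist (path_at \<omega> s) (path_at \<eta> s)) (1 / (1 + s)) < 1 / (1 + s)"
      using udist_upper[OF s0(1), of \<omega> \<eta>] u by linarith
    then have "dist (path_at \<omega> s) (path_at \<eta> s) < e / (1 + e)"
      using udist_upper[OF s0(1), of \<omega> \<eta>] u by (auto simp: min_def split: if_splits)
    also have "\<dots> \<le> e" using e by (simp add: field_simps)
    finally show ?thesis by (simp add: dist_commute)
  qed
  then show ?thesis
    unfolding J1_nbhd_def using e
    by (auto intro!: bexI[of _ "\<lambda>s. s"] simp: time_changes_def strict_mono_on_def)
qed

text \<open>Composed with \<^const>\<open>step_path\<close>, this Lipschitz regularisation depends continuously on finitely many
  values of the path, up to a small error. It gives both Borel measurability of maps into the path space and
  the lower bound in the weak convergence criterion.\<close>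

definition infconv :: "('a::metric_space cadlag \<Rightarrow> real) \<Rightarrow> nat \<Rightarrow> 'a cadlag \<Rightarrow> real" where
  "infconv f n \<omega> = (INF \<eta>. f \<eta> + real n * udist \<omega> \<eta>)"

context
  fixes f :: "'a::metric_space cadlag \<Rightarrow> real"
  assumes f01: "\<And>\<omega>. 0 \<le> f \<omega>" "\<And>\<omega>. f \<omega> \<le> 1"
begin

lemma bdd_below_infconv: "bdd_below (range (\<lambda>\<eta>. f \<eta> + real n * udist \<omega> \<eta>))"
  by (rule bdd_belowI[of _ 0]) (auto intro!: add_nonneg_nonneg f01 mult_nonneg_nonneg udist_nonneg)

lemma infconv_lower: "infconv f n \<omega> \<le> f \<eta> + real n * udist \<omega> \<eta>"
  unfolding infconv_def by (rule cINF_lower[OF bdd_below_infconv]) simp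

lemma infconv_le: "infconv f n \<omega> \<le> f \<omega>"
  using infconv_lower[of n \<omega> \<omega>] by (simp add: udist_self)

lemma infconv_nonneg: "0 \<le> infconv f n \<omega>"
  unfolding infconv_def
  by (rule cINF_greatest) (auto intro!: add_nonneg_nonneg f01 mult_nonneg_nonneg udist_nonneg)

lemma infconv_le_1: "infconv f n \<omega> \<le> 1"
  using infconv_le f01(2) order_trans by blast

lemma infconv_Lipschitz: "infconv f n \<omega> \<le> infconv f n \<eta> + real n * udist \<omega> \<eta>"
proof -
  have "infconv f n \<omega> - real n * udist \<omega> \<eta> \<le> infconv f n \<eta>"
    unfolding infconv_def[of f n \<eta>]
  proof (rule cINF_greatest)
    fix \<zeta>
    have "infconv f n \<omega> \<le> f \<zeta> + real n * udist \<omega> \<zeta>" by (rule infconv_lower)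
    also have "\<dots> \<le> f \<zeta> + real n * (udist \<omega> \<eta> + udist \<eta> \<zeta>)"
      by (intro add_left_mono mult_left_mono udist_triangle) simp
    finally show "infconv f n \<omega> - real n * udist \<omega> \<eta> \<le> f \<zeta> + real n * udist \<eta> \<zeta>"
      by (simp add: algebra_simps)
  qed simp
  then show ?thesis by simp
qed

lemma infconv_Lipschitz_abs: "\<bar>infconv f n \<omega> - infconv f n \<eta>\<bar> \<le> real n * udist \<omega> \<eta>"
  using infconv_Lipschitz[of n \<omega> \<eta>] infconv_Lipschitz[of n \<eta> \<omega>] by (simp add: udist_commute abs_le_iff)

text \<open>Paths close to \<omega> in \<open>udist\<close> are J1-close, so \<open>f\<close>
  exceeds c there by semicontinuity. For all others the penalty is at least 1 once n \<ge> (1+e)/e,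
  and c is below 1.\<close>

lemma infconv_tendsto:
  assumes lsc: "\<And>c. open {\<omega>. c < f \<omega>}"
  shows "(\<lambda>n. infconv f n \<omega>) \<longlonglongrightarrow> f \<omega>"
proof (rule order_tendstoI)
  fix a assume "f \<omega> < a"
  then show "\<forall>\<^sub>F n in sequentially. infconv f n \<omega> < a"
    by (intro always_eventually allI le_less_trans[OF infconv_le])
next
  fix a assume a: "a < f \<omega>"
  then obtain c where c: "a < c" "c < f \<omega>" using dense by blast
  obtain e where e: "e > 0" "J1_nbhd \<omega> e \<subseteq> {\<omega>. c < f \<omega>}"
    using lsc[of c] c(2) unfolding open_cadlag_def by blast
  obtain M :: nat where M: "(1 + e) / e \<le> real M" using real_arch_simple by blast
  have "c \<le> infconv f n \<omega>" if n: "n \<ge> M" for n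
    unfolding infconv_def
  proof (rule cINF_greatest)
    fix \<eta>
    show "c \<le> f \<eta> + real n * udist \<omega> \<eta>"
    proof (cases "udist \<omega> \<eta> < e / (1 + e)")
      case True
      then have "c < f \<eta>" using udist_small_J1_nbhd[OF e(1)] e(2) by blast
      then show ?thesis using mult_nonneg_nonneg[OF of_nat_0_le_iff[of n] udist_nonneg[of \<omega> \<eta>]] by linarith
    next
      case False
      have "1 = (1 + e) / e * (e / (1 + e))" using e(1) by simp
      also have "\<dots> \<le> real n * udist \<omega> \<eta>"
        using M n False e(1) by (intro mult_mono) auto
      finally show ?thesis using c(2) f01(1)[of \<eta>] f01(2)[of \<omega>] by linarith
    qed
  qed simp
  then show "\<forall>\<^sub>F n in sequentially. a < infconv f n \<omega>"
    unfolding eventually_sequentially using c(1) by (meson less_le_trans)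
qed

end

section \<open>Regularised functionals of step paths\<close>

lemma step_path_at: "path_at (step_path m x) t = x (grid m t)"
  by transfer simp

lemma grid_le_natE:
  assumes "0 \<le> t" "t \<le> real N"
  obtains i where "i \<le> N * Suc m" "grid m t = of_nat i / of_nat (Suc m)"
proof
  have "t * real (Suc m) \<le> real N * real (Suc m)" using assms by (intro mult_right_mono) auto
  also have "\<dots> = real (N * Suc m)" by (simp only: of_nat_mult)
  finally have "\<lfloor>t * real (Suc m)\<rfloor> \<le> int (N * Suc m)" by linarith
  then show "nat \<lfloor>t * real (Suc m)\<rfloor> \<le> N * Suc m" by linarith
  have "0 \<le> \<lfloor>t * real (Suc m)\<rfloor>" using assms by simp
  then show "grid m t = of_nat (nat \<lfloor>t * real (Suc m)\<rfloor>) / of_nat (Suc m)"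
    using assms by (simp add: grid_def)
qed

text \<open>Up to time N a step path is determined by finitely many coordinates, and later times
  have small weight in \<open>udist\<close>; convergence at finitely many rationals is therefore
  enough.\<close>

lemma continuous_on_infconv_step_path:
  fixes f :: "'a::metric_space cadlag \<Rightarrow> real"
  assumes f01: "\<And>\<omega>. 0 \<le> f \<omega>" "\<And>\<omega>. f \<omega> \<le> 1"
  shows "continuous_on UNIV (\<lambda>x. infconv f n (step_path m x))"
proof -
  have "isCont (\<lambda>x. infconv f n (step_path m x)) x" for x
    unfolding isCont_def
  proof (rule tendstoI)
    fix e :: real assume e: "0 < e"
    \<comment> \<open>The Lipschitz constant is n; dividing by 1 + n instead also covers n =
      0.\<close>
    define e' where "e' = e / (2 * (1 + real n))"
    have e': "e' > 0" "real n * e' < e"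
    proof -
      show "0 < e'" using e by (simp add: e'_def add_pos_nonneg)
      have "real n * e' \<le> (1 + real n) * e'" using \<open>0 < e'\<close> by (intro mult_right_mono) auto
      also have "\<dots> = e / 2"
        using add_pos_nonneg[of 1 "real n"] by (simp add: e'_def field_simps)
      finally show "real n * e' < e" using e by simp
    qed
    obtain N :: nat where N: "1 / Suc N < e'" using nat_approx_posE e'(1) by blast
    have "((\<lambda>y. y q) \<longlongrightarrow> x q) (at x)" for q
      using continuous_on_product_coordinates unfolding continuous_on_def by fast
    then have "\<forall>\<^sub>F y in at x. \<forall>i\<in>{..N * Suc m}. dist (y (of_nat i / of_nat (Suc m))) (x (of_nat i / of_nat (Suc m))) < e'"
      by (intro eventually_ball_finite ballI tendstoD e') auto
    then show "\<forall>\<^sub>F y in at x. dist (infconv f n (step_path m y)) (infconv f n (step_path m x)) < e"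
    proof eventually_elim
      case (elim y)
      have "udist (step_path m y) (step_path m x) \<le> max e' (1 / (1 + real N))"
      proof (rule udist_le_max)
        fix t :: real assume "0 \<le> t" "t < real N"
        then obtain i where "i \<le> N * Suc m" "grid m t = of_nat i / of_nat (Suc m)"
          using grid_le_natE[of t N m] by auto
        with elim show "dist (path_at (step_path m y) t) (path_at (step_path m x) t) \<le> e'"
          unfolding step_path_at by (auto simp: less_imp_le)
      qed
      then have "udist (step_path m y) (step_path m x) \<le> e'" using N by simp
      then have "real n * udist (step_path m y) (step_path m x) \<le> real n * e'" by (intro mult_left_mono) auto
      then show ?case
        using infconv_Lipschitz_abs[of f n "step_path m y" "step_path m x"] f01 e'(2)
        by (simp add: dist_real_def)
    qed
  qed
  then show ?thesis by (simp add: continuous_on_eq_continuous_at)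
qed

text \<open>The hypothesis controls rational times only, and the path may jump. Right continuity
  carries the bound over: if it failed at t, it would fail at a rational slightly to the right of
  t.\<close>

lemma udist_step_path_on_rats:
  assumes "on_rats \<omega> \<notin> oscillating N d e" and m: "1 / real (Suc m) < d"
  shows "udist \<omega> (step_path m (on_rats \<omega>)) \<le> max e (1 / (1 + real N))"
proof (rule udist_le_max)
  fix t :: real assume t: "0 \<le> t" "t < real N"
  define g where "g = grid m t"
  have g: "of_rat g \<le> t" "t < of_rat g + d" "0 \<le> g" "g \<le> of_nat N"
    using grid_le[OF t(1), of m] grid_gt[OF t(1), of m] m grid_nonneg grid_le_nat[of t N m] t by (auto simp: g_def)
  \<comment> \<open>Below this bound a rational after t is still in [0,N] and within d of the grid
    point.\<close>
  define b where "b = min (real N) (of_rat g + d)"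
  have tb: "t < b" using t g by (simp add: b_def)
  have "dist (path_at \<omega> t) (on_rats \<omega> g) \<le> e"
  proof (rule ccontr)
    assume "\<not> dist (path_at \<omega> t) (on_rats \<omega> g) \<le> e"
    then have gt: "e < dist (path_at \<omega> t) (on_rats \<omega> g)" by simp
    have "((\<lambda>s. dist (path_at \<omega> s) (on_rats \<omega> g)) \<longlongrightarrow> dist (path_at \<omega> t) (on_rats \<omega> g)) (at_right t)"
      by (intro tendsto_dist path_at_right t tendsto_const)
    then have "\<forall>\<^sub>F s in at_right t. e < dist (path_at \<omega> s) (on_rats \<omega> g)"
      using gt by (rule order_tendstoD)
    then obtain c where c: "t < c" "\<And>s. t < s \<Longrightarrow> s < c \<Longrightarrow> e < dist (path_at \<omega> s) (on_rats \<omega> g)"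
      unfolding eventually_at_right_field by blast
    obtain q where q: "t < of_rat q" "of_rat q < min b c"
      using of_rat_dense[of t "min b c"] c(1) tb by auto
    have "0 \<le> (of_rat q :: real)" using q t by linarith
    then have q0: "0 \<le> q" by simp
    have "(of_rat q :: real) \<le> of_rat (of_nat N)" using q by (simp add: b_def)
    then have qN: "q \<le> of_nat N" by (simp only: of_rat_less_eq)
    have "\<bar>of_rat q - of_rat g\<bar> < d" using q g by (auto simp: b_def abs_less_iff)
    then have "dist (on_rats \<omega> q) (on_rats \<omega> g) \<le> e"
      by (rule not_oscillatingD[OF assms(1) q0 g(3) qN g(4)])
    moreover have "e < dist (on_rats \<omega> q) (on_rats \<omega> g)"
      using c(2)[of "of_rat q"] q unfolding on_rats_def by simp
    ultimately show False by linarith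
  qed
  then show "dist (path_at \<omega> t) (path_at (step_path m (on_rats \<omega>)) t) \<le> e"
    by (simp add: step_path_at g_def)
qed

lemma udist_step_path_tendsto:
  assumes "on_rats \<omega> \<in> locally_unif_cont"
  shows "(\<lambda>m. udist \<omega> (step_path m (on_rats \<omega>))) \<longlonglongrightarrow> 0"
proof (rule LIMSEQ_I)
  fix e :: real assume e: "0 < e"
  obtain N :: nat where N: "1 / Suc N < e" using nat_approx_posE e by blast
  obtain d where d: "d > 0" "on_rats \<omega> \<notin> oscillating N d (e/2)"
    using locally_unif_contE[OF assms, of "e/2" N] e by auto
  obtain M :: nat where M: "1 / Suc M < d" using nat_approx_posE d(1) by blast
  have "udist \<omega> (step_path m (on_rats \<omega>)) < e" if "M \<le> m" for m
  proof -
    have "1 / real (Suc m) \<le> 1 / real (Suc M)" using that by (intro divide_left_mono) auto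
    with M have "1 / real (Suc m) < d" by linarith
    from udist_step_path_on_rats[OF d(2) this] show ?thesis using N e by (auto simp: max_def split: if_splits)
  qed
  then show "\<exists>no. \<forall>n\<ge>no. norm (udist \<omega> (step_path n (on_rats \<omega>)) - 0) < e"
    using udist_nonneg[of \<omega>] by (intro exI[of _ M]) (simp add: abs_of_nonneg)
qed

lemma cadlag_eqI_rats:
  assumes eq: "\<And>q. 0 \<le> q \<Longrightarrow> on_rats \<omega> q = on_rats \<eta> q"
  shows "\<omega> = \<eta>"
proof -
  have *: "path_at \<omega> t = path_at \<eta> t" if t: "0 \<le> t" for t
  proof (rule ccontr)
    assume "path_at \<omega> t \<noteq> path_at \<eta> t"
    then have "0 < dist (path_at \<omega> t) (path_at \<eta> t)" by simp
    have "((\<lambda>s. dist (path_at \<omega> s) (path_at \<eta> s)) \<longlongrightarrow> dist (path_at \<omega> t) (path_at \<eta> t)) (at_right t)"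
      by (intro tendsto_dist path_at_right t)
    then have "\<forall>\<^sub>F s in at_right t. 0 < dist (path_at \<omega> s) (path_at \<eta> s)"
      using \<open>0 < dist (path_at \<omega> t) (path_at \<eta> t)\<close> by (rule order_tendstoD)
    then obtain c where c: "t < c" "\<And>s. t < s \<Longrightarrow> s < c \<Longrightarrow> 0 < dist (path_at \<omega> s) (path_at \<eta> s)"
      unfolding eventually_at_right_field by blast
    obtain q where q: "t < of_rat q" "of_rat q < c" using of_rat_dense[OF c(1)] by blast
    then have "(0::real) \<le> of_rat q" using t by linarith
    then have "on_rats \<omega> q = on_rats \<eta> q" by (intro eq) simp
    with c(2)[OF q] show False by (simp add: on_rats_def)
  qed
  have "path_at \<omega> t = path_at \<eta> t" for t
    using *[of t] *[of 0] path_at_neg[of t \<omega>] path_at_neg[of t \<eta>] by (cases "0 \<le> t") auto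
  then show ?thesis using path_at_inject by blast
qed

text \<open>For the implication from left to right, the continuous extension agrees with the path at
  rational times and so equals it by right continuity. Continuity thus becomes a Borel condition on
  countably many values.\<close>

lemma on_rats_continuous:
  fixes \<omega> :: "'a::complete_space cadlag"
  shows "on_rats \<omega> \<in> locally_unif_cont \<longleftrightarrow> continuous_on {0..} (path_at \<omega>)"
proof
  assume c: "continuous_on {0..} (path_at \<omega>)"
  show "on_rats \<omega> \<in> locally_unif_cont"
  proof (rule locally_unif_contI)
    fix N :: nat and e :: real assume e: "0 < e"
    have "uniformly_continuous_on {0..real N} (path_at \<omega>)"
      by (rule compact_uniformly_continuous) (auto intro: continuous_on_subset[OF c])
    then obtain d where d: "d > 0" "\<And>s t. s \<in> {0..real N} \<Longrightarrow> t \<in> {0..real N} \<Longrightarrow> dist s t < d \<Longrightarrow>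
        dist (path_at \<omega> s) (path_at \<omega> t) < e"
      unfolding uniformly_continuous_on_def using e by metis
    have "on_rats \<omega> \<notin> oscillating N d e"
    proof
      assume "on_rats \<omega> \<in> oscillating N d e"
      then obtain p q :: rat where pq: "0 \<le> p" "0 \<le> q" "p \<le> of_nat N" "q \<le> of_nat N"
         "\<bar>of_rat p - of_rat q :: real\<bar> < d" "e < dist (on_rats \<omega> p) (on_rats \<omega> q)"
        unfolding oscillating_def by blast
      have "of_rat p \<le> real N" "of_rat q \<le> real N"
        using pq(3,4) by (metis of_rat_less_eq of_rat_of_nat_eq)+
      then have "dist (on_rats \<omega> p) (on_rats \<omega> q) < e"
        using pq(1,2,5) unfolding on_rats_def by (intro d(2)) (auto simp: dist_real_def)
      with pq(6) show False by simp
    qed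
    with d(1) show "\<exists>d>0. on_rats \<omega> \<notin> oscillating N d e" by blast
  qed
next
  assume a: "on_rats \<omega> \<in> locally_unif_cont"
  obtain \<eta> where \<eta>: "continuous_on {0..} (path_at \<eta>)" "\<And>q. 0 \<le> q \<Longrightarrow> on_rats \<eta> q = on_rats \<omega> q"
    using locally_unif_cont_extension[OF a] by blast
  then have "\<eta> = \<omega>" by (intro cadlag_eqI_rats)
  with \<eta>(1) show "continuous_on {0..} (path_at \<omega>)" by simp
qed

lemma sets_continuous_paths [measurable]: "(continuous_paths :: 'a::polish_space cadlag set) \<in> sets borel"
proof -
  have "on_rats -` locally_unif_cont \<inter> space borel \<in> sets (borel :: 'a cadlag measure)" by measurable
  also have "on_rats -` locally_unif_cont \<inter> space borel = (continuous_paths :: 'a cadlag set)"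
    by (auto simp: continuous_paths_def on_rats_continuous)
  finally show ?thesis .
qed

text \<open>Values at negative rationals are irrelevant; the path is \<open>undefined\<close> off \<^const>\<open>locally_unif_cont\<close>.\<close>

definition rat_extension :: "(rat \<Rightarrow> 'a::complete_space) \<Rightarrow> 'a cadlag" where
  "rat_extension x = (if x \<in> locally_unif_cont
     then SOME \<omega>. continuous_on {0..} (path_at \<omega>) \<and> (\<forall>q\<ge>0. on_rats \<omega> q = x q) else undefined)"

lemma rat_extension:
  assumes "x \<in> locally_unif_cont"
  shows "continuous_on {0..} (path_at (rat_extension x))" "0 \<le> q \<Longrightarrow> on_rats (rat_extension x) q = x q"
proof -
  have "\<exists>\<omega>. continuous_on {0..} (path_at \<omega>) \<and> (\<forall>q\<ge>0. on_rats \<omega> q = x q)"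
    using locally_unif_cont_extension[OF assms] by metis
  from someI_ex[OF this] show "continuous_on {0..} (path_at (rat_extension x))"
      "0 \<le> q \<Longrightarrow> on_rats (rat_extension x) q = x q"
    using assms by (auto simp: rat_extension_def)
qed

lemma step_path_rat_extension:
  assumes "x \<in> locally_unif_cont"
  shows "step_path m (on_rats (rat_extension x)) = step_path m x"
  by (metis assms grid_nonneg path_at_inject rat_extension(2) step_path_at ext)

lemma infconv_step_path_tendsto:
  assumes f01: "\<And>\<omega>. 0 \<le> f \<omega>" "\<And>\<omega>. f \<omega> \<le> 1" and x: "x \<in> locally_unif_cont"
  shows "(\<lambda>m. infconv f n (step_path m x)) \<longlonglongrightarrow> infconv f n (rat_extension x)"
proof -
  let ?\<omega> = "rat_extension x"
  have "on_rats ?\<omega> \<in> locally_unif_cont"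
    using on_rats_continuous rat_extension(1)[OF x] by blast
  then have lim: "(\<lambda>m. real n * udist ?\<omega> (step_path m x)) \<longlonglongrightarrow> 0"
    using tendsto_mult_left[OF udist_step_path_tendsto[of ?\<omega>], of "real n"] by (simp add: step_path_rat_extension[OF x])
  have "(\<lambda>m. infconv f n (step_path m x) - infconv f n ?\<omega>) \<longlonglongrightarrow> 0"
  proof (rule Lim_null_comparison[OF _ lim])
    show "\<forall>\<^sub>F m in sequentially. norm (infconv f n (step_path m x) - infconv f n ?\<omega>) \<le> real n * udist ?\<omega> (step_path m x)"
      unfolding real_norm_def udist_commute[of ?\<omega>]
      by (intro always_eventually allI infconv_Lipschitz_abs[of f, OF f01])
  qed
  then show ?thesis by (rule LIM_zero_cancel)
qed

text \<open>\<open>rat_extension\<close> is obtained by choice, so measurability cannot be read off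
  its definition. On the good set the functional is a pointwise limit of continuous functions of the
  rational values.\<close>

lemma borel_measurable_infconv_rat_extension:
  fixes f :: "'a::polish_space cadlag \<Rightarrow> real"
  assumes f01: "\<And>\<omega>. 0 \<le> f \<omega>" "\<And>\<omega>. f \<omega> \<le> 1"
  shows "(\<lambda>x. indicator locally_unif_cont x * infconv f n (rat_extension x)) \<in> borel_measurable borel"
proof (rule borel_measurable_LIMSEQ_real)
  show "(\<lambda>x. indicator locally_unif_cont x * infconv f n (step_path m x)) \<in> borel_measurable borel" for m
    by (intro borel_measurable_times borel_measurable_indicator sets_locally_unif_cont
        borel_measurable_continuous_onI continuous_on_infconv_step_path f01)
  show "(\<lambda>m. indicator locally_unif_cont x * infconv f n (step_path m x))
      \<longlonglongrightarrow> indicator locally_unif_cont x * infconv f n (rat_extension x)" for x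
    by (cases "x \<in> locally_unif_cont") (auto intro!: infconv_step_path_tendsto[of f, OF f01])
qed

text \<open>The indicator of an open set is lower semicontinuous, hence the pointwise limit of its
  regularisations, whose compositions with the extension are already known to be Borel.\<close>

lemma measurable_rat_extension [measurable]:
  "(rat_extension :: (rat \<Rightarrow> 'a::polish_space) \<Rightarrow> 'a cadlag) \<in> borel \<rightarrow>\<^sub>M borel"
proof (rule borel_measurableI)
  fix U :: "'a cadlag set" assume U: "open U"
  let ?f = "indicator U :: 'a cadlag \<Rightarrow> real"
  let ?G = "locally_unif_cont :: (rat \<Rightarrow> 'a) set"
  have f01: "0 \<le> ?f \<omega>" "?f \<omega> \<le> 1" for \<omega> by (auto simp: indicator_def)
  have lsc: "open {\<omega>. c < ?f \<omega>}" for c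
  proof -
    have "{\<omega>. c < ?f \<omega>} = (if c < 0 then UNIV else if c < 1 then U else {})"
      by (auto simp: indicator_def)
    then show ?thesis using U by simp
  qed
  have m3: "(\<lambda>x. indicator ?G x * ?f (rat_extension x)) \<in> borel_measurable borel"
  proof (rule borel_measurable_LIMSEQ_real)
    show "(\<lambda>x. indicator ?G x * infconv ?f n (rat_extension x)) \<in> borel_measurable borel" for n
      by (rule borel_measurable_infconv_rat_extension[of ?f, OF f01])
    have "(\<lambda>n. infconv ?f n \<omega>) \<longlonglongrightarrow> ?f \<omega>" for \<omega>
      by (rule infconv_tendsto[of ?f, OF f01 lsc])
    then show "(\<lambda>n. indicator ?G x * infconv ?f n (rat_extension x)) \<longlonglongrightarrow> indicator ?G x * ?f (rat_extension x)" for x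
      by (rule tendsto_mult_left)
  qed
  \<comment> \<open>Off the good set the extension is the constant \<open>undefined\<close>, which
    may or may not belong to \<open>U\<close>.\<close>
  have "rat_extension -` U = {x \<in> space borel. indicator ?G x * ?f (rat_extension x) = 1} \<union>
      (if undefined \<in> U then - ?G else {})"
    by (auto simp: indicator_def rat_extension_def split: if_splits)
  also have "\<dots> \<in> sets borel"
    using m3 by (intro sets.Un) (auto intro!: borel_comp sets_locally_unif_cont measurable_sets_borel simp: pred_def)
  finally show "rat_extension -` U \<inter> space borel \<in> sets borel" by simp
qed

text \<open>The open-set half of the portmanteau theorem: the indicator of \<open>U\<close> is the
  limit from below of n times the distance to the complement, cut off at 1. \<open>U\<close> is
  proper because \<open>infdist\<close> to the empty set is 0.\<close>

lemma weakly_converges_open_bound: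
  fixes L :: "nat \<Rightarrow> 'b::metric_space measure"
  assumes L: "weakly_converges L Q" and U: "open U" "U \<noteq> UNIV"
    and le: "\<forall>\<^sub>F k in sequentially. measure (L k) U \<le> c"
  shows "measure Q U \<le> c"
proof -
  define \<phi> where "\<phi> n x = min 1 (real n * infdist x (- U))" for n x
  have Ls: "prob_space (L k)" "sets (L k) = sets borel" for k
    using L by (auto simp: weakly_converges_def)
  have Qs: "prob_space Q" "sets Q = sets borel"
    using L by (auto simp: weakly_converges_def)
  interpret Q: prob_space Q by (rule Qs)
  have [measurable_cong]: "sets (L k) = sets borel" "sets Q = sets borel" for k by (rule Ls Qs)+
  have [measurable]: "U \<in> sets borel" using U(1) by (rule borel_open)
  have \<phi>0: "0 \<le> \<phi> n x" "\<phi> n x \<le> 1" for n x by (auto simp: \<phi>_def infdist_nonneg)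
  have \<phi>c: "continuous_on UNIV (\<phi> n)" for n unfolding \<phi>_def by (intro continuous_intros)
  have \<phi>m [measurable]: "\<phi> n \<in> borel_measurable borel" for n using \<phi>c by (rule borel_measurable_continuous_onI)
  have \<phi>U: "\<phi> n x \<le> indicator U x" for n x
    using \<phi>0(2)[of n x] by (auto simp: indicator_def \<phi>_def)
  have "integral\<^sup>L Q (\<phi> n) \<le> c" for n
  proof (rule tendsto_upperbound)
    have "bounded (range (\<phi> n))" by (rule boundedI[of _ 1]) (use \<phi>0 in auto)
    then show "(\<lambda>k. integral\<^sup>L (L k) (\<phi> n)) \<longlonglongrightarrow> integral\<^sup>L Q (\<phi> n)"
      using L \<phi>c unfolding weakly_converges_def by blast
    show "\<forall>\<^sub>F k in sequentially. integral\<^sup>L (L k) (\<phi> n) \<le> c"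
      using le
    proof eventually_elim
      case (elim k)
      interpret prob_space "L k" by (rule Ls)
      have [measurable_cong]: "sets (L k) = sets borel" by (rule Ls)
      have "integral\<^sup>L (L k) (\<phi> n) \<le> integral\<^sup>L (L k) (indicator U)"
      proof (rule integral_mono)
        show "integrable (L k) (\<phi> n)"
          by (rule integrable_const_bound[of _ 1]) (auto simp: \<phi>0)
        show "integrable (L k) (indicator U :: _ \<Rightarrow> real)"
          by (rule integrable_const_bound[of _ 1]) (auto simp: indicator_def)
      qed (rule \<phi>U)
      then show ?case using elim U(1) Ls by simp
    qed
  qed simp
  moreover have "(\<lambda>n. integral\<^sup>L Q (\<phi> n)) \<longlonglongrightarrow> integral\<^sup>L Q (indicator U)"
  proof (rule integral_dominated_convergence[where w = "\<lambda>_. 1"])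
    show "AE x in Q. (\<lambda>n. \<phi> n x) \<longlonglongrightarrow> indicator U x"
    proof (rule AE_I2)
      fix x
      show "(\<lambda>n. \<phi> n x) \<longlonglongrightarrow> indicator U x"
      proof (cases "x \<in> U")
        case False then show ?thesis by (simp add: \<phi>_def)
      next
        case True
        then have "0 < infdist x (- U)"
          using U in_closed_iff_infdist_zero[of "- U" x] infdist_nonneg[of x "- U"]
          by (metis Compl_UNIV_eq Compl_iff antisym_conv2 closed_Compl double_compl)
        then obtain N :: nat where N: "1 / infdist x (- U) \<le> real N" using real_arch_simple by blast
        have "\<phi> n x = 1" if "n \<ge> N" for n
        proof -
          have "1 / infdist x (- U) \<le> real n" using N that by linarith
          then show ?thesis using \<open>0 < infdist x (- U)\<close> by (simp add: \<phi>_def field_simps)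
        qed
        then have "\<forall>\<^sub>F n in sequentially. \<phi> n x = 1" unfolding eventually_sequentially by blast
        then show ?thesis using True by (simp add: tendsto_eventually)
      qed
    qed
  qed (use \<phi>m \<phi>0 U Qs in \<open>auto intro: borel_open\<close>)
  moreover have "integral\<^sup>L Q (indicator U) = measure Q U"
    using U(1) Qs by simp
  ultimately show ?thesis by (intro LIMSEQ_le_const2) auto
qed

text \<open>The tightness hypothesis bounds the uniform modulus. This both forces continuity of the
  limit and allows a path under \<Lambda> k to be replaced by its grid discretisation, a function of
  finitely many of the times at which convergence is known.\<close>

theorem weak_limit_continuous_paths:
  fixes \<Lambda> :: "nat \<Rightarrow> 'a::polish_space cadlag measure"
  assumes \<Lambda>: "\<And>k. prob_space (\<Lambda> k)" "\<And>k. sets (\<Lambda> k) = sets borel"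
    and conv: "weakly_converges (\<lambda>k. distr (\<Lambda> k) borel on_rats) Q"
    and tight: "\<And>N e c. 0 < e \<Longrightarrow> 0 < c \<Longrightarrow> \<exists>d>0. \<forall>\<^sub>F k in sequentially.
      measure (distr (\<Lambda> k) borel on_rats) (oscillating N d e) \<le> c"
  shows "weakly_converges \<Lambda> (distr Q borel rat_extension)"
    and "emeasure (distr Q borel rat_extension) continuous_paths = 1"
proof -
  define L where "L k = distr (\<Lambda> k) borel on_rats" for k
  have [measurable_cong]: "sets (\<Lambda> k) = sets borel" for k by (rule \<Lambda>)
  interpret \<Lambda>: prob_space "\<Lambda> k" for k by (rule \<Lambda>)
  interpret L: prob_space "L k" for k unfolding L_def by (rule \<Lambda>.prob_space_distr) simp
  have [measurable_cong]: "sets Q = sets borel" and "prob_space Q" using conv by (auto simp: weakly_converges_def)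
  interpret Q: prob_space Q by fact
  let ?G = "locally_unif_cont :: (rat \<Rightarrow> 'a) set"
  have QG: "AE x in Q. x \<in> ?G"
  proof -
    have "AE x in Q. \<exists>m. x \<notin> oscillating N (1 / real (Suc m)) (1 / real (Suc k))" for N k
    proof -
      define V where "V = (\<Inter>m. oscillating N (1 / real (Suc m)) (1 / real (Suc k)) :: (rat \<Rightarrow> 'a) set)"
      have [measurable]: "V \<in> sets borel" unfolding V_def by measurable
      have "measure Q V \<le> 0 + c" if c: "c > 0" for c
      proof -
        obtain d where d: "d > 0" "\<forall>\<^sub>F j in sequentially. measure (distr (\<Lambda> j) borel on_rats) (oscillating N d (1 / real (Suc k))) \<le> c"
          using tight[of "1 / real (Suc k)" c N] c by auto
        obtain m :: nat where m: "1 / Suc m < d" using nat_approx_posE d(1) by blast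
        have "measure Q V \<le> measure Q (oscillating N d (1 / real (Suc k)))"
          using oscillating_mono[of "1 / real (Suc m)" d "1 / real (Suc k)" "1 / real (Suc k)" N] m
          by (intro Q.finite_measure_mono) (auto simp: V_def)
        also have "\<dots> \<le> c"
        proof (rule weakly_converges_open_bound[OF conv open_oscillating _ d(2)])
          have "(\<lambda>_. undefined) \<notin> oscillating N d (1 / real (Suc k))" by (simp add: oscillating_def not_less)
          then show "oscillating N d (1 / real (Suc k)) \<noteq> (UNIV :: (rat \<Rightarrow> 'a) set)" by blast
        qed
        finally show ?thesis by simp
      qed
      then have "measure Q V \<le> 0" by (rule field_le_epsilon)
      then have "emeasure Q V = 0" by (simp add: Q.emeasure_eq_measure measure_le_0_iff)
      then have "AE x in Q. x \<notin> V" by (intro AE_not_in) (auto simp: null_sets_def \<open>sets Q = sets borel\<close>)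
      then show ?thesis by (auto simp: V_def)
    qed
    then show ?thesis unfolding locally_unif_cont_def by (simp add: AE_all_countable)
  qed
  define P where "P = distr Q borel rat_extension"
  interpret P: prob_space P unfolding P_def by (rule Q.prob_space_distr) simp
  have "AE \<omega> in P. \<omega> \<in> continuous_paths"
  proof -
    have "rat_extension x \<in> continuous_paths" if "x \<in> ?G" for x :: "rat \<Rightarrow> 'a"
      using rat_extension(1)[OF that] by (simp add: continuous_paths_def)
    then have "AE x in Q. rat_extension x \<in> continuous_paths"
      using QG by (rule eventually_mono[rotated])
    then show ?thesis
      unfolding P_def by (subst AE_distr_iff) simp_all
  qed
  then show "emeasure (distr Q borel rat_extension) continuous_paths = 1"
    using P.emeasure_eq_1_AE[of continuous_paths] by (simp add: P_def)

  \<comment> \<open>A lower bound for the limit inferior suffices: applied to \<open>f\<close> and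
    to \<open>- f\<close>, both rescaled into [0,1], it gives convergence.\<close>
  have lower: "\<forall>\<^sub>F k in sequentially. c < integral\<^sup>L (\<Lambda> k) f"
    if f: "continuous_on UNIV f" and f01: "\<And>\<omega>. 0 \<le> f \<omega>" "\<And>\<omega>. f \<omega> \<le> 1" and c: "c < integral\<^sup>L P f"
    for f :: "'a cadlag \<Rightarrow> real" and c
  proof -
    have fm [measurable]: "f \<in> borel_measurable borel" using f by (rule borel_measurable_continuous_onI)
    have lsc: "open {\<omega>. a < f \<omega>}" for a
      using f by (intro open_Collect_less) auto
    define g where "g n x = indicator ?G x * infconv f n (rat_extension x)" for n x
    have gm [measurable]: "g n \<in> borel_measurable borel" for n
      unfolding g_def by (rule borel_measurable_infconv_rat_extension[of f, OF f01])
    have Fc: "continuous_on UNIV (\<lambda>x. infconv f n (step_path m x))" for n m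
      by (rule continuous_on_infconv_step_path[of f, OF f01])
    have Fm [measurable]: "(\<lambda>x. infconv f n (step_path m x)) \<in> borel_measurable borel" for n m
      by (rule borel_measurable_continuous_onI[OF Fc])
    note i01 = infconv_nonneg[of f, OF f01] infconv_le_1[of f, OF f01]
    have int_P: "integral\<^sup>L P f = integral\<^sup>L Q (\<lambda>x. f (rat_extension x))"
      unfolding P_def by (rule integral_distr) simp_all
    have "(\<lambda>n. integral\<^sup>L Q (g n)) \<longlonglongrightarrow> integral\<^sup>L Q (\<lambda>x. f (rat_extension x))"
    proof (rule integral_dominated_convergence[where w = "\<lambda>_. 1"])
      show "AE x in Q. (\<lambda>n. g n x) \<longlonglongrightarrow> f (rat_extension x)"
        using QG
      proof eventually_elim
        case (elim x)
        have "(\<lambda>n. infconv f n (rat_extension x)) \<longlonglongrightarrow> f (rat_extension x)"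
          by (rule infconv_tendsto[of f, OF f01 lsc])
        then show ?case using elim by (simp add: g_def)
      qed
      show "AE x in Q. norm (g n x) \<le> 1" for n
        using i01 by (auto simp: g_def indicator_def)
    qed simp_all
    \<comment> \<open>Of the four portions of the gap, one is spent on the limits in n and m, one on
      replacing the path by a step path, one on oscillating paths; the fourth is left over.\<close>
    moreover define \<gamma> where "\<gamma> = (integral\<^sup>L P f - c) / 4"
    have \<gamma>: "0 < \<gamma>" "integral\<^sup>L P f = c + 4 * \<gamma>" using c by (simp_all add: \<gamma>_def field_simps)
    have "c + 3 * \<gamma> < integral\<^sup>L Q (\<lambda>x. f (rat_extension x))" using \<gamma> int_P by simp
    ultimately have "\<forall>\<^sub>F n in sequentially. c + 3 * \<gamma> < integral\<^sup>L Q (g n)"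
      by (rule order_tendstoD)
    then obtain n where n: "c + 3 * \<gamma> < integral\<^sup>L Q (g n)"
      unfolding eventually_sequentially by blast
    define F where "F m x = infconv f n (step_path m x)" for m and x :: "rat \<Rightarrow> 'a"
    have "(\<lambda>m. integral\<^sup>L Q (F m)) \<longlonglongrightarrow> integral\<^sup>L Q (g n)"
    proof (rule integral_dominated_convergence[where w = "\<lambda>_. 1"])
      show "AE x in Q. (\<lambda>m. F m x) \<longlonglongrightarrow> g n x"
        using QG
      proof eventually_elim
        case (elim x)
        then show ?case using infconv_step_path_tendsto[of f, OF f01 elim, of n] by (simp add: g_def F_def)
      qed
      show "AE x in Q. norm (F m x) \<le> 1" for m
        using i01 by (auto simp: F_def)
    qed (simp_all add: F_def[abs_def])
    then have evm: "\<forall>\<^sub>F m in sequentially. c + 3 * \<gamma> < integral\<^sup>L Q (F m)"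
      using n by (rule order_tendstoD)
    define e where "e = \<gamma> / (1 + real n)"
    have e: "0 < e" "real n * e \<le> \<gamma>"
    proof -
      show "0 < e" using \<gamma> by (simp add: e_def add_pos_nonneg)
      have "real n * e \<le> (1 + real n) * e" using \<open>0 < e\<close> by (intro mult_right_mono) auto
      also have "\<dots> = \<gamma>" using add_pos_nonneg[of 1 "real n"] by (simp add: e_def)
      finally show "real n * e \<le> \<gamma>" .
    qed
    obtain N :: nat where N: "1 / Suc N < e" using nat_approx_posE e(1) by blast
    obtain d where d: "0 < d" "\<forall>\<^sub>F k in sequentially. measure (L k) (oscillating N d e) \<le> \<gamma>"
      using tight[OF e(1) \<gamma>(1), of N] unfolding L_def by blast
    have "(\<lambda>m. 1 / real (Suc m)) \<longlonglongrightarrow> 0" by (rule LIMSEQ_Suc[OF lim_1_over_n])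
    then have "\<forall>\<^sub>F m in sequentially. 1 / real (Suc m) < d" using d(1) by (rule order_tendstoD)
    with evm have "\<forall>\<^sub>F m in sequentially. 1 / real (Suc m) < d \<and> c + 3 * \<gamma> < integral\<^sup>L Q (F m)"
      by eventually_elim simp
    then obtain m where m: "1 / real (Suc m) < d" "c + 3 * \<gamma> < integral\<^sup>L Q (F m)"
      unfolding eventually_sequentially by blast
    have Fmm [measurable]: "F m \<in> borel_measurable borel" unfolding F_def[abs_def] by (rule Fm)
    have F01: "0 \<le> F m x" "F m x \<le> 1" for x using i01 by (auto simp: F_def)
    have "bounded (range (F m))" by (rule boundedI[of _ 1]) (use F01 in auto)
    then have "(\<lambda>k. integral\<^sup>L (L k) (F m)) \<longlonglongrightarrow> integral\<^sup>L Q (F m)"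
      using conv Fc[of n m] unfolding weakly_converges_def L_def F_def[abs_def] by blast
    then have "\<forall>\<^sub>F k in sequentially. c + 3 * \<gamma> < integral\<^sup>L (L k) (F m)"
      using m(2) by (rule order_tendstoD)
    with d(2) show ?thesis
    proof eventually_elim
      case (elim k)
      let ?O = "oscillating N d e :: (rat \<Rightarrow> 'a) set"
      have "integral\<^sup>L (\<Lambda> k) (\<lambda>\<omega>. F m (on_rats \<omega>) - \<gamma> - indicator ?O (on_rats \<omega>)) \<le> integral\<^sup>L (\<Lambda> k) f"
      proof (rule integral_mono)
        show "integrable (\<Lambda> k) f"
          by (rule \<Lambda>.integrable_const_bound[of _ 1]) (use f01 in auto)
        show "integrable (\<Lambda> k) (\<lambda>\<omega>. F m (on_rats \<omega>) - \<gamma> - indicator ?O (on_rats \<omega>))"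
          by (intro Bochner_Integration.integrable_diff \<Lambda>.integrable_const_bound[of _ "max 1 \<gamma>"])
             (use F01 \<gamma>(1) in \<open>auto simp: indicator_def le_max_iff_disj\<close>)
        fix \<omega>
        \<comment> \<open>On oscillating paths subtracting 1 makes the left side nonpositive. On the
          others the Lipschitz bound costs n * e \<le> \<gamma>, and the regularisation lies below
          \<open>f\<close>.\<close>
        show "F m (on_rats \<omega>) - \<gamma> - indicator ?O (on_rats \<omega>) \<le> f \<omega>"
        proof (cases "on_rats \<omega> \<in> ?O")
          case True
          then show ?thesis using F01(2)[of "on_rats \<omega>"] f01(1)[of \<omega>] \<gamma>(1) by simp
        next
          case False
          have "udist \<omega> (step_path m (on_rats \<omega>)) \<le> e"
            using udist_step_path_on_rats[OF False m(1)] N by simp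
          then have "real n * udist \<omega> (step_path m (on_rats \<omega>)) \<le> real n * e"
            by (rule mult_left_mono) simp
          then show ?thesis
            using infconv_Lipschitz[of f, OF f01, of n "step_path m (on_rats \<omega>)" \<omega>] infconv_le[of f, OF f01, of n \<omega>] e(2) False
            by (simp add: F_def udist_commute)
        qed
      qed
      also have "integral\<^sup>L (\<Lambda> k) (\<lambda>\<omega>. F m (on_rats \<omega>) - \<gamma> - indicator ?O (on_rats \<omega>)) =
          integral\<^sup>L (L k) (\<lambda>x. F m x - \<gamma> - indicator ?O x)"
        unfolding L_def by (rule integral_distr[symmetric]) simp_all
      also have "\<dots> = integral\<^sup>L (L k) (F m) - \<gamma> - measure (L k) ?O"
      proof -
        have i: "integrable (L k) (F m)"
          by (rule L.integrable_const_bound[of _ 1]) (use F01 in \<open>auto simp: L_def\<close>)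
        moreover have "integrable (L k) (indicator ?O :: _ \<Rightarrow> real)"
          by (rule L.integrable_const_bound[of _ 1]) (auto simp: L_def indicator_def)
        ultimately have "integral\<^sup>L (L k) (\<lambda>x. F m x - \<gamma> - indicator ?O x) =
            integral\<^sup>L (L k) (F m) - integral\<^sup>L (L k) (\<lambda>x. \<gamma>) - integral\<^sup>L (L k) (indicator ?O)"
          by (simp only: Bochner_Integration.integral_diff Bochner_Integration.integrable_diff L.integrable_const)
        moreover have "integral\<^sup>L (L k) (\<lambda>x. \<gamma>) = \<gamma>"
          using L.prob_space[of k] by (simp only: lebesgue_integral_const) simp
        moreover have "integral\<^sup>L (L k) (indicator ?O :: _ \<Rightarrow> real) = measure (L k) ?O"
          by (simp add: L_def)
        ultimately show ?thesis by simp
      qed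
      finally show ?case using elim \<gamma>(1) by linarith
    qed
  qed
  show "weakly_converges \<Lambda> (distr Q borel rat_extension)"
    unfolding weakly_converges_def
  proof (intro conjI allI impI \<Lambda>)
    show "prob_space (distr Q borel rat_extension)" using P.prob_space_axioms by (simp add: P_def)
    fix f :: "'a cadlag \<Rightarrow> real" assume f: "continuous_on UNIV f \<and> bounded (range f)"
    then obtain B where B: "0 < B" "\<And>\<omega>. \<bar>f \<omega>\<bar> \<le> B"
      unfolding bounded_pos by auto
    have fm [measurable]: "f \<in> borel_measurable borel" using f by (intro borel_measurable_continuous_onI) auto
    \<comment> \<open>For s = 1 and s = -1 this maps the range of \<open>s * f\<close> into
      [0,1].\<close>
    define h where "h s \<omega> = (s * f \<omega> + B) / (2 * B)" for s \<omega>
    have hc: "continuous_on UNIV (h s)" for s unfolding h_def using f B(1) by (auto intro!: continuous_intros)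
    have h01: "0 \<le> h s \<omega>" "h s \<omega> \<le> 1" if "s = 1 \<or> s = -1" for s \<omega>
      using that B(2)[of \<omega>] B(1) by (auto simp: h_def abs_le_iff)
    then have h1: "0 \<le> h 1 \<omega>" "h 1 \<omega> \<le> 1" and h2: "0 \<le> h (-1) \<omega>" "h (-1) \<omega> \<le> 1" for \<omega>
      by auto
    have "integrable P f" "integrable (\<Lambda> k) f" for k
      by (rule P.integrable_const_bound[of _ B] \<Lambda>.integrable_const_bound[of _ B]; use B in \<open>auto simp: P_def\<close>)+
    then have ih: "integral\<^sup>L P (h s) = (s * integral\<^sup>L P f + B) / (2 * B)"
        "integral\<^sup>L (\<Lambda> k) (h s) = (s * integral\<^sup>L (\<Lambda> k) f + B) / (2 * B)" for s k
      using P.prob_space \<Lambda>.prob_space unfolding h_def by simp_all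
    have "(\<lambda>k. integral\<^sup>L (\<Lambda> k) f) \<longlonglongrightarrow> integral\<^sup>L P f"
    proof (rule order_tendstoI)
      fix a assume "a < integral\<^sup>L P f"
      then have "(a + B) / (2 * B) < integral\<^sup>L P (h 1)"
        unfolding ih using B(1) by (intro divide_strict_right_mono) auto
      from lower[OF hc h1 this] show "\<forall>\<^sub>F k in sequentially. a < integral\<^sup>L (\<Lambda> k) f"
        unfolding ih by eventually_elim (use B(1) in \<open>auto simp: divide_less_cancel\<close>)
    next
      fix a assume "integral\<^sup>L P f < a"
      then have "(- a + B) / (2 * B) < integral\<^sup>L P (h (-1))"
        unfolding ih using B(1) by (intro divide_strict_right_mono) auto
      from lower[OF hc h2 this] show "\<forall>\<^sub>F k in sequentially. integral\<^sup>L (\<Lambda> k) f < a"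
        unfolding ih by eventually_elim (use B(1) in \<open>auto simp: divide_less_cancel\<close>)
    qed
    then show "(\<lambda>k. integral\<^sup>L (\<Lambda> k) f) \<longlonglongrightarrow> integral\<^sup>L (distr Q borel rat_extension) f"
      by (simp add: P_def)
  qed simp
qed

section \<open>Jump paths\<close>

definition arrival :: "(nat \<Rightarrow> real) \<Rightarrow> nat \<Rightarrow> real" where
  "arrival \<tau> n = (\<Sum>i<n. \<tau> i)"

definition proper_times :: "(nat \<Rightarrow> real) set" where
  "proper_times = {\<tau>. (\<forall>n. 0 < \<tau> n) \<and> filterlim (arrival \<tau>) at_top sequentially}"

text \<open>Holding times become an argument of their own. \<open>jump_path\<close> depends on the
  states also through \<open>h\<close>, which is only Borel; with \<open>h\<close> factored out the
  remaining map can be studied by continuity.\<close>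

definition walk_path :: "(nat \<Rightarrow> 'a::metric_space) \<Rightarrow> (nat \<Rightarrow> real) \<Rightarrow> 'a cadlag" where
  "walk_path y \<tau> = jump_path (\<lambda>_. 1) y \<tau>"

lemma jump_path_eq_walk_path: "jump_path h y e = walk_path y (\<lambda>i. h (y i) * e i)"
  unfolding walk_path_def by transfer (auto simp: jump_fun_def jump_time_def[abs_def])

lemma path_at_walk_path:
  "path_at (walk_path y \<tau>) t = (if \<tau> \<in> proper_times then y (LEAST n. max t 0 < arrival \<tau> (Suc n)) else y 0)"
  unfolding walk_path_def jump_path.rep_eq
  by (simp add: jump_fun_def jump_time_def[abs_def] proper_times_def arrival_def[abs_def])

lemma arrival_0 [simp]: "arrival \<tau> 0 = 0" by (simp add: arrival_def)

lemma arrival_Suc: "arrival \<tau> (Suc n) = arrival \<tau> n + \<tau> n" by (simp add: arrival_def)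

lemma strict_mono_arrival: "\<tau> \<in> proper_times \<Longrightarrow> strict_mono (arrival \<tau>)"
  by (simp add: strict_mono_Suc_iff arrival_Suc proper_times_def)

lemma arrival_interval:
  assumes \<tau>: "\<tau> \<in> proper_times" and t: "0 \<le> t"
  obtains n where "arrival \<tau> n \<le> t" "t < arrival \<tau> (Suc n)"
proof -
  have "\<exists>m. t < arrival \<tau> m"
    using \<tau> unfolding proper_times_def filterlim_at_top_dense eventually_sequentially by blast
  define m where "m = (LEAST m. t < arrival \<tau> m)"
  have m: "t < arrival \<tau> m" unfolding m_def using \<open>\<exists>m. t < arrival \<tau> m\<close> by (rule LeastI_ex)
  then have "m \<noteq> 0" using t by (intro notI) simp
  then obtain n where n: "m = Suc n" by (cases m) auto
  then have "\<not> t < arrival \<tau> n" unfolding m_def by (intro not_less_Least) simp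
  then show thesis using m n by (intro that[of n]) auto
qed

lemma walk_path_interval:
  assumes \<tau>: "\<tau> \<in> proper_times" and t: "arrival \<tau> n \<le> t" "t < arrival \<tau> (Suc n)"
  shows "path_at (walk_path y \<tau>) t = y n"
proof -
  note mono = strict_mono_arrival[OF \<tau>]
  have "0 \<le> arrival \<tau> n" using strict_mono_leD[OF mono, of 0 n] by simp
  then have t0: "max t 0 = t" using t(1) by simp
  have "(LEAST n. t < arrival \<tau> (Suc n)) = n"
  proof (rule Least_equality)
    fix m assume "t < arrival \<tau> (Suc m)"
    then have "arrival \<tau> n < arrival \<tau> (Suc m)" using t(1) by linarith
    then show "n \<le> m" using mono by (simp add: strict_mono_less)
  qed (fact t(2))
  then show ?thesis using \<tau> by (simp add: path_at_walk_path t0)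
qed

lemma walk_path_improper: "\<tau> \<notin> proper_times \<Longrightarrow> path_at (walk_path y \<tau>) t = y 0"
  by (simp add: path_at_walk_path)

lemma arrival_ge: "\<tau> \<in> proper_times \<Longrightarrow> n \<le> m \<Longrightarrow> arrival \<tau> n \<le> arrival \<tau> m"
  using strict_mono_leD[OF strict_mono_arrival] .

text \<open>The series form separates holding times from the chain, so the clocks can be integrated
  out term by term. If the chain never leaves \<open>B\<close>, both sides are infinite because
  proper holding times have divergent sum.\<close>

lemma exit_time_walk_path:
  assumes \<tau>: "\<tau> \<in> proper_times"
  shows "exit_time B (walk_path y \<tau>) = (\<Sum>n. ennreal (\<tau> n) * (if \<forall>k\<le>n. y k \<in> B then 1 else 0))"
proof -
  note mono = strict_mono_arrival[OF \<tau>]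
  have pos: "0 < \<tau> n" for n using \<tau> by (simp add: proper_times_def)
  have nn: "0 \<le> arrival \<tau> n" for n using arrival_ge[OF \<tau>, of 0 n] by simp
  have sum: "(\<Sum>i<n. ennreal (\<tau> i)) = ennreal (arrival \<tau> n)" for n
    unfolding arrival_def using pos by (subst sum_ennreal) (auto simp: less_imp_le)
  show ?thesis
  proof (cases "\<exists>n. y n \<notin> B")
    case True
    define \<sigma> where "\<sigma> = (LEAST n. y n \<notin> B)"
    have \<sigma>: "y \<sigma> \<notin> B" "\<And>k. k < \<sigma> \<Longrightarrow> y k \<in> B"
      unfolding \<sigma>_def using True LeastI_ex[of "\<lambda>n. y n \<notin> B"] not_less_Least[of _ "\<lambda>n. y n \<notin> B"] by blast+
    have iff: "(\<forall>k\<le>n. y k \<in> B) \<longleftrightarrow> n < \<sigma>" for n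
      using \<sigma> by (metis le_less_trans not_le)
    have "exit_time B (walk_path y \<tau>) = ennreal (arrival \<tau> \<sigma>)"
      unfolding exit_time_def
    proof (rule antisym)
      have "path_at (walk_path y \<tau>) (arrival \<tau> \<sigma>) = y \<sigma>"
        by (rule walk_path_interval[OF \<tau>]) (use pos in \<open>auto simp: arrival_Suc\<close>)
      then show "(INF t\<in>{t. 0 \<le> t \<and> path_at (walk_path y \<tau>) t \<notin> B}. ennreal t) \<le> ennreal (arrival \<tau> \<sigma>)"
        by (intro INF_lower) (use nn \<sigma> in auto)
      show "ennreal (arrival \<tau> \<sigma>) \<le> (INF t\<in>{t. 0 \<le> t \<and> path_at (walk_path y \<tau>) t \<notin> B}. ennreal t)"
      proof (rule INF_greatest)
        fix t assume "t \<in> {t. 0 \<le> t \<and> path_at (walk_path y \<tau>) t \<notin> B}"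
        then have t: "0 \<le> t" "path_at (walk_path y \<tau>) t \<notin> B" by auto
        obtain n where n: "arrival \<tau> n \<le> t" "t < arrival \<tau> (Suc n)" using arrival_interval[OF \<tau> t(1)] .
        then have "y n \<notin> B" using t(2) walk_path_interval[OF \<tau> n, of y] by simp
        then have "\<sigma> \<le> n" using \<sigma> not_le by blast
        then have "arrival \<tau> \<sigma> \<le> t" using arrival_ge[OF \<tau>, of \<sigma> n] n by linarith
        then show "ennreal (arrival \<tau> \<sigma>) \<le> ennreal t" by (rule ennreal_leI)
      qed
    qed
    also have "\<dots> = (\<Sum>n<\<sigma>. ennreal (\<tau> n))" by (rule sum[symmetric])
    also have "\<dots> = (\<Sum>n. ennreal (\<tau> n) * (if \<forall>k\<le>n. y k \<in> B then 1 else 0))"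
      by (subst suminf_finite[of "{..<\<sigma>}"]) (auto simp: iff)
    finally show ?thesis .
  next
    case False
    then have "path_at (walk_path y \<tau>) t \<in> B" for t
      using \<tau> by (simp add: path_at_walk_path)
    then have "exit_time B (walk_path y \<tau>) = \<infinity>"
      by (simp add: exit_time_def)
    also have "\<infinity> = (\<Sum>n. ennreal (\<tau> n))"
    proof (rule ccontr)
      assume "\<infinity> \<noteq> (\<Sum>n. ennreal (\<tau> n))"
      then obtain c where c: "(\<Sum>n. ennreal (\<tau> n)) = ennreal c" "0 \<le> c"
        by (cases "\<Sum>n. ennreal (\<tau> n)") auto
      have "\<forall>\<^sub>F n in sequentially. c < arrival \<tau> n"
        using \<tau> unfolding proper_times_def filterlim_at_top_dense by blast
      then obtain n where n: "c < arrival \<tau> n" unfolding eventually_sequentially by blast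
      have "ennreal (arrival \<tau> n) \<le> ennreal c"
        unfolding sum[symmetric] c(1)[symmetric] by (rule sum_le_suminf) auto
      then show False using n c(2) nn[of n] by (simp add: ennreal_le_iff)
    qed
    finally show ?thesis using False by simp
  qed
qed

section \<open>Dependence of a jump path on its states and holding times\<close>

lemma sets_proper_times [measurable]: "proper_times \<in> sets borel"
proof -
  have [measurable]: "(\<lambda>\<tau>. \<tau> i) \<in> borel_measurable (borel :: (nat \<Rightarrow> real) measure)" for i
    by (intro borel_measurable_continuous_onI continuous_on_product_coordinates)
  have "proper_times = {\<tau> \<in> space borel. (\<forall>n. 0 < \<tau> n) \<and> (\<forall>k::nat. \<exists>N. \<forall>n\<ge>N. real k \<le> (\<Sum>i<n. \<tau> i))}"
    by (auto simp: proper_times_def arrival_def[abs_def] filterlim_at_top eventually_sequentially)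
       (meson order_trans real_arch_simple)
  also have "\<dots> \<in> sets borel" by measurable
  finally show ?thesis .
qed

text \<open>Length of the part of the interval [a, a + b] that lies to the left of s.\<close>

definition clamp_time :: "real \<Rightarrow> real \<Rightarrow> real \<Rightarrow> real" where
  "clamp_time a b s = max 0 (min (s - a) b)"

text \<open>The piecewise linear time change that matches the first \<open>n\<close> arrival times.\<close>

definition match_times :: "(nat \<Rightarrow> real) \<Rightarrow> (nat \<Rightarrow> real) \<Rightarrow> nat \<Rightarrow> real \<Rightarrow> real" where
  "match_times \<tau> \<tau>' n s = (\<Sum>j<n. \<tau>' j / \<tau> j * clamp_time (arrival \<tau> j) (\<tau> j) s) + max 0 (s - arrival \<tau> n)"

lemma sum_clamp_time:
  assumes pos: "\<And>j. 0 < \<tau> j" and s: "0 \<le> s"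
  shows "(\<Sum>j<n. clamp_time (arrival \<tau> j) (\<tau> j) s) + max 0 (s - arrival \<tau> n) = s"
proof (induction n)
  case 0 then show ?case using s by simp
next
  case (Suc n)
  have "clamp_time (arrival \<tau> n) (\<tau> n) s + max 0 (s - arrival \<tau> (Suc n)) = max 0 (s - arrival \<tau> n)"
    using pos[of n] by (simp add: clamp_time_def arrival_Suc max_def min_def)
  with Suc show ?case by simp
qed

lemma match_times_arrival:
  assumes pos: "\<And>j. 0 < \<tau> j" and k: "k \<le> n"
  shows "match_times \<tau> \<tau>' n (arrival \<tau> k) = arrival \<tau>' k"
proof -
  have mono: "arrival \<tau> i \<le> arrival \<tau> j" if "i \<le> j" for i j
    unfolding arrival_def using that pos by (intro sum_mono2) (auto simp: less_imp_le)
  have "clamp_time (arrival \<tau> j) (\<tau> j) (arrival \<tau> k) = (if j < k then \<tau> j else 0)" for j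
    using mono[of "Suc j" k] mono[of k j] pos[of j] by (auto simp: clamp_time_def arrival_Suc)
  then have "(\<Sum>j<n. \<tau>' j / \<tau> j * clamp_time (arrival \<tau> j) (\<tau> j) (arrival \<tau> k)) = (\<Sum>j<n. if j < k then \<tau>' j else 0)"
    using pos by (intro sum.cong) (auto simp: less_imp_neq[symmetric])
  also have "\<dots> = arrival \<tau>' k"
    unfolding arrival_def using k by (intro sum.mono_neutral_cong_right) auto
  finally show ?thesis using mono[OF k] by (simp add: match_times_def)
qed

text \<open>Each holding interval contributes the change of its length times the fraction of it
  already passed at time s, a number in [0,1].\<close>

lemma match_times_close:
  assumes pos: "\<And>j. 0 < \<tau> j" and s: "0 \<le> s"
  shows "\<bar>match_times \<tau> \<tau>' n s - s\<bar> \<le> (\<Sum>j<n. \<bar>\<tau>' j - \<tau> j\<bar>)"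
proof -
  have "match_times \<tau> \<tau>' n s - s = (\<Sum>j<n. (\<tau>' j - \<tau> j) * (clamp_time (arrival \<tau> j) (\<tau> j) s / \<tau> j))"
  proof -
    have "(\<tau>' j - \<tau> j) * (clamp_time (arrival \<tau> j) (\<tau> j) s / \<tau> j) =
        \<tau>' j / \<tau> j * clamp_time (arrival \<tau> j) (\<tau> j) s - clamp_time (arrival \<tau> j) (\<tau> j) s" for j
      using pos[of j] by (simp add: field_simps)
    then have "(\<Sum>j<n. (\<tau>' j - \<tau> j) * (clamp_time (arrival \<tau> j) (\<tau> j) s / \<tau> j)) =
       (\<Sum>j<n. \<tau>' j / \<tau> j * clamp_time (arrival \<tau> j) (\<tau> j) s) - (\<Sum>j<n. clamp_time (arrival \<tau> j) (\<tau> j) s)"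
      by (simp only: sum_subtractf)
    then show ?thesis
      using sum_clamp_time[where \<tau>=\<tau> and n=n, OF pos s] unfolding match_times_def by linarith
  qed
  also have "\<bar>\<dots>\<bar> \<le> (\<Sum>j<n. \<bar>(\<tau>' j - \<tau> j) * (clamp_time (arrival \<tau> j) (\<tau> j) s / \<tau> j)\<bar>)"
    by (rule sum_abs)
  also have "\<dots> \<le> (\<Sum>j<n. \<bar>\<tau>' j - \<tau> j\<bar>)"
  proof (rule sum_mono)
    fix j
    have "\<bar>clamp_time (arrival \<tau> j) (\<tau> j) s / \<tau> j\<bar> \<le> 1"
      using pos[of j] by (auto simp: clamp_time_def)
    then show "\<bar>(\<tau>' j - \<tau> j) * (clamp_time (arrival \<tau> j) (\<tau> j) s / \<tau> j)\<bar> \<le> \<bar>\<tau>' j - \<tau> j\<bar>"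
      unfolding abs_mult by (rule mult_left_le) simp
  qed
  finally show ?thesis .
qed

lemma clamp_time_mono: "s \<le> t \<Longrightarrow> clamp_time a b s \<le> clamp_time a b t"
  by (auto simp: clamp_time_def)

text \<open>All slopes are ratios of holding times, or 1 after the last matched arrival. Their
  minimum yields strict monotonicity and unboundedness, hence a time change.\<close>

lemma match_times_growth:
  assumes pos: "\<And>j. 0 < \<tau> j" and pos': "\<And>j. 0 < \<tau>' j"
  obtains c where "0 < c" "\<And>s t. 0 \<le> s \<Longrightarrow> s \<le> t \<Longrightarrow> c * (t - s) \<le> match_times \<tau> \<tau>' n t - match_times \<tau> \<tau>' n s"
proof -
  define c where "c = Min (insert 1 ((\<lambda>j. \<tau>' j / \<tau> j) ` {..<n}))"
  have c: "0 < c" "c \<le> 1" "\<And>j. j < n \<Longrightarrow> c \<le> \<tau>' j / \<tau> j"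
    unfolding c_def using pos pos' by (auto simp: Min_gr_iff intro!: Min_le)
  have "c * (t - s) \<le> match_times \<tau> \<tau>' n t - match_times \<tau> \<tau>' n s" if st: "0 \<le> s" "s \<le> t" for s t
  proof -
    let ?d = "\<lambda>j. clamp_time (arrival \<tau> j) (\<tau> j) t - clamp_time (arrival \<tau> j) (\<tau> j) s"
    let ?m = "max 0 (t - arrival \<tau> n) - max 0 (s - arrival \<tau> n)"
    have "t - s = (\<Sum>j<n. ?d j) + ?m"
      using sum_clamp_time[where \<tau>=\<tau> and n=n and s=s, OF pos] sum_clamp_time[where \<tau>=\<tau> and n=n and s=t, OF pos] st
      unfolding sum_subtractf by linarith
    then have "c * (t - s) = (\<Sum>j<n. c * ?d j) + c * ?m"
      by (simp only: distrib_left sum_distrib_left)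
    also have "\<dots> \<le> (\<Sum>j<n. \<tau>' j / \<tau> j * ?d j) + 1 * ?m"
      using st by (intro add_mono sum_mono mult_right_mono c) (auto simp: clamp_time_mono)
    also have "\<dots> = match_times \<tau> \<tau>' n t - match_times \<tau> \<tau>' n s"
      by (simp add: match_times_def right_diff_distrib sum_subtractf)
    finally show ?thesis .
  qed
  with c(1) show thesis by (rule that)
qed

lemma match_times_time_change:
  assumes pos: "\<And>j. 0 < \<tau> j" and pos': "\<And>j. 0 < \<tau>' j"
  shows "match_times \<tau> \<tau>' n \<in> time_changes"
proof -
  let ?l = "match_times \<tau> \<tau>' n"
  obtain c where c: "0 < c" "\<And>s t. 0 \<le> s \<Longrightarrow> s \<le> t \<Longrightarrow> c * (t - s) \<le> ?l t - ?l s"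
    using match_times_growth[of \<tau> \<tau>' n, OF pos pos'] by blast
  have l0: "?l 0 = 0" using match_times_arrival[of \<tau> 0 n \<tau>', OF pos] by simp
  have "strict_mono_on {0..} ?l"
  proof (rule strict_mono_onI)
    fix s t :: real assume st: "s \<in> {0..}" "t \<in> {0..}" "s < t"
    then have "0 < c * (t - s)" using c(1) by simp
    also have "\<dots> \<le> ?l t - ?l s" using st by (intro c) auto
    finally show "?l s < ?l t" by simp
  qed
  moreover have "?l ` {0..} = {0..}"
  proof
    show "?l ` {0..} \<subseteq> {0..}"
    proof (rule image_subsetI)
      fix s :: real assume "s \<in> {0..}"
      then have "0 \<le> c * (s - 0)" "c * (s - 0) \<le> ?l s - ?l 0" using c(1) c(2)[of 0 s] by auto
      then show "?l s \<in> {0..}" using l0 by simp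
    qed
    show "{0..} \<subseteq> ?l ` {0..}"
    proof
      fix u :: real assume u: "u \<in> {0..}"
      have "c * (u / c - 0) \<le> ?l (u / c) - ?l 0" using c(1) u by (intro c) auto
      then have "u \<le> ?l (u / c)" using c(1) l0 by simp
      moreover have "continuous_on {0..u / c} ?l"
        unfolding match_times_def clamp_time_def by (intro continuous_intros)
      ultimately obtain s where "0 \<le> s" "s \<le> u / c" "?l s = u"
        using IVT'[of ?l 0 u "u / c"] l0 u c(1) by auto
      then show "u \<in> ?l ` {0..}" by auto
    qed
  qed
  ultimately show ?thesis by (simp add: time_changes_def)
qed

text \<open>Once the first n arrival times are matched, both paths sit in their k-th states
  simultaneously; the window [0, 1/e] is over before the n-th arrival, so only n coordinates
  matter.\<close>

lemma walk_path_J1_nbhd: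
  assumes \<tau>: "\<tau> \<in> proper_times" and \<tau>': "\<tau>' \<in> proper_times" and n: "1 / e < arrival \<tau> n"
    and t: "(\<Sum>j<n. \<bar>\<tau>' j - \<tau> j\<bar>) \<le> e" and y: "\<And>j. j < n \<Longrightarrow> dist (y' j) (y j) \<le> e"
  shows "walk_path y' \<tau>' \<in> J1_nbhd (walk_path y \<tau>) e"
proof -
  have pos: "0 < \<tau> j" "0 < \<tau>' j" for j using \<tau> \<tau>' by (auto simp: proper_times_def)
  let ?l = "match_times \<tau> \<tau>' n"
  have tc: "?l \<in> time_changes" by (rule match_times_time_change[OF pos])
  have "dist (path_at (walk_path y' \<tau>') (?l s)) (path_at (walk_path y \<tau>) s) \<le> e" if s: "s \<in> {0..1 / e}" for s
  proof -
    have "0 \<le> s" "s < arrival \<tau> n" using s n by auto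
    obtain k where k: "arrival \<tau> k \<le> s" "s < arrival \<tau> (Suc k)" using arrival_interval[OF \<tau> \<open>0 \<le> s\<close>] .
    have "arrival \<tau> k < arrival \<tau> n" using k \<open>s < arrival \<tau> n\<close> by linarith
    then have kn: "k < n" using strict_mono_less[OF strict_mono_arrival[OF \<tau>]] by simp
    have ak: "0 \<le> arrival \<tau> k" using arrival_ge[OF \<tau>, of 0 k] by simp
    have sm: "strict_mono_on {0..} ?l" using tc by (simp add: time_changes_def)
    have "?l (arrival \<tau> k) \<le> ?l s"
      using strict_mono_on_leD[OF sm] k(1) ak by simp
    moreover have "?l s < ?l (arrival \<tau> (Suc k))"
      using strict_mono_onD[OF sm] k ak by simp
    moreover have "?l (arrival \<tau> k) = arrival \<tau>' k" "?l (arrival \<tau> (Suc k)) = arrival \<tau>' (Suc k)"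
      using kn by (auto intro!: match_times_arrival[OF pos(1)])
    ultimately have "path_at (walk_path y' \<tau>') (?l s) = y' k"
      by (intro walk_path_interval[OF \<tau>']) auto
    then show ?thesis using y[OF kn] walk_path_interval[OF \<tau> k, of y] by simp
  qed
  moreover have "\<bar>?l s - s\<bar> \<le> e" if "0 \<le> s" for s
    using match_times_close[OF pos(1) that] t by (rule order_trans)
  ultimately show ?thesis unfolding J1_nbhd_def using tc by blast
qed

text \<open>The map is treated on two Borel pieces, proper and improper holding times, and is
  continuous on each.\<close>

lemma measurable_walk_path [measurable]:
  "(\<lambda>(y, \<tau>). walk_path y \<tau>) \<in> (borel :: ((nat \<Rightarrow> 'a::polish_space) \<times> (nat \<Rightarrow> real)) measure) \<rightarrow>\<^sub>M borel"
proof -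
  let ?A = "UNIV \<times> proper_times :: ((nat \<Rightarrow> 'a) \<times> (nat \<Rightarrow> real)) set"
  have "?A = snd -` proper_times \<inter> space borel" by auto
  moreover have "snd \<in> (borel :: ((nat \<Rightarrow> 'a) \<times> (nat \<Rightarrow> real)) measure) \<rightarrow>\<^sub>M borel"
    by (intro borel_measurable_continuous_onI continuous_on_snd continuous_on_id)
  ultimately have A: "?A \<in> sets borel" using measurable_sets[OF _ sets_proper_times] by metis
  have coord: "((\<lambda>p. dist (fst p j) (y j)) \<longlongrightarrow> 0) (at (y, \<tau>) within S)" "((\<lambda>p. snd p j) \<longlongrightarrow> \<tau> j) (at (y, \<tau>) within S)"
    for j and y :: "nat \<Rightarrow> 'a" and \<tau> :: "nat \<Rightarrow> real" and S
  proof -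
    have "continuous_on UNIV (\<lambda>p :: (nat \<Rightarrow> 'a) \<times> (nat \<Rightarrow> real). dist (fst p j) (y j))"
      by (intro continuous_intros continuous_on_compose2[OF continuous_on_product_coordinates[of j]]) auto
    then have "((\<lambda>p. dist (fst p j) (y j)) \<longlongrightarrow> dist (fst (y, \<tau>) j) (y j)) (at (y, \<tau>))"
      unfolding continuous_on_def by blast
    then show "((\<lambda>p. dist (fst p j) (y j)) \<longlongrightarrow> 0) (at (y, \<tau>) within S)"
      by (auto intro: tendsto_within_subset)
    have "continuous_on UNIV (\<lambda>p :: (nat \<Rightarrow> 'a) \<times> (nat \<Rightarrow> real). snd p j)"
      by (intro continuous_intros continuous_on_compose2[OF continuous_on_product_coordinates[of j]]) auto
    then have "((\<lambda>p. snd p j) \<longlongrightarrow> snd (y, \<tau>) j) (at (y, \<tau>))"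
      unfolding continuous_on_def by blast
    then show "((\<lambda>p. snd p j) \<longlongrightarrow> \<tau> j) (at (y, \<tau>) within S)"
      by (auto intro: tendsto_within_subset)
  qed
  have "continuous_on ?A (\<lambda>(y, \<tau>). walk_path y \<tau>)"
    unfolding continuous_on_def
  proof
    fix p assume "p \<in> ?A"
    then obtain y \<tau> where p: "p = (y, \<tau>)" and \<tau>: "\<tau> \<in> proper_times" by auto
    show "((\<lambda>(y, \<tau>). walk_path y \<tau>) \<longlongrightarrow> (case p of (y, \<tau>) \<Rightarrow> walk_path y \<tau>)) (at p within ?A)"
      unfolding p split_conv filterlim_iff eventually_nhds_cadlag
    proof (intro allI impI, elim exE conjE)
      fix Q :: "'a cadlag \<Rightarrow> bool" and e :: real
      assume e: "0 < e" and Q: "\<forall>\<eta>\<in>J1_nbhd (walk_path y \<tau>) e. Q \<eta>"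
      have "\<forall>\<^sub>F n in sequentially. 1 / e < arrival \<tau> n"
        using \<tau> unfolding proper_times_def filterlim_at_top_dense by blast
      then obtain n where n: "1 / e < arrival \<tau> n" unfolding eventually_sequentially by blast
      have "((\<lambda>p. \<Sum>j<n. \<bar>snd p j - \<tau> j\<bar>) \<longlongrightarrow> (\<Sum>j<n. \<bar>\<tau> j - \<tau> j\<bar>)) (at (y, \<tau>) within ?A)"
        by (intro tendsto_intros coord)
      then have "\<forall>\<^sub>F p in at (y, \<tau>) within ?A. (\<Sum>j<n. \<bar>snd p j - \<tau> j\<bar>) < e"
        by (rule order_tendstoD) (use e in simp)
      moreover have "\<forall>\<^sub>F p in at (y, \<tau>) within ?A. \<forall>j\<in>{..<n}. dist (fst p j) (y j) < e"
        by (intro eventually_ball_finite ballI order_tendstoD[OF coord(1)] e) simp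
      moreover have "\<forall>\<^sub>F p in at (y, \<tau>) within ?A. p \<in> ?A"
        by (simp add: eventually_at_filter)
      ultimately show "\<forall>\<^sub>F p in at (y, \<tau>) within ?A. Q (case p of (y, \<tau>) \<Rightarrow> walk_path y \<tau>)"
      proof eventually_elim
        case (elim p)
        have "walk_path (fst p) (snd p) \<in> J1_nbhd (walk_path y \<tau>) e"
          by (rule walk_path_J1_nbhd[OF \<tau> _ n]) (use elim in \<open>auto simp: less_imp_le\<close>)
        then show ?case using Q by (simp add: case_prod_beta)
      qed
    qed
  qed
  \<comment> \<open>Improper holding times give the constant path at \<open>y 0\<close>. Zero
    holding times are improper, so \<open>g\<close> is that path as a function of \<open>y 0\<close>
    alone.\<close>
  moreover define g where "g = (\<lambda>p :: (nat \<Rightarrow> 'a) \<times> (nat \<Rightarrow> real). walk_path (\<lambda>_. fst p 0) (\<lambda>_. 0))"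
  have z: "(\<lambda>_. 0) \<notin> proper_times" by (simp add: proper_times_def)
  have "continuous_on (- ?A) g"
    unfolding continuous_on_def
  proof
    fix p :: "(nat \<Rightarrow> 'a) \<times> (nat \<Rightarrow> real)"
    obtain y \<tau> where p: "p = (y, \<tau>)" by (cases p)
    show "(g \<longlongrightarrow> g p) (at p within - ?A)"
      unfolding filterlim_iff eventually_nhds_cadlag
    proof (intro allI impI, elim exE conjE)
      fix Q :: "'a cadlag \<Rightarrow> bool" and e :: real
      assume e: "0 < e" and Q: "\<forall>\<eta>\<in>J1_nbhd (g p) e. Q \<eta>"
      have "\<forall>\<^sub>F q in at p within - ?A. dist (fst q 0) (y 0) < e"
        unfolding p by (rule order_tendstoD[OF coord(1)]) (rule e)
      then show "\<forall>\<^sub>F q in at p within - ?A. Q (g q)"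
      proof eventually_elim
        case (elim q)
        have "g q \<in> J1_nbhd (g p) e"
          unfolding J1_nbhd_def mem_Collect_eq
          by (rule bexI[of _ "\<lambda>s. s"])
            (use elim e in \<open>auto simp: time_changes_def strict_mono_on_def g_def walk_path_improper[OF z] p less_imp_le\<close>)
        then show ?case using Q by blast
      qed
    qed
  qed
  ultimately have "(\<lambda>p. if p \<in> ?A then (case p of (y, \<tau>) \<Rightarrow> walk_path y \<tau>) else g p) \<in> borel \<rightarrow>\<^sub>M borel"
    by (rule borel_measurable_continuous_on_if[OF A])
  also have "(\<lambda>p. if p \<in> ?A then (case p of (y, \<tau>) \<Rightarrow> walk_path y \<tau>) else g p) = (\<lambda>(y, \<tau>). walk_path y \<tau>)"
  proof
    fix p :: "(nat \<Rightarrow> 'a) \<times> (nat \<Rightarrow> real)"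
    obtain y \<tau> where p: "p = (y, \<tau>)" by (cases p)
    have "walk_path y \<tau> = g p" if "\<tau> \<notin> proper_times"
      using that by (intro iffD1[OF path_at_inject] ext) (simp add: g_def p walk_path_improper z)
    then show "(if p \<in> ?A then (case p of (y, \<tau>) \<Rightarrow> walk_path y \<tau>) else g p) = (case p of (y, \<tau>) \<Rightarrow> walk_path y \<tau>)"
      by (auto simp: p)
  qed
  finally show ?thesis .
qed

section \<open>Markov chains and exponential clocks\<close>

locale markov_chain =
  fixes K :: "'a::polish_space \<Rightarrow> 'a measure"
  assumes measurable_K [measurable]: "K \<in> borel \<rightarrow>\<^sub>M subprob_algebra borel"
    and prob_space_K: "\<And>x. prob_space (K x)"
begin

lemma sets_K [measurable_cong]: "sets (K x) = sets borel"
  using measurable_space[OF measurable_K, of x] by (auto simp: space_subprob_algebra)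

context
  fixes x :: 'a
begin

interpretation IT: Ionescu_Tulcea "chain_step K x" "\<lambda>_. borel"
  by (rule Ionescu_Tulcea_chain_step[OF measurable_K prob_space_K])

lemma chain_law_eq_lim: "chain_law K x = IT.PF.lim"
  unfolding chain_law_def ..

lemma sets_chain_law_PiM: "sets (chain_law K x) = sets (PiM UNIV (\<lambda>_. borel))"
  unfolding chain_law_eq_lim by (rule IT.PF.sets_lim)

lemma sets_chain_law [measurable_cong]: "sets (chain_law K x) = sets borel"
  unfolding sets_chain_law_PiM by (rule sets_PiM_equal_borel)

lemma CI_eq_C: "IT.CI {0..<n} = IT.C 0 n (\<lambda>_. undefined)"
proof (rule measure_eqI)
  show "sets (IT.CI {0..<n}) = sets (IT.C 0 n (\<lambda>_. undefined))"
    by (simp add: IT.CI_def IT.sets_C)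
  fix X assume "X \<in> sets (IT.CI {0..<n})"
  then have X: "X \<in> sets (PiM {0..<n} (\<lambda>_. borel))" by (simp add: IT.CI_def)
  then show "emeasure (IT.CI {0..<n}) X = emeasure (IT.C 0 n (\<lambda>_. undefined)) X"
    using sets.sets_into_space[OF X] by (subst IT.emeasure_CI) (auto simp: prod_emb_id space_PiM)
qed

lemma distr_chain_law:
  "distr (chain_law K x) (PiM {0..<n} (\<lambda>_. borel)) (\<lambda>y. restrict y {0..<n}) = IT.C 0 n (\<lambda>_. undefined)"
  unfolding chain_law_eq_lim by (subst IT.distr_lim) (simp_all add: CI_eq_C)

lemma prob_space_chain_law: "prob_space (chain_law K x)"
proof -
  interpret C: prob_space "IT.C 0 0 (\<lambda>_. undefined)" by (rule IT.prob_space_C) simp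
  have "(\<lambda>y. restrict y {0..<0}) \<in> chain_law K x \<rightarrow>\<^sub>M PiM {0..<0} (\<lambda>_. borel :: 'a measure)"
    unfolding measurable_cong_sets[OF sets_chain_law_PiM refl] by (rule measurable_restrict_subset) simp
  then have "emeasure (chain_law K x) (space (chain_law K x)) = emeasure (IT.C 0 0 (\<lambda>_. undefined)) (space (IT.C 0 0 (\<lambda>_. undefined)))"
    unfolding distr_chain_law[symmetric] space_distr
    by (subst emeasure_distr) (auto simp: measurable_space intro!: arg_cong[of _ _ "emeasure _"])
  then show ?thesis using C.emeasure_space_1 by (intro prob_spaceI) simp
qed

lemma nn_integral_chain_law_C:
  assumes [measurable]: "F \<in> borel_measurable (PiM {0..<n} (\<lambda>_. borel))"
  shows "(\<integral>\<^sup>+y. F (restrict y {0..<n}) \<partial>chain_law K x) = (\<integral>\<^sup>+\<omega>. F \<omega> \<partial>IT.C 0 n (\<lambda>_. undefined))"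
proof -
  have [measurable]: "(\<lambda>y. restrict y {0..<n}) \<in> chain_law K x \<rightarrow>\<^sub>M PiM {0..<n} (\<lambda>_. borel)"
    unfolding measurable_cong_sets[OF sets_chain_law_PiM refl] by (rule measurable_restrict_subset) simp
  show ?thesis
    unfolding distr_chain_law[symmetric] by (subst nn_integral_distr) auto
qed

lemma AE_chain_law_0: "AE y in chain_law K x. y 0 = x"
proof -
  have m: "(\<lambda>\<omega>. indicator {x} (\<omega> 0) :: ennreal) \<in> borel_measurable (PiM {0..<Suc 0} (\<lambda>_. borel :: 'a measure))"
    by measurable
  interpret prob_space "chain_law K x" by (rule prob_space_chain_law)
  have c: "(\<lambda>y :: nat \<Rightarrow> 'a. y 0) \<in> borel_measurable borel"
    by (intro borel_measurable_continuous_onI continuous_on_product_coordinates)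
  have "(\<lambda>y :: nat \<Rightarrow> 'a. y 0) -` {x} \<in> sets borel"
    by (rule measurable_sets_borel[OF c]) simp
  then have s: "{y :: nat \<Rightarrow> 'a. y 0 = x} \<in> sets (chain_law K x)"
    by (simp add: vimage_def sets_chain_law)
  have "emeasure (chain_law K x) {y. y 0 = x} = (\<integral>\<^sup>+y. indicator {y. y 0 = x} y \<partial>chain_law K x)"
    by (rule nn_integral_indicator[OF s, symmetric])
  also have "\<dots> = (\<integral>\<^sup>+y. indicator {x} (restrict y {0..<Suc 0} 0) \<partial>chain_law K x)"
    by (intro nn_integral_cong) (auto split: split_indicator)
  also have "\<dots> = (\<integral>\<^sup>+\<omega>. indicator {x} (\<omega> 0) \<partial>IT.C 0 (Suc 0) (\<lambda>_. undefined))"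
    by (rule nn_integral_chain_law_C[OF m])
  also have "\<dots> = (\<integral>\<^sup>+\<omega>. indicator {x} (\<omega> 0) \<partial>IT.eP 0 (\<lambda>_. undefined))"
    using IT.measurable_eP[of 0] by (simp add: bind_return)
  also have "\<dots> = (\<integral>\<^sup>+z. indicator {x} z \<partial>return borel x)"
    using m by (subst IT.nn_integral_eP) (auto simp: space_PiM)
  also have "\<dots> = 1" by (subst nn_integral_return) auto
  finally have "emeasure (chain_law K x) {y. y 0 = x} = 1" .
  then show ?thesis
    using AE_in_set_eq_1[OF s] by (simp add: emeasure_eq_measure)
qed

text \<open>The Markov property in the form used throughout: \<open>f\<close> may depend on the
  whole past up to n, but as a function on infinite sequences, which is why adaptedness is a
  hypothesis.\<close>

lemma nn_integral_chain_law_Suc: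
  assumes f [measurable]: "f \<in> borel_measurable (borel :: ((nat \<Rightarrow> 'a) \<times> 'a) measure)"
    and adapted: "\<And>y y' z. (\<And>i. i \<le> n \<Longrightarrow> y i = y' i) \<Longrightarrow> f (y, z) = f (y', z)"
  shows "(\<integral>\<^sup>+y. f (y, y (Suc n)) \<partial>chain_law K x) = (\<integral>\<^sup>+y. (\<integral>\<^sup>+z. f (y, z) \<partial>K (y n)) \<partial>chain_law K x)"
proof -
  let ?J = "{0..<Suc n}" and ?u = "\<lambda>_. undefined :: 'a"
  \<comment> \<open>Pads a finite history to an infinite sequence; by adaptedness the padding does
    not influence \<open>f\<close>.\<close>
  define e where "e \<omega> i = (if i \<le> n then \<omega> i else undefined)" for \<omega> :: "nat \<Rightarrow> 'a" and i :: nat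
  have e_meas: "e \<in> PiM {0..<m} (\<lambda>_. borel) \<rightarrow>\<^sub>M borel" if "Suc n \<le> m" for m
  proof (rule measurable_coordinatewise_then_product)
    fix i
    show "(\<lambda>\<omega>. e \<omega> i) \<in> PiM {0..<m} (\<lambda>_. borel) \<rightarrow>\<^sub>M borel"
      using that by (cases "i \<le> n") (auto simp: e_def intro!: measurable_component_singleton)
  qed
  note [measurable] = e_meas[OF order_refl] e_meas[of "Suc (Suc n)", simplified]
  have [measurable]: "(\<lambda>\<omega>. \<omega> n) \<in> PiM ?J (\<lambda>_. borel) \<rightarrow>\<^sub>M (borel :: 'a measure)"
      "(\<lambda>\<omega>. \<omega> (Suc n)) \<in> PiM {0..<Suc (Suc n)} (\<lambda>_. borel) \<rightarrow>\<^sub>M (borel :: 'a measure)"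
    by (auto intro!: measurable_component_singleton)
  define F where "F \<omega> = f (e \<omega>, \<omega> (Suc n))" for \<omega>
  have F[measurable]: "F \<in> borel_measurable (PiM {0..<Suc (Suc n)} (\<lambda>_. borel))"
    unfolding F_def[abs_def] by measurable
  define G where "G \<omega> = (\<integral>\<^sup>+z. f (e \<omega>, z) \<partial>K (\<omega> n))" for \<omega>
  have G[measurable]: "G \<in> borel_measurable (PiM ?J (\<lambda>_. borel))"
    unfolding G_def[abs_def]
    by (rule nn_integral_measurable_subprob_algebra2[where N = borel]) measurable
  have "(\<integral>\<^sup>+y. f (y, y (Suc n)) \<partial>chain_law K x) = (\<integral>\<^sup>+y. F (restrict y {0..<Suc (Suc n)}) \<partial>chain_law K x)"
    by (intro nn_integral_cong) (auto simp: F_def e_def intro!: adapted)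
  also have "\<dots> = (\<integral>\<^sup>+\<omega>. F \<omega> \<partial>IT.C 0 (Suc (Suc n)) ?u)"
    by (rule nn_integral_chain_law_C[OF F])
  also have "\<dots> = (\<integral>\<^sup>+\<omega>. (\<integral>\<^sup>+\<eta>. F \<eta> \<partial>IT.eP (Suc n) \<omega>) \<partial>IT.C 0 (Suc n) ?u)"
  proof -
    have "IT.C 0 (Suc (Suc n)) ?u = IT.C 0 (Suc n) ?u \<bind> IT.eP (Suc n)" by simp
    moreover have "IT.eP (Suc n) \<in> IT.C 0 (Suc n) ?u \<rightarrow>\<^sub>M subprob_algebra (PiM {0..<Suc (Suc n)} (\<lambda>_. borel))"
      using IT.measurable_eP[of "Suc n"] IT.sets_C[of ?u 0 "Suc n"] by (simp cong: measurable_cong_sets)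
    ultimately show ?thesis
      using F by (simp only: nn_integral_bind)
  qed
  also have "\<dots> = (\<integral>\<^sup>+\<omega>. G \<omega> \<partial>IT.C 0 (Suc n) ?u)"
  proof (rule nn_integral_cong)
    fix \<omega> assume "\<omega> \<in> space (IT.C 0 (Suc n) ?u)"
    then have \<omega>: "\<omega> \<in> space (PiM {0..<Suc n} (\<lambda>_. borel))" using IT.space_C[of ?u 0 "Suc n"] by simp
    have "(\<integral>\<^sup>+\<eta>. F \<eta> \<partial>IT.eP (Suc n) \<omega>) = (\<integral>\<^sup>+z. F (fun_upd \<omega> (Suc n) z) \<partial>K (\<omega> n))"
      using IT.nn_integral_eP[OF \<omega> F] by simp
    also have "\<dots> = G \<omega>"
      unfolding G_def F_def by (intro nn_integral_cong) (auto simp: e_def intro!: adapted)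
    finally show "(\<integral>\<^sup>+\<eta>. F \<eta> \<partial>IT.eP (Suc n) \<omega>) = G \<omega>" .
  qed
  also have "\<dots> = (\<integral>\<^sup>+y. G (restrict y {0..<Suc n}) \<partial>chain_law K x)"
    by (rule nn_integral_chain_law_C[OF G, symmetric])
  also have "\<dots> = (\<integral>\<^sup>+y. (\<integral>\<^sup>+z. f (y, z) \<partial>K (y n)) \<partial>chain_law K x)"
    unfolding G_def by (intro nn_integral_cong) (auto simp: e_def intro!: nn_integral_cong adapted)
  finally show ?thesis .
qed

end

end

section \<open>Independent exponential clocks\<close>

abbreviation std_exp :: "real measure" where
  "std_exp \<equiv> density lborel (exponential_density 1)"

lemma prob_space_std_exp: "prob_space std_exp"
  by (rule prob_space_exponential_density) simp

lemma nn_integral_std_exp_exp: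
  assumes "0 \<le> c"
  shows "(\<integral>\<^sup>+u. ennreal (exp (- (c * u))) \<partial>std_exp) = ennreal (1 / (1 + c))"
proof -
  have "(\<integral>\<^sup>+u. ennreal (exp (- (c * u))) \<partial>std_exp) =
      (\<integral>\<^sup>+u. ennreal (1 / (1 + c)) * ennreal (exponential_density (1 + c) u) \<partial>lborel)"
  proof -
    have "ennreal (exponential_density 1 u) * ennreal (exp (- (c * u))) =
        ennreal (1 / (1 + c)) * ennreal (exponential_density (1 + c) u)" for u
    proof -
      have "exponential_density 1 u * exp (- (c * u)) = 1 / (1 + c) * exponential_density (1 + c) u"
        using assms
        by (simp add: exponential_density_def mult_exp_exp nonzero_eq_divide_eq add_nonneg_eq_0_iff algebra_simps)
      then show ?thesis
        using assms by (simp add: ennreal_mult'[symmetric] exponential_density_def)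
    qed
    then show ?thesis by (subst nn_integral_density) simp_all
  qed
  also have "\<dots> = ennreal (1 / (1 + c)) * (\<integral>\<^sup>+u. ennreal (exponential_density (1 + c) u) \<partial>lborel)"
    by (rule nn_integral_cmult) simp
  also have "(\<integral>\<^sup>+u. ennreal (exponential_density (1 + c) u) \<partial>lborel) = 1"
    using prob_space.emeasure_space_1[OF prob_space_exponential_density[of "1 + c"]] assms
    by (simp add: emeasure_density)
  finally show ?thesis by simp
qed

lemma nn_integral_std_exp_id: "(\<integral>\<^sup>+u. ennreal u \<partial>std_exp) = 1"
proof -
  have "prob_space std_exp" by (rule prob_space_std_exp)
  have "(\<integral>\<^sup>+u. ennreal u \<partial>std_exp) = (\<integral>\<^sup>+u. ennreal (exponential_density 1 u) * ennreal u \<partial>lborel)"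
    by (subst nn_integral_density) simp_all
  also have "\<dots> = (\<integral>\<^sup>+u. ennreal (exponential_density 1 u * u ^ 1) \<partial>lborel)"
    by (intro nn_integral_cong) (auto simp: exponential_density_def ennreal_mult')
  also have "\<dots> = 1"
    using nn_integral_erlang_ith_moment[of 1 0 1] by simp
  finally show ?thesis .
qed

abbreviation clocks :: "(nat \<Rightarrow> real) measure" where
  "clocks \<equiv> Pi\<^sub>M UNIV (\<lambda>_. std_exp)"

interpretation std_exp: prob_space std_exp by (rule prob_space_std_exp)

interpretation clocks: product_prob_space "\<lambda>_ :: nat. std_exp" UNIV ..

lemma sets_clocks: "sets clocks = sets borel"
proof -
  have "sets clocks = sets (Pi\<^sub>M UNIV (\<lambda>_ :: nat. borel :: real measure))"
    by (rule sets_PiM_cong) auto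
  then show ?thesis by (simp add: sets_PiM_equal_borel)
qed

lemma space_clocks [simp]: "space clocks = UNIV"
  using sets_eq_imp_space_eq[OF sets_clocks] by simp

lemma measurable_nth_borel:
  "(\<lambda>f. f i) \<in> (borel :: ('i::countable \<Rightarrow> 'b::second_countable_topology) measure) \<rightarrow>\<^sub>M borel"
  by (intro borel_measurable_continuous_onI continuous_on_product_coordinates)

lemma measurable_clocks_nth [measurable]: "(\<lambda>e. e i) \<in> borel_measurable clocks"
  unfolding measurable_cong_sets[OF sets_clocks refl] by (rule measurable_nth_borel)

lemma measurable_clocks_nth': "(\<lambda>e. e i) \<in> clocks \<rightarrow>\<^sub>M std_exp"
  by (rule measurable_component_singleton) simp

lemma distr_clocks: "distr clocks std_exp (\<lambda>e. e i) = std_exp"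
  using clocks.PiM_component[of i] by simp

lemma nn_integral_clocks_nth: "(\<integral>\<^sup>+e. ennreal (e i) \<partial>clocks) = 1"
proof -
  have "(\<integral>\<^sup>+e. ennreal (e i) \<partial>clocks) = (\<integral>\<^sup>+u. ennreal u \<partial>distr clocks std_exp (\<lambda>e. e i))"
    by (rule nn_integral_distr[OF measurable_clocks_nth', symmetric]) simp
  then show ?thesis by (simp only: distr_clocks nn_integral_std_exp_id)
qed

lemma AE_clocks_nth: "AE e in clocks. 0 < e i"
proof -
  have "AE u in lborel. u \<noteq> (0::real)" by (rule AE_lborel_singleton)
  then have "AE u in lborel. 0 < ennreal (exponential_density 1 u) \<longrightarrow> 0 < u"
    by eventually_elim (auto simp: exponential_density_def)
  then have "AE u in std_exp. 0 < u"
    by (subst AE_density) simp_all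
  then show ?thesis by (intro AE_PiM_component prob_space_std_exp) simp_all
qed

lemma nn_integral_clocks_exp:
  assumes c: "\<And>i. i < n \<Longrightarrow> 0 \<le> c i"
  shows "(\<integral>\<^sup>+e. ennreal (exp (- (\<Sum>i<n. c i * e i))) \<partial>clocks) = (\<Prod>i<n. ennreal (1 / (1 + c i)))"
proof -
  have "(\<integral>\<^sup>+e. ennreal (exp (- (\<Sum>i<n. c i * e i))) \<partial>clocks) =
      (\<integral>\<^sup>+e. (\<Prod>i<n. ennreal (exp (- (c i * restrict e {..<n} i)))) \<partial>clocks)"
    by (intro nn_integral_cong) (auto simp: sum_negf[symmetric] exp_sum prod_ennreal)
  also have "\<dots> = (\<integral>\<^sup>+e. (\<Prod>i<n. ennreal (exp (- (c i * e i)))) \<partial>Pi\<^sub>M {..<n} (\<lambda>_. std_exp))"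
  proof -
    have "(\<integral>\<^sup>+e. (\<Prod>i<n. ennreal (exp (- (c i * e i)))) \<partial>distr clocks (Pi\<^sub>M {..<n} (\<lambda>_. std_exp)) (\<lambda>e. restrict e {..<n})) =
      (\<integral>\<^sup>+e. (\<Prod>i<n. ennreal (exp (- (c i * restrict e {..<n} i)))) \<partial>clocks)"
    proof (rule nn_integral_distr)
      show "(\<lambda>e. restrict e {..<n}) \<in> clocks \<rightarrow>\<^sub>M Pi\<^sub>M {..<n} (\<lambda>_. std_exp)"
        by (rule measurable_restrict_subset) simp
      have "(\<lambda>e. \<Prod>i<n. ennreal (exp (- (c i * e i)))) \<in> borel_measurable (Pi\<^sub>M {..<n} (\<lambda>_. std_exp))"
      proof (rule borel_measurable_prod_ennreal)
        fix i assume "i \<in> {..<n}"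
        then have [measurable]: "(\<lambda>e. e i) \<in> borel_measurable (Pi\<^sub>M {..<n} (\<lambda>_. std_exp))"
          using measurable_component_singleton[of i "{..<n}" "\<lambda>_. std_exp"] by (simp cong: measurable_cong_sets)
        show "(\<lambda>e. ennreal (exp (- (c i * e i)))) \<in> borel_measurable (Pi\<^sub>M {..<n} (\<lambda>_. std_exp))"
          by measurable
      qed
      then show "(\<lambda>e. \<Prod>i<n. ennreal (exp (- (c i * e i)))) \<in>
          borel_measurable (distr clocks (Pi\<^sub>M {..<n} (\<lambda>_. std_exp)) (\<lambda>e. restrict e {..<n}))"
        by simp
    qed
    then show ?thesis by (simp only: clocks.distr_PiM_restrict_finite[of "{..<n}"] finite_lessThan subset_UNIV)
  qed
  also have "\<dots> = (\<Prod>i<n. \<integral>\<^sup>+u. ennreal (exp (- (c i * u))) \<partial>std_exp)"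
    by (rule clocks.product_nn_integral_prod) auto
  also have "\<dots> = (\<Prod>i<n. ennreal (1 / (1 + c i)))"
    using c by (intro prod.cong nn_integral_std_exp_exp) auto
  finally show ?thesis .
qed

text \<open>Chernoff bound: the n-th arrival is at most k with probability at most exp k / 2^n, so
  all arrivals stay below k with probability 0.\<close>

lemma AE_clocks_proper: "AE e in clocks. e \<in> proper_times"
proof -
  have pos: "AE e in clocks. \<forall>i. 0 < e i"
    by (simp add: AE_all_countable AE_clocks_nth)
  have "AE e in clocks. \<forall>k::nat. \<exists>n. real k < arrival e n"
    unfolding AE_all_countable
  proof
    fix k :: nat
    define V where "V = {e \<in> space clocks. \<forall>n. arrival e n \<le> real k}"
    have V: "V \<in> sets clocks" unfolding V_def arrival_def by measurable
    have le: "emeasure clocks V \<le> ennreal (exp (real k)) * ennreal ((1/2) ^ n)" for n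
    proof -
      have "emeasure clocks V = (\<integral>\<^sup>+e. indicator V e \<partial>clocks)" using V by simp
      also have "\<dots> \<le> (\<integral>\<^sup>+e. ennreal (exp (real k)) * ennreal (exp (- (\<Sum>i<n. 1 * e i))) \<partial>clocks)"
        by (intro nn_integral_mono)
           (auto simp: V_def arrival_def ennreal_mult[symmetric] exp_add[symmetric] split: split_indicator)
      also have "\<dots> = ennreal (exp (real k)) * (\<Prod>i<n. ennreal (1 / (1 + 1)))"
        by (subst nn_integral_cmult, measurable, subst nn_integral_clocks_exp) auto
      also have "(\<Prod>i<n. ennreal (1 / (1 + 1))) = ennreal ((1/2) ^ n)"
        by (subst prod_ennreal) (auto simp: power_divide)
      finally show ?thesis .
    qed
    have "emeasure clocks V \<le> ennreal (exp (real k) * 0)"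
    proof (rule tendsto_lowerbound)
      show "(\<lambda>n. ennreal (exp (real k) * (1/2) ^ n)) \<longlonglongrightarrow> ennreal (exp (real k) * 0)"
        by (intro tendsto_ennrealI tendsto_mult_left LIMSEQ_power_zero) simp
      show "\<forall>\<^sub>F n in sequentially. emeasure clocks V \<le> ennreal (exp (real k) * (1/2) ^ n)"
        using le by (simp add: ennreal_mult)
    qed simp
    then have "V \<in> null_sets clocks" using V by auto
    then have "AE e in clocks. e \<notin> V" by (rule AE_not_in)
    then show "AE e in clocks. \<exists>n. real k < arrival e n"
      by eventually_elim (auto simp: V_def not_le)
  qed
  with pos show ?thesis
  proof eventually_elim
    case (elim e)
    have mono: "arrival e m \<le> arrival e n" if "m \<le> n" for m n
      unfolding arrival_def using that elim(1) by (intro sum_mono2) (auto simp: less_imp_le)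
    have "filterlim (arrival e) at_top sequentially"
      unfolding filterlim_at_top
    proof
      fix z :: real
      obtain k :: nat where "z \<le> real k" using real_arch_simple by blast
      moreover obtain n where "real k < arrival e n" using elim(2) by blast
      ultimately have "\<forall>m\<ge>n. z \<le> arrival e m" using mono by (meson le_less_trans less_imp_le order_trans)
      then show "\<forall>\<^sub>F n in sequentially. z \<le> arrival e n" unfolding eventually_sequentially by blast
    qed
    with elim(1) show ?case by (simp add: proper_times_def)
  qed
qed

lemma proper_times_scale:
  assumes e: "e \<in> proper_times" and c: "0 < c" "\<And>i. c \<le> g i"
  shows "(\<lambda>i. g i * e i) \<in> proper_times"
proof -
  have pos: "0 < e i" for i using e by (simp add: proper_times_def)
  have "filterlim (arrival (\<lambda>i. g i * e i)) at_top sequentially"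
  proof (rule filterlim_at_top_mono)
    show "filterlim (\<lambda>n. c * arrival e n) at_top sequentially"
      using e c(1) by (intro filterlim_tendsto_pos_mult_at_top[OF tendsto_const]) (auto simp: proper_times_def)
    show "\<forall>\<^sub>F n in sequentially. c * arrival e n \<le> arrival (\<lambda>i. g i * e i) n"
      unfolding arrival_def sum_distrib_left using c(2) pos
      by (intro always_eventually allI sum_mono mult_right_mono) (auto simp: less_imp_le)
  qed
  moreover have "0 < g i * e i" for i using pos[of i] c(1) c(2)[of i] by simp
  ultimately show ?thesis by (simp add: proper_times_def)
qed

section \<open>Exit times of jump walks\<close>

text \<open>The index at which the excursion in progress at step n began. A new excursion begins
  whenever the walk is found farther than \<epsilon> from where the current one started.\<close>

primrec start :: "real \<Rightarrow> (nat \<Rightarrow> 'a::metric_space) \<Rightarrow> nat \<Rightarrow> nat" where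
  "start \<epsilon> y 0 = 0"
| "start \<epsilon> y (Suc n) = (if dist (y (start \<epsilon> y n)) (y (Suc n)) \<le> \<epsilon> then start \<epsilon> y n else Suc n)"

lemma start_le: "start \<epsilon> y n \<le> n"
  by (induction n) auto

lemma dist_start: "0 \<le> \<epsilon> \<Longrightarrow> dist (y (start \<epsilon> y n)) (y n) \<le> \<epsilon>"
  by (cases n) auto

lemma start_eqI: "start \<epsilon> y m \<le> n \<Longrightarrow> n \<le> m \<Longrightarrow> start \<epsilon> y n = start \<epsilon> y m"
proof (induction m)
  case (Suc m)
  then show ?case by (cases "n = Suc m") (auto split: if_splits)
qed simp

lemma start_cong: "(\<And>i. i \<le> n \<Longrightarrow> y i = y' i) \<Longrightarrow> start \<epsilon> y n = start \<epsilon> y' n"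
proof (induction n)
  case (Suc n)
  then have "start \<epsilon> y n = start \<epsilon> y' n" by simp
  moreover have "y (start \<epsilon> y' n) = y' (start \<epsilon> y' n)"
    using start_le[of \<epsilon> y' n] by (intro Suc.prems) simp
  ultimately show ?case using Suc.prems[of "Suc n"] by simp
qed simp

text \<open>Within time \<open>\<delta>\<close> a path that moves by more than \<open>4\<epsilon>\<close> must complete an excursion out of an
  \<open>\<epsilon>\<close>-ball, because the jump at which an excursion ends contributes at most \<open>\<epsilon>\<close>.\<close>

lemma oscillating_walk_path:
  assumes \<tau>: "\<tau> \<in> proper_times" and jump: "\<And>n. dist (y n) (y (Suc n)) \<le> \<epsilon>" and \<epsilon>: "0 \<le> \<epsilon>"
    and osc: "on_rats (walk_path y \<tau>) \<in> oscillating N \<delta> (4 * \<epsilon>)"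
  shows "\<exists>n. \<epsilon> < dist (y (start \<epsilon> y n)) (y (Suc n)) \<and> arrival \<tau> (start \<epsilon> y n) \<le> real N \<and>
    arrival \<tau> (Suc n) - arrival \<tau> (start \<epsilon> y n) < \<delta>"
proof -
  let ?\<omega> = "walk_path y \<tau>" and ?s = "start \<epsilon> y"
  have main: ?thesis
    if pq: "0 \<le> p" "p \<le> q" "q \<le> real N" "q - p < \<delta>" "4 * \<epsilon> < dist (path_at ?\<omega> p) (path_at ?\<omega> q)" for p q :: real
  proof -
    obtain n where n: "arrival \<tau> n \<le> p" "p < arrival \<tau> (Suc n)" using arrival_interval[OF \<tau> pq(1)] .
    obtain m where m: "arrival \<tau> m \<le> q" "q < arrival \<tau> (Suc m)" using arrival_interval[OF \<tau>, of q] pq by auto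
    have "arrival \<tau> n < arrival \<tau> (Suc m)" using n m pq by linarith
    then have "n \<le> m" using strict_mono_less[OF strict_mono_arrival[OF \<tau>]] by simp
    have far: "4 * \<epsilon> < dist (y n) (y m)"
      using pq(5) walk_path_interval[OF \<tau> n, of y] walk_path_interval[OF \<tau> m, of y] by simp
    have tri: "dist (y n) (y m) \<le> dist (y a) (y n) + dist (y a) (y b) + dist (y b) (y c) + dist (y c) (y m)" for a b c
      using dist_triangle[of "y n" "y m" "y a"] dist_triangle[of "y a" "y m" "y b"] dist_triangle[of "y b" "y m" "y c"]
      by (simp add: dist_commute)
    \<comment> \<open>The excursion in progress at time q begins at index s; the excursion sought is
      the one completed by the jump into s.\<close>
    define s where "s = ?s m"
    have "n < s"
    proof (rule ccontr)
      assume "\<not> n < s"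
      then have "?s n = s" unfolding s_def using \<open>n \<le> m\<close> by (intro start_eqI) auto
      then have "dist (y s) (y n) \<le> \<epsilon>" "dist (y s) (y m) \<le> \<epsilon>"
        using dist_start[OF \<epsilon>, of y n] dist_start[OF \<epsilon>, of y m] by (auto simp: s_def)
      then show False using far \<epsilon> tri[of s s s] by simp
    qed
    then obtain k where k: "s = Suc k" by (cases s) auto
    have "s \<le> m" unfolding s_def by (rule start_le)
    have "?s s = s" unfolding s_def by (rule start_eqI[OF order_refl start_le])
    then have ex: "\<epsilon> < dist (y (?s k)) (y (Suc k))"
      using k start_le[of \<epsilon> y k] by (auto split: if_splits)
    \<comment> \<open>Otherwise y n and y m would be joined through the start of that excursion, its
      last state y k, and y s, in four moves of length at most \<epsilon>. This is the origin of the
      factor 4.\<close>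
    have "n < ?s k"
    proof (rule ccontr)
      assume "\<not> n < ?s k"
      then have "?s n = ?s k" using \<open>n < s\<close> k by (intro start_eqI) auto
      then have "dist (y (?s k)) (y n) \<le> \<epsilon>" using dist_start[OF \<epsilon>, of y n] by simp
      moreover have "dist (y (?s k)) (y k) \<le> \<epsilon>" by (rule dist_start[OF \<epsilon>])
      moreover have "dist (y k) (y s) \<le> \<epsilon>" using jump[of k] k by simp
      moreover have "dist (y s) (y m) \<le> \<epsilon>" unfolding s_def by (rule dist_start[OF \<epsilon>])
      ultimately show False using far tri[of "?s k" k s] by linarith
    qed
    then have 1: "p < arrival \<tau> (?s k)" using n(2) arrival_ge[OF \<tau>, of "Suc n" "?s k"] by linarith
    have 2: "arrival \<tau> (Suc k) \<le> q" using m(1) arrival_ge[OF \<tau>, of "Suc k" m] \<open>s \<le> m\<close> k by linarith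
    have 3: "arrival \<tau> (?s k) \<le> arrival \<tau> (Suc k)"
      using start_le[of \<epsilon> y k] by (intro arrival_ge[OF \<tau>]) simp
    show ?thesis using 1 2 3 ex pq by (intro exI[of _ k]) linarith
  qed
  obtain p q :: rat where pq: "0 \<le> p" "0 \<le> q" "p \<le> of_nat N" "q \<le> of_nat N"
      "\<bar>of_rat p - of_rat q :: real\<bar> < \<delta>" "4 * \<epsilon> < dist (on_rats ?\<omega> p) (on_rats ?\<omega> q)"
    using osc unfolding oscillating_def by blast
  have "(0::real) \<le> of_rat p" "(0::real) \<le> of_rat q" "of_rat p \<le> real N" "of_rat q \<le> real N"
    using pq(1-4) by (simp_all, (metis of_rat_less_eq of_rat_of_nat_eq)+)
  then show ?thesis
    using main[of "of_rat p" "of_rat q"] main[of "of_rat q" "of_rat p"] pq(5,6)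
    by (cases "(of_rat p :: real) \<le> of_rat q") (auto simp: on_rats_def dist_commute abs_less_iff)
qed

lemma measurable_fst_nth:
  "(\<lambda>p. fst p k) \<in> (borel :: ((nat \<Rightarrow> 'a::second_countable_topology) \<times> 'b::second_countable_topology) measure) \<rightarrow>\<^sub>M borel"
  unfolding borel_prod[symmetric] by (rule measurable_compose[OF measurable_fst measurable_nth_borel])

lemma measurable_snd_borel:
  "snd \<in> (borel :: ('a::second_countable_topology \<times> 'b::second_countable_topology) measure) \<rightarrow>\<^sub>M borel"
  unfolding borel_prod[symmetric] by simp

lemma measurable_nth_at:
  assumes "N \<in> (borel :: (nat \<Rightarrow> 'a::second_countable_topology) measure) \<rightarrow>\<^sub>M count_space (UNIV :: nat set)"
  shows "(\<lambda>y. y (N y)) \<in> borel \<rightarrow>\<^sub>M borel"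
  by (rule measurable_compose_countable[OF measurable_nth_borel assms])

lemma measurable_start [measurable]:
  "(\<lambda>y :: nat \<Rightarrow> 'a::polish_space. start \<epsilon> y n) \<in> borel \<rightarrow>\<^sub>M count_space UNIV"
proof (induction n)
  case (Suc n)
  note [measurable] = Suc measurable_nth_at[OF Suc] measurable_nth_borel
  show ?case unfolding start.simps by measurable
qed simp

text \<open>The positive lower bound on the mean holding times rules out explosion; \<open>s\<close>
  bounds the jump length and thus the overshoot when a ball is left.\<close>

locale jump_walk = markov_chain K for K :: "'a::polish_space \<Rightarrow> 'a measure" +
  fixes h :: "'a \<Rightarrow> real" and hmin s :: real
  assumes measurable_h [measurable]: "h \<in> borel_measurable borel"
    and hmin: "0 < hmin" and h_ge: "\<And>x. hmin \<le> h x"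
    and jump_le: "\<And>x. AE z in K x. dist x z \<le> s"
begin

lemma measurable_K_eq: "measurable (K x) N = measurable borel N"
  by (rule measurable_cong_sets[OF sets_K refl])

lemma h_pos: "0 < h x" using hmin h_ge[of x] by linarith

definition law :: "'a \<Rightarrow> 'a cadlag measure" where
  "law x = distr (chain_law K x \<Otimes>\<^sub>M clocks) borel (\<lambda>(y, e). jump_path h y e)"

abbreviation hold :: "(nat \<Rightarrow> 'a) \<Rightarrow> (nat \<Rightarrow> real) \<Rightarrow> nat \<Rightarrow> real" where
  "hold y e \<equiv> \<lambda>i. h (y i) * e i"

lemma measurable_pair_walk: "(\<lambda>(y, e). walk_path y (hold y e)) \<in> chain_law K x \<Otimes>\<^sub>M clocks \<rightarrow>\<^sub>M borel"
proof -
  have sets: "sets (chain_law K x \<Otimes>\<^sub>M clocks) = sets (borel \<Otimes>\<^sub>M borel)"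
    by (rule sets_pair_measure_cong[OF sets_chain_law sets_clocks])
  have "(\<lambda>p. (fst p, hold (fst p) (snd p))) \<in> (borel :: (nat \<Rightarrow> 'a) measure) \<Otimes>\<^sub>M (borel :: (nat \<Rightarrow> real) measure) \<rightarrow>\<^sub>M borel \<Otimes>\<^sub>M borel"
  proof (rule measurable_Pair)
    show "(\<lambda>p. hold (fst p) (snd p)) \<in> (borel :: (nat \<Rightarrow> 'a) measure) \<Otimes>\<^sub>M (borel :: (nat \<Rightarrow> real) measure) \<rightarrow>\<^sub>M borel"
    proof (rule measurable_coordinatewise_then_product)
      fix i
      show "(\<lambda>p. h (fst p i) * snd p i) \<in> borel_measurable ((borel :: (nat \<Rightarrow> 'a) measure) \<Otimes>\<^sub>M (borel :: (nat \<Rightarrow> real) measure))"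
        by (intro borel_measurable_times measurable_compose[OF _ measurable_h]
            measurable_compose[OF measurable_fst measurable_nth_borel] measurable_compose[OF measurable_snd measurable_nth_borel])
    qed
  qed simp
  then have "(\<lambda>p. case (fst p, hold (fst p) (snd p)) of (y, \<tau>) \<Rightarrow> walk_path y \<tau>) \<in> borel \<Otimes>\<^sub>M borel \<rightarrow>\<^sub>M borel"
    by (rule measurable_compose) (simp add: borel_prod measurable_walk_path)
  then show ?thesis
    unfolding measurable_cong_sets[OF sets refl] by (simp add: case_prod_beta')
qed

lemma law_eq: "law x = distr (chain_law K x \<Otimes>\<^sub>M clocks) borel (\<lambda>(y, e). walk_path y (hold y e))"
  unfolding law_def jump_path_eq_walk_path ..

lemma prob_space_clocks: "prob_space clocks"
  by (rule prob_space_PiM) (rule prob_space_std_exp)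

lemma prob_space_law: "prob_space (law x)"
proof -
  interpret C: prob_space "chain_law K x" by (rule prob_space_chain_law)
  interpret E: prob_space clocks by (rule prob_space_clocks)
  interpret pair_prob_space "chain_law K x" clocks ..
  show ?thesis unfolding law_eq by (rule prob_space_distr[OF measurable_pair_walk])
qed

lemma sets_law [measurable_cong]: "sets (law x) = sets borel"
  by (simp add: law_def)

lemma nn_integral_law:
  assumes [measurable]: "f \<in> borel_measurable borel"
  shows "(\<integral>\<^sup>+\<omega>. f \<omega> \<partial>law x) = (\<integral>\<^sup>+y. (\<integral>\<^sup>+e. f (walk_path y (hold y e)) \<partial>clocks) \<partial>chain_law K x)"
proof -
  have "(\<integral>\<^sup>+\<omega>. f \<omega> \<partial>law x) = (\<integral>\<^sup>+p. f ((\<lambda>(y, e). walk_path y (hold y e)) p) \<partial>(chain_law K x \<Otimes>\<^sub>M clocks))"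
    unfolding law_eq by (rule nn_integral_distr[OF measurable_pair_walk]) simp
  also have "\<dots> = (\<integral>\<^sup>+y. (\<integral>\<^sup>+e. f ((\<lambda>(y, e). walk_path y (hold y e)) (y, e)) \<partial>clocks) \<partial>chain_law K x)"
    by (rule clocks.P.nn_integral_fst[symmetric]) (rule measurable_compose[OF measurable_pair_walk assms])
  finally show ?thesis by simp
qed

lemma hold_proper: "e \<in> proper_times \<Longrightarrow> hold y e \<in> proper_times"
  by (rule proper_times_scale[OF _ hmin h_ge])

text \<open>One null set of clocks serves all chains at once, because \<open>h\<close> is bounded
  below. The clocks can therefore be integrated out with the chain fixed.\<close>

lemma AE_clocks_hold: "AE e in clocks. \<forall>y. hold y e \<in> proper_times"
  using AE_clocks_proper by eventually_elim (auto intro: hold_proper)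

lemma measurable_chain_nth [measurable]: "(\<lambda>y. y i) \<in> chain_law K x \<rightarrow>\<^sub>M borel"
  unfolding measurable_cong_sets[OF sets_chain_law refl] by (rule measurable_nth_borel)

lemma AE_chain_jump: "AE y in chain_law K x. \<forall>n. dist (y n) (y (Suc n)) \<le> s"
  unfolding AE_all_countable
proof
  fix n
  let ?f = "\<lambda>p :: (nat \<Rightarrow> 'a) \<times> 'a. indicator {s<..} (dist (fst p n) (snd p)) :: ennreal"
  have ind: "(indicator {s<..} :: real \<Rightarrow> ennreal) \<in> borel_measurable borel" by simp
  have "(\<lambda>p :: (nat \<Rightarrow> 'a) \<times> 'a. dist (fst p n) (snd p)) \<in> borel_measurable borel"
    by (intro borel_measurable_dist measurable_fst_nth measurable_snd_borel)
  then have m: "?f \<in> borel_measurable borel" by (rule measurable_compose[OF _ ind])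
  have "(\<integral>\<^sup>+y. ?f (y, y (Suc n)) \<partial>chain_law K x) = (\<integral>\<^sup>+y. (\<integral>\<^sup>+z. ?f (y, z) \<partial>K (y n)) \<partial>chain_law K x)"
    by (rule nn_integral_chain_law_Suc[OF m]) simp
  also have "\<dots> = (\<integral>\<^sup>+y. 0 \<partial>chain_law K x)"
  proof (rule nn_integral_cong)
    fix y
    have "(\<integral>\<^sup>+z. ?f (y, z) \<partial>K (y n)) = (\<integral>\<^sup>+z. 0 \<partial>K (y n))"
      by (rule nn_integral_cong_AE) (use jump_le[of "y n"] in \<open>auto elim!: eventually_mono\<close>)
    then show "(\<integral>\<^sup>+z. ?f (y, z) \<partial>K (y n)) = 0" by simp
  qed
  finally have "(\<integral>\<^sup>+y. ?f (y, y (Suc n)) \<partial>chain_law K x) = 0" by simp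
  moreover have "(\<lambda>y. ?f (y, y (Suc n))) \<in> borel_measurable (chain_law K x)"
    by (rule measurable_compose[OF _ ind]) (simp add: borel_measurable_dist)
  ultimately have "AE y in chain_law K x. ?f (y, y (Suc n)) = 0"
    by (subst (asm) nn_integral_0_iff_AE) simp_all
  then show "AE y in chain_law K x. dist (y n) (y (Suc n)) \<le> s"
    by eventually_elim (auto simp: indicator_def split: if_splits)
qed

section \<open>Mean exit times and Laplace transforms of exit times\<close>

primrec occ :: "'a set \<Rightarrow> nat \<Rightarrow> ('a \<Rightarrow> ennreal) \<Rightarrow> 'a \<Rightarrow> ennreal" where
  "occ B 0 f x = indicator B x * f x"
| "occ B (Suc n) f x = indicator B x * (\<integral>\<^sup>+z. occ B n f z \<partial>K x)"

lemma measurable_nn_integral_K [measurable]: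
  assumes [measurable]: "f \<in> borel_measurable borel"
  shows "(\<lambda>x. \<integral>\<^sup>+z. f z \<partial>K x) \<in> borel_measurable borel"
  by (rule nn_integral_measurable_subprob_algebra2[where N = borel]) measurable

lemma measurable_occ [measurable]:
  assumes [measurable]: "f \<in> borel_measurable borel" "B \<in> sets borel"
  shows "occ B n f \<in> borel_measurable borel"
proof (induction n)
  case 0
  have "occ B 0 f = (\<lambda>x. indicator B x * f x)" by auto
  then show ?case by simp
next
  case (Suc n)
  note [measurable] = Suc
  have "occ B (Suc n) f = (\<lambda>x. indicator B x * (\<integral>\<^sup>+z. occ B n f z \<partial>K x))" by auto
  then show ?case by simp
qed

text \<open>The recursion of \<open>occ\<close> splits off the first step, whereas the chain formula
  integrates out the last; this reconciles the two.\<close>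

lemma occ_Suc_inner: "occ B n (\<lambda>x. \<integral>\<^sup>+z. indicator B z * f z \<partial>K x) x = occ B (Suc n) f x"
  by (induction n arbitrary: x) simp_all

text \<open>Identifies \<open>occ B n\<close> with the n-th power of the kernel killed outside
  \<open>B\<close>.\<close>

lemma nn_integral_chain_occ:
  assumes [measurable]: "f \<in> borel_measurable borel" "B \<in> sets borel"
  shows "(\<integral>\<^sup>+y. (\<Prod>k\<le>n. indicator B (y k)) * f (y n) \<partial>chain_law K x) = occ B n f x"
  using assms(1)
proof (induction n arbitrary: f)
  case 0
  interpret prob_space "chain_law K x" by (rule prob_space_chain_law)
  have "(\<integral>\<^sup>+y. (\<Prod>k\<le>0. indicator B (y k)) * f (y 0) \<partial>chain_law K x) = (\<integral>\<^sup>+y. indicator B x * f x \<partial>chain_law K x)"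
    by (rule nn_integral_cong_AE) (use AE_chain_law_0[of x] in \<open>auto elim!: eventually_mono\<close>)
  then show ?case by (simp add: emeasure_space_1)
next
  case (Suc n)
  note [measurable] = Suc.prems
  let ?f = "\<lambda>p :: (nat \<Rightarrow> 'a) \<times> 'a. (\<Prod>k\<le>n. indicator B (fst p k)) * (indicator B (snd p) * f (snd p)) :: ennreal"
  have ind: "(indicator B :: 'a \<Rightarrow> ennreal) \<in> borel_measurable borel" by simp
  have m: "?f \<in> borel_measurable borel"
    by (intro borel_measurable_times_ennreal borel_measurable_prod_ennreal measurable_compose[OF measurable_fst_nth ind]
        measurable_compose[OF measurable_snd_borel ind] measurable_compose[OF measurable_snd_borel Suc.prems])
  have "(\<integral>\<^sup>+y. (\<Prod>k\<le>Suc n. indicator B (y k)) * f (y (Suc n)) \<partial>chain_law K x) = (\<integral>\<^sup>+y. ?f (y, y (Suc n)) \<partial>chain_law K x)"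
    by (simp add: mult.assoc)
  also have "\<dots> = (\<integral>\<^sup>+y. (\<integral>\<^sup>+z. ?f (y, z) \<partial>K (y n)) \<partial>chain_law K x)"
    by (rule nn_integral_chain_law_Suc[OF m]) simp
  also have "\<dots> = (\<integral>\<^sup>+y. (\<Prod>k\<le>n. indicator B (y k)) * (\<integral>\<^sup>+z. indicator B z * f z \<partial>K (y n)) \<partial>chain_law K x)"
    by (intro nn_integral_cong) (simp add: nn_integral_cmult measurable_K_eq)
  also have "\<dots> = occ B n (\<lambda>x. \<integral>\<^sup>+z. indicator B z * f z \<partial>K x) x"
    by (rule Suc.IH) measurable
  finally show ?case by (simp only: occ_Suc_inner)
qed

definition mean_exit :: "'a set \<Rightarrow> 'a \<Rightarrow> ennreal" where
  "mean_exit B x = (\<integral>\<^sup>+\<omega>. exit_time B \<omega> \<partial>law x)"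

text \<open>The clocks have mean 1, so each visit before the exit contributes the mean holding time
  of the state visited: the Green operator of the killed chain applied to \<open>h\<close>.\<close>

lemma mean_exit_eq:
  assumes "closed B"
  shows "mean_exit B x = (\<Sum>n. occ B n (\<lambda>z. ennreal (h z)) x)"
proof -
  have [measurable]: "B \<in> sets borel" using assms by (rule borel_closed)
  let ?i = "\<lambda>y n. (\<Prod>k\<le>n. indicator B (y k)) :: ennreal"
  have ind: "(if \<forall>k\<le>n. y k \<in> B then 1 else 0) = ?i y n" for y :: "nat \<Rightarrow> 'a" and n
    by (auto simp: indicator_def prod_zero_iff)
  have "mean_exit B x = (\<integral>\<^sup>+y. (\<integral>\<^sup>+e. exit_time B (walk_path y (hold y e)) \<partial>clocks) \<partial>chain_law K x)"
    unfolding mean_exit_def by (rule nn_integral_law[OF borel_measurable_exit_time[OF assms]])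
  also have "\<dots> = (\<integral>\<^sup>+y. (\<Sum>n. ?i y n * ennreal (h (y n))) \<partial>chain_law K x)"
  proof (rule nn_integral_cong)
    fix y
    have "(\<integral>\<^sup>+e. exit_time B (walk_path y (hold y e)) \<partial>clocks) =
        (\<integral>\<^sup>+e. (\<Sum>n. ?i y n * ennreal (h (y n)) * ennreal (e n)) \<partial>clocks)"
      by (rule nn_integral_cong_AE)
         (use AE_clocks_hold in eventually_elim, simp add: exit_time_walk_path ind ennreal_mult'' less_imp_le[OF h_pos] mult_ac)
    also have "\<dots> = (\<Sum>n. \<integral>\<^sup>+e. ?i y n * ennreal (h (y n)) * ennreal (e n) \<partial>clocks)"
      by (rule nn_integral_suminf) simp
    also have "\<dots> = (\<Sum>n. ?i y n * ennreal (h (y n)))"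
      by (simp add: nn_integral_cmult nn_integral_clocks_nth)
    finally show "(\<integral>\<^sup>+e. exit_time B (walk_path y (hold y e)) \<partial>clocks) = (\<Sum>n. ?i y n * ennreal (h (y n)))" .
  qed
  also have "\<dots> = (\<Sum>n. \<integral>\<^sup>+y. ?i y n * ennreal (h (y n)) \<partial>chain_law K x)"
    by (rule nn_integral_suminf) measurable
  also have "\<dots> = (\<Sum>n. occ B n (\<lambda>z. ennreal (h z)) x)"
  proof -
    have "(\<integral>\<^sup>+y. ?i y n * ennreal (h (y n)) \<partial>chain_law K x) = occ B n (\<lambda>z. ennreal (h z)) x" for n
      by (rule nn_integral_chain_occ) simp_all
    then show ?thesis by simp
  qed
  finally show ?thesis .
qed

lemma measurable_mean_exit: "closed B \<Longrightarrow> mean_exit B \<in> borel_measurable borel"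
proof -
  assume B: "closed B"
  then have [measurable]: "B \<in> sets borel" by (rule borel_closed)
  have "mean_exit B = (\<lambda>x. \<Sum>n. occ B n (\<lambda>z. ennreal (h z)) x)" using mean_exit_eq[OF B] by auto
  then show ?thesis by simp
qed

text \<open>The first-step (Poisson) equation, read off from the occupation series by detaching its
  first term. It holds in \<open>ennreal\<close>, whether or not the mean is finite.\<close>

lemma mean_exit_step:
  assumes "closed B"
  shows "mean_exit B x = indicator B x * (ennreal (h x) + (\<integral>\<^sup>+z. mean_exit B z \<partial>K x))"
proof -
  have [measurable]: "B \<in> sets borel" using assms by (rule borel_closed)
  let ?o = "\<lambda>n. occ B n (\<lambda>z. ennreal (h z))"
  have "(\<lambda>n. ?o n x) sums ((\<Sum>n. ?o (Suc n) x) + ?o 0 x)"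
    by (intro sums_Suc summable_sums summableI)
  then have "mean_exit B x = (\<Sum>n. ?o (Suc n) x) + ?o 0 x"
    unfolding mean_exit_eq[OF assms] by (rule sums_unique[symmetric])
  also have "(\<Sum>n. ?o (Suc n) x) = indicator B x * (\<Sum>n. \<integral>\<^sup>+z. ?o n z \<partial>K x)"
    by simp
  also have "(\<Sum>n. \<integral>\<^sup>+z. ?o n z \<partial>K x) = (\<integral>\<^sup>+z. (\<Sum>n. ?o n z) \<partial>K x)"
    by (rule nn_integral_suminf[symmetric])
       (unfold measurable_K_eq, rule measurable_occ, simp_all)
  finally show ?thesis
    by (simp add: mean_exit_eq[OF assms] distrib_left add.commute)
qed

text \<open>The part of the Laplace transform due to exits within n jumps. The factor 1 / (1 + l * h
  x) is the transform of an exponential holding time of mean \<open>h x\<close>.\<close>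

primrec lap_step :: "real \<Rightarrow> 'a set \<Rightarrow> nat \<Rightarrow> 'a \<Rightarrow> ennreal" where
  "lap_step l B 0 x = indicator (- B) x"
| "lap_step l B (Suc n) x = (if x \<in> B then ennreal (1 / (1 + l * h x)) * (\<integral>\<^sup>+z. lap_step l B n z \<partial>K x) else 1)"

text \<open>\<open>lap l B x\<close> is the Laplace transform at \<open>l\<close> of the exit time from \<open>B\<close> for the walk started at \<open>x\<close>.\<close>

definition lap :: "real \<Rightarrow> 'a set \<Rightarrow> 'a \<Rightarrow> ennreal" where
  "lap l B x = (SUP n. lap_step l B n x)"

text \<open>Comparison principle: the iteration starts below \<open>W\<close>, and one step
  preserves this because the step is monotone. Hence \<open>lap\<close> is below every
  supersolution.\<close>

lemma lap_step_supersolution: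
  assumes off: "\<And>x. x \<notin> B \<Longrightarrow> 1 \<le> W x"
    and super: "\<And>x. x \<in> B \<Longrightarrow> ennreal (1 / (1 + l * h x)) * (\<integral>\<^sup>+z. W z \<partial>K x) \<le> W x"
  shows "lap_step l B n x \<le> W x"
proof (induction n arbitrary: x)
  case 0 then show ?case using off[of x] by (auto simp: indicator_def)
next
  case (Suc n)
  show ?case
  proof (cases "x \<in> B")
    case True
    have "lap_step l B (Suc n) x \<le> ennreal (1 / (1 + l * h x)) * (\<integral>\<^sup>+z. W z \<partial>K x)"
      using True by (auto intro!: mult_left_mono nn_integral_mono Suc.IH)
    then show ?thesis using super[OF True] by simp
  qed (use off in simp)
qed

lemma lap_supersolution:
  assumes "\<And>x. x \<notin> B \<Longrightarrow> 1 \<le> W x"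
    and "\<And>x. x \<in> B \<Longrightarrow> ennreal (1 / (1 + l * h x)) * (\<integral>\<^sup>+z. W z \<partial>K x) \<le> W x"
  shows "lap l B x \<le> W x"
  unfolding lap_def by (rule SUP_least) (rule lap_step_supersolution[OF assms])

lemma disc_le_1: "0 \<le> l \<Longrightarrow> ennreal (1 / (1 + l * h x)) \<le> 1"
  using h_pos[of x] by (simp add: divide_le_eq_1 add_pos_nonneg)

lemma nn_integral_K_le_1: "(\<And>z. f z \<le> 1) \<Longrightarrow> (\<integral>\<^sup>+z. f z \<partial>K x) \<le> 1"
proof -
  assume "\<And>z. f z \<le> 1"
  then have "(\<integral>\<^sup>+z. f z \<partial>K x) \<le> (\<integral>\<^sup>+z. 1 \<partial>K x)" by (intro nn_integral_mono)
  then show ?thesis using prob_space.emeasure_space_1[OF prob_space_K[of x]] by simp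
qed

lemma lap_step_le_1: "0 \<le> l \<Longrightarrow> lap_step l B n x \<le> 1"
  using nn_integral_K_le_1[of "\<lambda>_. 1"]
  by (intro lap_step_supersolution) (auto intro!: mult_le_one disc_le_1)

lemma lap_le_1: "0 \<le> l \<Longrightarrow> lap l B x \<le> 1"
  unfolding lap_def by (rule SUP_least) (rule lap_step_le_1)

lemma lap_outside: "x \<notin> B \<Longrightarrow> lap l B x = 1"
  unfolding lap_def
proof -
  assume "x \<notin> B"
  then have "lap_step l B n x = 1" for n by (cases n) auto
  then show "(SUP n. lap_step l B n x) = 1" by simp
qed

lemma incseq_lap_step: "0 \<le> l \<Longrightarrow> incseq (\<lambda>n. lap_step l B n)"
proof (rule incseq_SucI)
  fix n assume "0 \<le> l"
  show "lap_step l B n \<le> lap_step l B (Suc n)"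
  proof (induction n)
    case 0 then show ?case by (auto simp: le_fun_def indicator_def)
  next
    case (Suc n)
    then show ?case by (auto simp: le_fun_def intro!: mult_left_mono nn_integral_mono)
  qed
qed

text \<open>The centre is a variable too, since later the ball is centred at the random state in
  which an excursion started.\<close>

lemma measurable_lap_step_pair:
  "(\<lambda>p. lap_step l (cball (fst p) \<epsilon>) n (snd p)) \<in> borel_measurable (borel \<Otimes>\<^sub>M borel)"
proof (induction n)
  have [measurable]: "Measurable.pred (borel \<Otimes>\<^sub>M borel) (\<lambda>p. snd p \<in> cball (fst p :: 'a) \<epsilon>)"
    unfolding mem_cball by measurable
  {
    case 0
    have "(\<lambda>p. lap_step l (cball (fst p) \<epsilon>) 0 (snd p)) = (\<lambda>p. if snd p \<in> cball (fst p) \<epsilon> then 0 else 1)"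
      by (auto simp: indicator_def)
    then show ?case by simp
  next
    case (Suc n)
    have [measurable]: "(\<lambda>q :: ('a \<times> 'a) \<times> 'a. lap_step l (cball (fst (fst q)) \<epsilon>) n (snd q)) \<in>
        borel_measurable ((borel \<Otimes>\<^sub>M borel) \<Otimes>\<^sub>M borel)"
    proof -
      have "(\<lambda>q. (fst (fst q), snd q)) \<in> ((borel :: 'a measure) \<Otimes>\<^sub>M (borel :: 'a measure)) \<Otimes>\<^sub>M (borel :: 'a measure) \<rightarrow>\<^sub>M borel \<Otimes>\<^sub>M borel"
        by measurable
      from measurable_compose[OF this Suc] show ?thesis by simp
    qed
    have "(\<lambda>p. \<integral>\<^sup>+z. lap_step l (cball (fst p) \<epsilon>) n z \<partial>K (snd p)) \<in> borel_measurable (borel \<Otimes>\<^sub>M borel)"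
      by (rule nn_integral_measurable_subprob_algebra2[where N = borel]) (simp_all add: case_prod_beta')
    then show ?case by simp
  }
qed

lemma measurable_lap_pair:
  "(\<lambda>p. lap l (cball (fst p) \<epsilon>) (snd p)) \<in> borel_measurable (borel \<Otimes>\<^sub>M borel)"
  unfolding lap_def by (intro borel_measurable_SUP measurable_lap_step_pair) simp

lemma measurable_lap_step: "B \<in> sets borel \<Longrightarrow> lap_step l B n \<in> borel_measurable borel"
proof (induction n)
  case 0
  have "lap_step l B 0 = indicator (- B)" by auto
  then show ?case using 0 by (auto intro!: borel_measurable_indicator borel_comp)
next
  case (Suc n)
  note [measurable] = Suc.IH[OF Suc.prems] Suc.prems
  have "lap_step l B (Suc n) = (\<lambda>x. if x \<in> B then ennreal (1 / (1 + l * h x)) * (\<integral>\<^sup>+z. lap_step l B n z \<partial>K x) else 1)"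
    by auto
  then show ?case by simp
qed

lemma lap_first_step:
  assumes l: "0 \<le> l" and B: "B \<in> sets borel" and x: "x \<in> B"
  shows "lap l B x = ennreal (1 / (1 + l * h x)) * (\<integral>\<^sup>+z. lap l B z \<partial>K x)"
proof -
  have inc: "incseq (\<lambda>n. lap_step l B n)" by (rule incseq_lap_step[OF l])
  have m: "lap_step l B n \<in> borel_measurable (K x)" for n
    using measurable_lap_step[OF B] by (simp add: measurable_K_eq)
  have "lap l B x = (SUP n. lap_step l B (Suc n) x)"
  proof (rule antisym)
    have "lap_step l B n x \<le> (SUP n. lap_step l B (Suc n) x)" for n
    proof -
      have "lap_step l B n x \<le> lap_step l B (Suc n) x"
        using incseq_SucD[OF inc] unfolding le_fun_def by blast
      also have "\<dots> \<le> (SUP n. lap_step l B (Suc n) x)" by (rule SUP_upper) simp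
      finally show ?thesis .
    qed
    then show "lap l B x \<le> (SUP n. lap_step l B (Suc n) x)"
      unfolding lap_def by (rule SUP_least)
    show "(SUP n. lap_step l B (Suc n) x) \<le> lap l B x"
      unfolding lap_def by (intro SUP_least SUP_upper UNIV_I)
  qed
  also have "\<dots> = (SUP n. ennreal (1 / (1 + l * h x)) * (\<integral>\<^sup>+z. lap_step l B n z \<partial>K x))"
    using x by simp
  also have "\<dots> = ennreal (1 / (1 + l * h x)) * (SUP n. \<integral>\<^sup>+z. lap_step l B n z \<partial>K x)"
    by (rule SUP_mult_left_ennreal[symmetric])
  also have "(SUP n. \<integral>\<^sup>+z. lap_step l B n z \<partial>K x) = (\<integral>\<^sup>+z. (SUP n. lap_step l B n z) \<partial>K x)"
    by (rule nn_integral_monotone_convergence_SUP[OF inc m, symmetric])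
  finally show ?thesis by (simp add: lap_def)
qed

text \<open>The transform for the smaller set is a supersolution for the larger one: on
  \<open>B\<close> it satisfies the equation, and off \<open>B\<close> it is 1, which no discounted
  average exceeds.\<close>

lemma lap_antimono:
  assumes l: "0 \<le> l" and B: "B \<in> sets borel" and "B \<subseteq> B'"
  shows "lap l B' x \<le> lap l B x"
proof (rule lap_supersolution)
  show "1 \<le> lap l B x" if "x \<notin> B'" for x
  proof -
    have "x \<notin> B" using that assms(3) by blast
    then show ?thesis using lap_outside[of x B l] by simp
  qed
  show "ennreal (1 / (1 + l * h x)) * (\<integral>\<^sup>+z. lap l B z \<partial>K x) \<le> lap l B x" for x
  proof (cases "x \<in> B")
    case True then show ?thesis using lap_first_step[OF l B] by simp
  next
    case False
    then show ?thesis
      using lap_le_1[OF l] lap_outside[OF False, of l] by (auto intro!: mult_le_one disc_le_1 l nn_integral_K_le_1)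
  qed
qed

text \<open>With \<open>\<phi> = mean_exit B\<close>, the function \<open>1 - l * \<phi> / (1 + l * \<Phi>)\<close> is a supersolution of the equation for
  \<^const>\<open>lap\<close>.\<close>

lemma lap_mean_exit:
  assumes l: "0 \<le> l" and B: "closed B" and \<Phi>: "\<And>z. mean_exit B z \<le> ennreal \<Phi>" "1 \<le> l * \<Phi>"
    and x: "ennreal (c * \<Phi>) \<le> mean_exit B x" and c: "0 \<le> c"
  shows "lap l B x \<le> ennreal (1 - c / 2)"
proof -
  have \<Phi>0: "0 \<le> \<Phi>"
  proof (rule ccontr)
    assume "\<not> 0 \<le> \<Phi>"
    then have "l * \<Phi> \<le> 0" using l by (simp add: mult_nonneg_nonpos)
    then show False using \<Phi>(2) by simp
  qed
  define \<phi> where "\<phi> z = enn2real (mean_exit B z)" for z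
  have fin: "mean_exit B z = ennreal (\<phi> z)" for z
    unfolding \<phi>_def using \<Phi>(1)[of z] by (simp add: top.not_eq_extremum le_less_trans[OF _ ennreal_less_top])
  have \<phi>: "0 \<le> \<phi> z" "\<phi> z \<le> \<Phi>" for z
    using \<Phi>(1)[of z] \<Phi>0 unfolding fin by (auto simp: \<phi>_def ennreal_le_iff)
  have \<phi>m [measurable]: "\<phi> \<in> borel_measurable borel"
    unfolding \<phi>_def[abs_def] using measurable_mean_exit[OF B] by measurable
  \<comment> \<open>The additive 1 keeps D - l * \<phi> at least 1, which is what the supersolution
    inequality needs.\<close>
  define D where "D = 1 + l * \<Phi>"
  have D: "0 < D" using \<Phi>(2) by (simp add: D_def)
  define v where "v z = l * \<phi> z / D" for z
  have v: "0 \<le> v z" "v z \<le> 1" for z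
  proof -
    show "0 \<le> v z" using \<phi>(1)[of z] l D by (simp add: v_def)
    have "l * \<phi> z \<le> l * \<Phi>" using \<phi>(2) l by (rule mult_left_mono)
    then show "v z \<le> 1" using D by (simp add: v_def D_def)
  qed
  have vm [measurable]: "v \<in> borel_measurable borel" unfolding v_def[abs_def] by measurable
  have "lap l B x \<le> ennreal (1 - v x)"
  proof (rule lap_supersolution)
    fix z assume z: "z \<notin> B"
    then have "mean_exit B z = 0" using mean_exit_step[OF B, of z] by simp
    then have "v z = 0" by (simp add: v_def \<phi>_def)
    then show "1 \<le> ennreal (1 - v z)" by simp
  next
    fix z assume z: "z \<in> B"
    have step: "ennreal (\<phi> z) = ennreal (h z) + (\<integral>\<^sup>+w. ennreal (\<phi> w) \<partial>K z)"
      using mean_exit_step[OF B, of z] z by (simp add: fin)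
    interpret Kz: prob_space "K z" by (rule prob_space_K)
    have int: "integrable (K z) \<phi>" "integrable (K z) v"
      using \<phi> v by (auto intro!: Kz.integrable_const_bound[of \<phi> \<Phi>] Kz.integrable_const_bound[of v 1] simp: measurable_K_eq)
    define I where "I = integral\<^sup>L (K z) \<phi>"
    have "(\<integral>\<^sup>+w. ennreal (\<phi> w) \<partial>K z) = ennreal I"
      unfolding I_def by (rule nn_integral_eq_integral[OF int(1)]) (use \<phi> in simp)
    moreover have I0: "0 \<le> I" unfolding I_def using \<phi> by simp
    ultimately have eq: "\<phi> z = h z + I"
      using step h_pos[of z] \<phi>(1)[of z] by (simp add: ennreal_plus[symmetric] del: ennreal_plus)
    have "(\<integral>\<^sup>+w. ennreal (1 - v w) \<partial>K z) = ennreal (integral\<^sup>L (K z) (\<lambda>w. 1 - v w))"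
      by (rule nn_integral_eq_integral) (use int v in auto)
    also have "integral\<^sup>L (K z) (\<lambda>w. 1 - v w) = 1 - l * I / D"
      using int Kz.prob_space unfolding v_def I_def by simp
    finally have J: "(\<integral>\<^sup>+w. ennreal (1 - v w) \<partial>K z) = ennreal (1 - l * I / D)" .
    have pos: "0 < 1 + l * h z" using l h_pos[of z] by (simp add: add_pos_nonneg)
    \<comment> \<open>Inserting \<phi> z = h z + I and multiplying by D reduces this to l * h z
      \<le> l * h z * (D - l * \<phi> z).\<close>
    have "1 - l * I / D \<le> (1 - v z) * (1 + l * h z)"
    proof -
      have "l * \<phi> z \<le> l * \<Phi>" using \<phi>(2) l by (rule mult_left_mono)
      then have "1 \<le> D - l * \<phi> z" by (simp add: D_def)
      then have "l * h z * 1 \<le> l * h z * (D - l * \<phi> z)"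
        using l h_pos[of z] by (intro mult_left_mono) auto
      then have "D - l * I \<le> (D - l * \<phi> z) * (1 + l * h z)"
        by (simp add: eq algebra_simps)
      then have "(D - l * I) / D \<le> (D - l * \<phi> z) * (1 + l * h z) / D"
        using D by (intro divide_right_mono) auto
      then show ?thesis using D by (simp add: v_def diff_divide_distrib left_diff_distrib)
    qed
    then have "1 / (1 + l * h z) * (1 - l * I / D) \<le> 1 - v z"
      using pos by (simp add: field_simps)
    then show "ennreal (1 / (1 + l * h z)) * (\<integral>\<^sup>+w. ennreal (1 - v w) \<partial>K z) \<le> ennreal (1 - v z)"
      unfolding J using pos by (simp add: ennreal_mult'[symmetric] ennreal_leI)
  qed
  also have "\<dots> \<le> ennreal (1 - c / 2)"
  proof (rule ennreal_leI)
    have "c * \<Phi> \<le> \<phi> x" using x \<phi>(1)[of x] unfolding fin by (simp add: ennreal_le_iff)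
    then have "l * (c * \<Phi>) / D \<le> v x" unfolding v_def using l D by (intro divide_right_mono mult_left_mono) auto
    \<comment> \<open>Since 1 \<le> l * \<Phi>, D is at most 2 * l * \<Phi>; hence the factor
      1/2.\<close>
    moreover have "c / 2 \<le> l * (c * \<Phi>) / D"
    proof -
      have "c * D \<le> c * (2 * (l * \<Phi>))" using \<Phi>(2) c by (intro mult_left_mono) (auto simp: D_def mult.commute)
      then show ?thesis using D by (simp add: field_simps)
    qed
    ultimately show "1 - v x \<le> 1 - c / 2" by linarith
  qed
  finally show ?thesis .
qed

text \<open>To leave the large ball the walk has to leave \<open>M\<close> balls of radius \<open>\<rho>\<close> one after the other; each exit
  overshoots by at most \<open>s\<close>.\<close>

lemma lap_chaining:
  assumes l: "0 \<le> l" and \<rho>: "0 \<le> \<rho>" and s: "0 \<le> s" and q: "\<And>x. lap l (cball x \<rho>) x \<le> q"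
  shows "lap l (cball x (real M * (\<rho> + s))) x \<le> q ^ M"
proof (induction M arbitrary: x)
  case 0 then show ?case using lap_le_1[OF l] by simp
next
  case (Suc M)
  note IH = Suc.IH
  let ?B1 = "cball x \<rho>" and ?B2 = "cball x (real (Suc M) * (\<rho> + s))"
  have le: "\<rho> + s \<le> real (Suc M) * (\<rho> + s)" using \<rho> s by (simp add: mult_le_cancel_right1)
  \<comment> \<open>The comparison function is not at least 1 outside the large ball, so
    \<open>lap_supersolution\<close> does not apply. The bound is proved only within one jump of the
    inner ball, by induction on the number of jumps.\<close>
  have "lap_step l ?B2 n z \<le> q ^ M * lap l ?B1 z" if "z \<in> cball x (\<rho> + s)" for n z
    using that
  proof (induction n arbitrary: z)
    case 0
    then have "z \<in> ?B2" using le by auto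
    then show ?case by simp
  next
    case (Suc n)
    show ?case
    proof (cases "z \<in> ?B1")
      case True
      have z2: "z \<in> ?B2" using Suc.prems le by auto
      have "lap_step l ?B2 (Suc n) z = ennreal (1 / (1 + l * h z)) * (\<integral>\<^sup>+w. lap_step l ?B2 n w \<partial>K z)"
        using z2 by simp
      also have "\<dots> \<le> ennreal (1 / (1 + l * h z)) * (\<integral>\<^sup>+w. q ^ M * lap l ?B1 w \<partial>K z)"
      proof (intro mult_left_mono nn_integral_mono_AE)
        show "AE w in K z. lap_step l ?B2 n w \<le> q ^ M * lap l ?B1 w"
          using jump_le[of z]
        proof eventually_elim
          case (elim w)
          have "dist x w \<le> dist x z + dist z w" by (rule dist_triangle)
          then show ?case using elim True by (intro Suc.IH) auto
        qed
      qed simp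
      also have "\<dots> = q ^ M * (ennreal (1 / (1 + l * h z)) * (\<integral>\<^sup>+w. lap l ?B1 w \<partial>K z))"
      proof -
        have "lap l ?B1 \<in> borel_measurable (K z)"
          unfolding measurable_K_eq lap_def[abs_def]
          by (intro borel_measurable_SUP measurable_lap_step) auto
        then show ?thesis by (subst nn_integral_cmult) (auto simp: mult_ac)
      qed
      also have "\<dots> = q ^ M * lap l ?B1 z"
        using lap_first_step[OF l _ True] by simp
      finally show ?thesis .
    next
      \<comment> \<open>The inner ball has just been left: the walk restarts at z, and M balls
        around z still fit into the large one.\<close>
      case False
      have "lap_step l ?B2 (Suc n) z \<le> lap l ?B2 z" unfolding lap_def by (rule SUP_upper) simp
      also have "\<dots> \<le> lap l (cball z (real M * (\<rho> + s))) z"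
      proof (rule lap_antimono[OF l])
        show "cball z (real M * (\<rho> + s)) \<subseteq> ?B2"
        proof
          fix w assume "w \<in> cball z (real M * (\<rho> + s))"
          then show "w \<in> ?B2"
            using Suc.prems dist_triangle[of x w z] by (auto simp: distrib_right)
        qed
      qed simp
      also have "\<dots> \<le> q ^ M" by (rule IH)
      finally show ?thesis using lap_outside[OF False] by simp
    qed
  qed
  then have "lap l ?B2 x \<le> q ^ M * lap l ?B1 x"
    unfolding lap_def[of l ?B2] using \<rho> s by (intro SUP_least) simp
  also have "\<dots> \<le> q ^ M * q" by (intro mult_left_mono q) simp
  finally show ?case by (simp add: mult.commute)
qed

end

section \<open>Oscillation of jump walks\<close>

context jump_walk
begin

abbreviation (input) disc :: "real \<Rightarrow> 'a \<Rightarrow> ennreal" where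
  "disc l x \<equiv> ennreal (1 / (1 + l * h x))"

text \<open>Expectation, given the chain, of \<open>exp (- l' * S - l * (T - S))\<close>, where \<open>T\<close> is the \<open>n\<close>-th jump time and
  \<open>S\<close> the time at which the excursion in progress before it started.\<close>

definition two_rate :: "real \<Rightarrow> real \<Rightarrow> nat \<Rightarrow> nat \<Rightarrow> (nat \<Rightarrow> 'a) \<Rightarrow> ennreal" where
  "two_rate l' l m n y = (\<Prod>i<n. disc (if i < m then l' else l) (y i))"

text \<open>Nonzero only if the jump to index n + 1 completes an excursion. Summed over n and
  averaged, it counts excursions, discounted at l' up to their start and at l during them.\<close>

definition exit_weight :: "real \<Rightarrow> real \<Rightarrow> real \<Rightarrow> nat \<Rightarrow> (nat \<Rightarrow> 'a) \<Rightarrow> ennreal" where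
  "exit_weight \<epsilon> l' l n y = (if \<epsilon> < dist (y (start \<epsilon> y n)) (y (Suc n)) then two_rate l' l (start \<epsilon> y n) (Suc n) y else 0)"

text \<open>The partial sums of \<open>exit_weight\<close> plus this potential form a supermartingale.\<close>

definition potential :: "real \<Rightarrow> real \<Rightarrow> real \<Rightarrow> ennreal \<Rightarrow> nat \<Rightarrow> (nat \<Rightarrow> 'a) \<Rightarrow> ennreal" where
  "potential \<epsilon> l' l C n y =
     two_rate l' l (start \<epsilon> y n) n y * lap l (cball (y (start \<epsilon> y n)) \<epsilon>) (y n) +
     C * two_rate l' l' 0 n y * lap l' (cball (y (start \<epsilon> y n)) \<epsilon>) (y n)"

lemma two_rate_Suc: "two_rate l' l m (Suc n) y = two_rate l' l m n y * disc (if n < m then l' else l) (y n)"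
  by (simp add: two_rate_def)

lemma two_rate_same: "n \<le> m \<Longrightarrow> two_rate l' l m n y = two_rate l' l' 0 n y"
  unfolding two_rate_def by (intro prod.cong) auto

lemma two_rate_cong: "(\<And>i. i < n \<Longrightarrow> y i = y' i) \<Longrightarrow> two_rate l' l m n y = two_rate l' l m n y'"
  unfolding two_rate_def by (intro prod.cong) auto

text \<open>The potential after a jump to z, with the old excursion start still in force. The update
  of the start is thereby separated from averaging over the jump.\<close>

definition next_potential :: "real \<Rightarrow> real \<Rightarrow> real \<Rightarrow> ennreal \<Rightarrow> nat \<Rightarrow> (nat \<Rightarrow> 'a) \<Rightarrow> 'a \<Rightarrow> ennreal" where
  "next_potential \<epsilon> l' l C n y z =
     two_rate l' l (start \<epsilon> y n) (Suc n) y * lap l (cball (y (start \<epsilon> y n)) \<epsilon>) z +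
     C * two_rate l' l' 0 (Suc n) y * lap l' (cball (y (start \<epsilon> y n)) \<epsilon>) z"

text \<open>Without an exit both sides agree. At an exit both transforms are 1: the first term pays
  for the exit weight, and the second leaves \<open>C\<close>, enough for the new excursion and its
  successors because p + C * q \<le> C.\<close>

lemma exit_weight_potential_le:
  assumes p: "\<And>z. lap l (cball z \<epsilon>) z \<le> p" and q: "\<And>z. lap l' (cball z \<epsilon>) z \<le> q" and C: "p + C * q \<le> C"
  shows "exit_weight \<epsilon> l' l n y + potential \<epsilon> l' l C (Suc n) y \<le> next_potential \<epsilon> l' l C n y (y (Suc n))"
proof (cases "dist (y (start \<epsilon> y n)) (y (Suc n)) \<le> \<epsilon>")
  case True
  then show ?thesis by (simp add: exit_weight_def potential_def next_potential_def)
next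
  case False
  then have st: "start \<epsilon> y (Suc n) = Suc n" and ex: "\<epsilon> < dist (y (start \<epsilon> y n)) (y (Suc n))" by auto
  have out: "lap a (cball (y (start \<epsilon> y n)) \<epsilon>) (y (Suc n)) = 1" for a
    using ex by (intro lap_outside) simp
  let ?z = "y (Suc n)" and ?D' = "two_rate l' l' 0 (Suc n) y"
  have "potential \<epsilon> l' l C (Suc n) y = ?D' * (lap l (cball ?z \<epsilon>) ?z + C * lap l' (cball ?z \<epsilon>) ?z)"
    unfolding potential_def st two_rate_same[OF order_refl] by (simp add: distrib_left mult_ac)
  also have "\<dots> \<le> ?D' * (p + C * q)"
    by (intro mult_left_mono add_mono p q) simp_all
  also have "\<dots> \<le> ?D' * C" by (intro mult_left_mono C) simp
  finally show ?thesis
    using ex by (simp add: exit_weight_def next_potential_def out mult.commute add_left_mono)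
qed

lemma borel_measurable_lap: "B \<in> sets borel \<Longrightarrow> lap l B \<in> borel_measurable borel"
  unfolding lap_def[abs_def] by (intro borel_measurable_SUP measurable_lap_step) auto

text \<open>The state y n lies in the ball of its excursion, so both transforms obey the first-step
  equation there. As the excursion started no later than n, the new factor at n is taken at rate
  l.\<close>

lemma nn_integral_next_potential:
  assumes l: "0 \<le> l" "0 \<le> l'" and \<epsilon>: "0 \<le> \<epsilon>"
  shows "(\<integral>\<^sup>+z. next_potential \<epsilon> l' l C n y z \<partial>K (y n)) = potential \<epsilon> l' l C n y"
proof -
  let ?B = "cball (y (start \<epsilon> y n)) \<epsilon>"
  have m [measurable]: "lap a ?B \<in> borel_measurable (K (y n))" for a
    unfolding measurable_K_eq by (rule borel_measurable_lap) simp
  have yB: "y n \<in> ?B" using dist_start[OF \<epsilon>] by simp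
  have "(\<integral>\<^sup>+z. next_potential \<epsilon> l' l C n y z \<partial>K (y n)) =
      two_rate l' l (start \<epsilon> y n) (Suc n) y * (\<integral>\<^sup>+z. lap l ?B z \<partial>K (y n)) +
      C * two_rate l' l' 0 (Suc n) y * (\<integral>\<^sup>+z. lap l' ?B z \<partial>K (y n))"
    unfolding next_potential_def by (subst nn_integral_add) (simp_all add: nn_integral_cmult m)
  also have "\<dots> = two_rate l' l (start \<epsilon> y n) n y * (disc l (y n) * (\<integral>\<^sup>+z. lap l ?B z \<partial>K (y n))) +
      C * two_rate l' l' 0 n y * (disc l' (y n) * (\<integral>\<^sup>+z. lap l' ?B z \<partial>K (y n)))"
    using start_le[of \<epsilon> y n] by (simp add: two_rate_Suc mult.assoc)
  also have "\<dots> = potential \<epsilon> l' l C n y"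
    using lap_first_step[OF l(1) _ yB] lap_first_step[OF l(2) _ yB] by (simp add: potential_def)
  finally show ?thesis .
qed

lemma measurable_two_rate:
  assumes N: "N \<in> borel \<rightarrow>\<^sub>M count_space (UNIV :: nat set)"
  shows "(\<lambda>y. two_rate l' l (N y) n y) \<in> borel_measurable borel"
proof (rule measurable_compose_countable[OF _ N])
  fix m
  have "(\<lambda>y :: nat \<Rightarrow> 'a. disc l (y i)) \<in> borel_measurable borel" for l i
  proof -
    have "disc l \<in> borel_measurable borel" by measurable
    from measurable_compose[OF measurable_nth_borel this] show ?thesis .
  qed
  then show "(\<lambda>y. two_rate l' l m n y) \<in> borel_measurable borel"
    unfolding two_rate_def by (intro borel_measurable_prod_ennreal)
qed

lemma measurable_next_potential:
  "(\<lambda>p. next_potential \<epsilon> l' l C n (fst p) (snd p)) \<in> borel_measurable borel"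
proof -
  have fst: "fst \<in> (borel :: ((nat \<Rightarrow> 'a) \<times> 'a) measure) \<rightarrow>\<^sub>M borel"
    unfolding borel_prod[symmetric] by simp
  have t: "(\<lambda>p :: (nat \<Rightarrow> 'a) \<times> 'a. two_rate a b (start \<epsilon> (fst p) n) m (fst p)) \<in> borel_measurable borel"
      "(\<lambda>p :: (nat \<Rightarrow> 'a) \<times> 'a. two_rate a b 0 m (fst p)) \<in> borel_measurable borel" for a b m
    using measurable_compose[OF fst measurable_two_rate[OF measurable_start]]
      measurable_compose[OF fst measurable_two_rate[of "\<lambda>_. 0"]] by auto
  have "(\<lambda>p :: (nat \<Rightarrow> 'a) \<times> 'a. (fst p (start \<epsilon> (fst p) n), snd p)) \<in> borel \<rightarrow>\<^sub>M borel \<Otimes>\<^sub>M borel"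
    by (intro measurable_Pair measurable_compose[OF fst measurable_nth_at[OF measurable_start]] measurable_snd_borel)
  from measurable_compose[OF this measurable_lap_pair]
  have lp: "(\<lambda>p :: (nat \<Rightarrow> 'a) \<times> 'a. lap a (cball (fst p (start \<epsilon> (fst p) n)) \<epsilon>) (snd p)) \<in> borel_measurable borel" for a
    by simp
  show ?thesis
    unfolding next_potential_def
    by (intro borel_measurable_add borel_measurable_times_ennreal t lp borel_measurable_const)
qed

lemma measurable_exit_weight: "exit_weight \<epsilon> l' l n \<in> borel_measurable borel"
proof -
  have [measurable]: "(\<lambda>y :: nat \<Rightarrow> 'a. dist (y (start \<epsilon> y n)) (y (Suc n))) \<in> borel_measurable borel"
    by (intro borel_measurable_dist measurable_nth_at measurable_start measurable_nth_borel)
  have [measurable]: "(\<lambda>y. two_rate l' l (start \<epsilon> y n) (Suc n) y) \<in> borel_measurable borel"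
    by (rule measurable_two_rate[OF measurable_start])
  show ?thesis unfolding exit_weight_def[abs_def] by measurable
qed

lemma measurable_potential: "potential \<epsilon> l' l C n \<in> borel_measurable borel"
proof -
  have "(\<lambda>y :: nat \<Rightarrow> 'a. (y (start \<epsilon> y n), y n)) \<in> borel \<rightarrow>\<^sub>M borel \<Otimes>\<^sub>M borel"
    by (intro measurable_Pair measurable_nth_at measurable_start measurable_nth_borel)
  from measurable_compose[OF this measurable_lap_pair]
  have lp: "(\<lambda>y. lap a (cball (y (start \<epsilon> y n)) \<epsilon>) (y n)) \<in> borel_measurable borel" for a by simp
  have t: "(\<lambda>y. two_rate a b (start \<epsilon> y n) m y) \<in> borel_measurable borel"
      "(\<lambda>y. two_rate a b 0 m y) \<in> borel_measurable borel" for a b m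
    using measurable_two_rate[OF measurable_start] measurable_two_rate[of "\<lambda>_. 0"] by auto
  show ?thesis
    unfolding potential_def[abs_def]
    by (intro borel_measurable_add borel_measurable_times_ennreal lp t borel_measurable_const)
qed

lemma measurable_chain_law_eq: "measurable (chain_law K x) N = measurable borel N"
  by (rule measurable_cong_sets[OF sets_chain_law refl])

text \<open>The inequality for one step telescopes, and the initial potential is at most p + C * q.
  The extremal C = p / (1 - q) is the geometric series over excursions: each costs a factor q to
  reach, and each has weight p.\<close>

lemma sum_exit_weight_le:
  assumes l: "0 \<le> l" "0 \<le> l'" and \<epsilon>: "0 \<le> \<epsilon>"
    and p: "\<And>z. lap l (cball z \<epsilon>) z \<le> p" and q: "\<And>z. lap l' (cball z \<epsilon>) z \<le> q" and C: "p + C * q \<le> C"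
  shows "(\<Sum>n. \<integral>\<^sup>+y. exit_weight \<epsilon> l' l n y \<partial>chain_law K x) \<le> C"
proof -
  let ?E = "\<lambda>n. \<integral>\<^sup>+y. exit_weight \<epsilon> l' l n y \<partial>chain_law K x"
  let ?Z = "\<lambda>n. \<integral>\<^sup>+y. potential \<epsilon> l' l C n y \<partial>chain_law K x"
  interpret prob_space "chain_law K x" by (rule prob_space_chain_law)
  have step: "?E n + ?Z (Suc n) \<le> ?Z n" for n
  proof -
    have "?E n + ?Z (Suc n) = (\<integral>\<^sup>+y. exit_weight \<epsilon> l' l n y + potential \<epsilon> l' l C (Suc n) y \<partial>chain_law K x)"
      by (rule nn_integral_add[symmetric]) (simp_all add: measurable_chain_law_eq measurable_exit_weight measurable_potential)
    also have "\<dots> \<le> (\<integral>\<^sup>+y. next_potential \<epsilon> l' l C n y (y (Suc n)) \<partial>chain_law K x)"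
      by (intro nn_integral_mono exit_weight_potential_le[OF p q C])
    also have "\<dots> = (\<integral>\<^sup>+y. (\<integral>\<^sup>+z. next_potential \<epsilon> l' l C n y z \<partial>K (y n)) \<partial>chain_law K x)"
    proof -
      have "next_potential \<epsilon> l' l C n (fst (y, z)) (snd (y, z)) = next_potential \<epsilon> l' l C n (fst (y', z)) (snd (y', z))"
        if eq: "\<And>i. i \<le> n \<Longrightarrow> y i = y' i" for y y' z
      proof -
        have "start \<epsilon> y n = start \<epsilon> y' n" by (rule start_cong[OF eq])
        moreover have "y (start \<epsilon> y' n) = y' (start \<epsilon> y' n)" by (rule eq[OF start_le])
        moreover have "two_rate a b m (Suc n) y = two_rate a b m (Suc n) y'" for a b m
          by (rule two_rate_cong) (simp add: eq)
        ultimately show ?thesis by (simp add: next_potential_def)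
      qed
      from nn_integral_chain_law_Suc[OF measurable_next_potential, of n, OF this] show ?thesis by simp
    qed
    also have "\<dots> = ?Z n" by (simp add: nn_integral_next_potential[OF l \<epsilon>])
    finally show ?thesis .
  qed
  have Z0: "?Z 0 \<le> C"
  proof -
    have "?Z 0 \<le> (\<integral>\<^sup>+y. C \<partial>chain_law K x)"
    proof (rule nn_integral_mono)
      fix y
      have "potential \<epsilon> l' l C 0 y = lap l (cball (y 0) \<epsilon>) (y 0) + C * lap l' (cball (y 0) \<epsilon>) (y 0)"
        by (simp add: potential_def two_rate_def)
      also have "\<dots> \<le> p + C * q" by (intro add_mono mult_left_mono p q) simp
      finally show "potential \<epsilon> l' l C 0 y \<le> C" using C by (rule order_trans)
    qed
    then show ?thesis by (simp add: emeasure_space_1)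
  qed
  have "(\<Sum>n<m. ?E n) + ?Z m \<le> C" for m
  proof (induction m)
    case 0 then show ?case using Z0 by simp
  next
    case (Suc m)
    have "(\<Sum>n<Suc m. ?E n) + ?Z (Suc m) = (\<Sum>n<m. ?E n) + (?E m + ?Z (Suc m))" by (simp add: add.assoc)
    also have "\<dots> \<le> (\<Sum>n<m. ?E n) + ?Z m" by (intro add_left_mono step)
    also have "\<dots> \<le> C" by (rule Suc)
    finally show ?case .
  qed
  then have "(\<Sum>n<m. ?E n) \<le> C" for m
    by (meson le_iff_add order_trans)
  then show ?thesis by (rule suminf_le_const[OF summableI])
qed

text \<open>Exponential Chebyshev inequality. An oscillating path has an excursion starting before N
  and lasting less than \<delta>, for which the exponential weight times the constant is at least 1.
  Given the chain, the clocks are independent and this weight integrates to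
  \<open>two_rate\<close>.\<close>

lemma law_oscillating_le:
  assumes l: "0 \<le> l" "0 \<le> l'" and \<epsilon>: "0 \<le> \<epsilon>" "s \<le> \<epsilon>"
    and p: "\<And>z. lap l (cball z \<epsilon>) z \<le> p" and q: "\<And>z. lap l' (cball z \<epsilon>) z \<le> q" and C: "p + C * q \<le> C"
  shows "emeasure (law x) (on_rats -` oscillating N \<delta> (4 * \<epsilon>)) \<le> ennreal (exp (l' * real N + l * \<delta>)) * C"
proof -
  let ?V = "on_rats -` oscillating N \<delta> (4 * \<epsilon>) :: 'a cadlag set"
  let ?c = "ennreal (exp (l' * real N + l * \<delta>))"
  let ?r = "\<lambda>y n i. (if i < start \<epsilon> y n then l' else l) * h (y i)"
  have V: "?V \<in> sets borel"
    using measurable_sets[OF measurable_on_rats sets_oscillating] by simp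
  define I where "I y n = (if \<epsilon> < dist (y (start \<epsilon> y n)) (y (Suc n)) then 1 else 0 :: ennreal)" for y :: "nat \<Rightarrow> 'a" and n
  have bound: "indicator ?V (walk_path y (hold y e)) \<le>
      (\<Sum>n. ?c * (I y n * ennreal (exp (- (\<Sum>i<Suc n. ?r y n i * e i)))))"
    if y: "\<forall>n. dist (y n) (y (Suc n)) \<le> s" and e: "hold y e \<in> proper_times" for y e
  proof (cases "walk_path y (hold y e) \<in> ?V")
    case True
    have jump: "dist (y n) (y (Suc n)) \<le> \<epsilon>" for n using y \<epsilon>(2) order_trans by blast
    let ?T = "arrival (hold y e)"
    obtain n where n: "\<epsilon> < dist (y (start \<epsilon> y n)) (y (Suc n))" "?T (start \<epsilon> y n) \<le> real N"
        "?T (Suc n) - ?T (start \<epsilon> y n) < \<delta>"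
      using oscillating_walk_path[where y = y, OF e jump \<epsilon>(1)] True by auto
    have "(\<Sum>i<Suc n. ?r y n i * e i) = l' * ?T (start \<epsilon> y n) + l * (?T (Suc n) - ?T (start \<epsilon> y n))"
    proof -
      let ?s = "start \<epsilon> y n"
      have U: "{..<Suc n} = {..<?s} \<union> {?s..<Suc n}" using start_le[of \<epsilon> y n] by auto
      have split: "sum f {..<Suc n} = sum f {..<?s} + sum f {?s..<Suc n}" for f :: "nat \<Rightarrow> real"
        unfolding U by (rule sum.union_disjoint) auto
      have "(\<Sum>i<Suc n. ?r y n i * e i) = (\<Sum>i<?s. l' * hold y e i) + (\<Sum>i=?s..<Suc n. l * hold y e i)"
        unfolding split by (intro arg_cong2[of _ _ _ _ "(+)"] sum.cong) (auto simp: mult.assoc)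
      also have "\<dots> = l' * ?T ?s + l * (?T (Suc n) - ?T ?s)"
        unfolding arrival_def split[of "hold y e"]
          by (simp only: sum_distrib_left[symmetric] add_diff_cancel_left')
      finally show ?thesis .
    qed
    also have "\<dots> \<le> l' * real N + l * \<delta>"
      using n l by (intro add_mono mult_left_mono) auto
    finally have "1 \<le> exp (l' * real N + l * \<delta>) * exp (- (\<Sum>i<Suc n. ?r y n i * e i))"
      by (simp add: exp_add[symmetric])
    then have "1 \<le> ?c * (I y n * ennreal (exp (- (\<Sum>i<Suc n. ?r y n i * e i))))"
      using n(1) unfolding I_def by (simp add: ennreal_mult[symmetric] ennreal_1[symmetric] del: ennreal_1)
    also have "\<dots> \<le> (\<Sum>n. ?c * (I y n * ennreal (exp (- (\<Sum>i<Suc n. ?r y n i * e i)))))"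
      using sum_le_suminf[of "\<lambda>n. ?c * (I y n * ennreal (exp (- (\<Sum>i<Suc n. ?r y n i * e i))))" "{n}"] by simp
    finally show ?thesis using True by simp
  qed simp
  have "emeasure (law x) ?V = (\<integral>\<^sup>+\<omega>. indicator ?V \<omega> \<partial>law x)"
    using V by (simp add: sets_law)
  also have "\<dots> = (\<integral>\<^sup>+y. (\<integral>\<^sup>+e. indicator ?V (walk_path y (hold y e)) \<partial>clocks) \<partial>chain_law K x)"
    using V by (intro nn_integral_law) simp
  also have "\<dots> \<le> (\<integral>\<^sup>+y. (\<Sum>n. ?c * exit_weight \<epsilon> l' l n y) \<partial>chain_law K x)"
  proof (rule nn_integral_mono_AE)
    show "AE y in chain_law K x. (\<integral>\<^sup>+e. indicator ?V (walk_path y (hold y e)) \<partial>clocks) \<le> (\<Sum>n. ?c * exit_weight \<epsilon> l' l n y)"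
      using AE_chain_jump[of x]
    proof eventually_elim
      case (elim y)
      have "(\<integral>\<^sup>+e. indicator ?V (walk_path y (hold y e)) \<partial>clocks) \<le>
          (\<integral>\<^sup>+e. (\<Sum>n. ?c * (I y n * ennreal (exp (- (\<Sum>i<Suc n. ?r y n i * e i))))) \<partial>clocks)"
        by (rule nn_integral_mono_AE) (use AE_clocks_hold in eventually_elim, rule bound[OF elim], blast)
      also have "\<dots> = (\<Sum>n. \<integral>\<^sup>+e. ?c * (I y n * ennreal (exp (- (\<Sum>i<Suc n. ?r y n i * e i)))) \<partial>clocks)"
        by (rule nn_integral_suminf) simp
      also have "\<dots> = (\<Sum>n. ?c * (I y n * (\<integral>\<^sup>+e. ennreal (exp (- (\<Sum>i<Suc n. ?r y n i * e i))) \<partial>clocks)))"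
        by (simp add: nn_integral_cmult del: sum.lessThan_Suc)
      also have "\<dots> = (\<Sum>n. ?c * exit_weight \<epsilon> l' l n y)"
      proof -
        have "(\<integral>\<^sup>+e. ennreal (exp (- (\<Sum>i<Suc n. ?r y n i * e i))) \<partial>clocks) = two_rate l' l (start \<epsilon> y n) (Suc n) y" for n
          unfolding two_rate_def using l less_imp_le[OF h_pos]
          by (subst nn_integral_clocks_exp) (auto simp del: sum.lessThan_Suc)
        then have "I y n * (\<integral>\<^sup>+e. ennreal (exp (- (\<Sum>i<Suc n. ?r y n i * e i))) \<partial>clocks) = exit_weight \<epsilon> l' l n y" for n
          by (simp add: exit_weight_def I_def del: sum.lessThan_Suc)
        then show ?thesis by (simp only:)
      qed
      finally show ?case .
    qed
  qed
  also have "\<dots> = (\<Sum>n. \<integral>\<^sup>+y. ?c * exit_weight \<epsilon> l' l n y \<partial>chain_law K x)"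
    by (rule nn_integral_suminf)
       (unfold measurable_chain_law_eq, intro borel_measurable_times_ennreal borel_measurable_const measurable_exit_weight)
  also have "\<dots> = ?c * (\<Sum>n. \<integral>\<^sup>+y. exit_weight \<epsilon> l' l n y \<partial>chain_law K x)"
    by (simp add: nn_integral_cmult measurable_chain_law_eq measurable_exit_weight)
  also have "\<dots> \<le> ?c * C"
    by (intro mult_left_mono sum_exit_weight_le[OF l \<epsilon>(1) p q C]) simp
  finally show ?thesis .
qed

end

section \<open>Walks on variable Ahlfors regular spaces\<close>

lemma compact_UNIV_fun:
  assumes "compact (UNIV :: 'a::topological_space set)"
  shows "compact (UNIV :: ('i \<Rightarrow> 'a) set)"
proof -
  have "compact_space (euclidean :: 'a topology)"
    using assms by (simp add: compact_space_def)
  then have "compact_space (product_topology (\<lambda>_ :: 'i. euclidean :: 'a topology) UNIV)"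
    by (simp add: compact_space_product_topology)
  then show ?thesis
    by (simp add: euclidean_product_topology compact_space_def)
qed

lemma max_mean_exit_steps_mono: "B \<subseteq> B' \<Longrightarrow> max_mean_exit_steps \<mu> r B \<le> max_mean_exit_steps \<mu> r B'"
  unfolding max_mean_exit_steps_def discrete_exit_time_def
  by (intro SUP_subset_mono nn_integral_mono INF_superset_mono) auto

lemma ball_time_exponent_mono:
  assumes "B \<subseteq> B'"
  shows "ball_time_exponent \<mu> B \<le> ball_time_exponent \<mu> B'"
  unfolding ball_time_exponent_def
proof (intro SUP_subset_mono subsetI CollectI)
  fix \<gamma> assume \<gamma>: "\<gamma> \<in> {\<gamma>. 0 < \<gamma> \<and> Limsup (at_right 0) (\<lambda>r. max_mean_exit_steps \<mu> r B * ennreal (r powr \<gamma>)) = \<infinity>}"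
  have "Limsup (at_right 0) (\<lambda>r. max_mean_exit_steps \<mu> r B * ennreal (r powr \<gamma>)) \<le>
      Limsup (at_right 0) (\<lambda>r. max_mean_exit_steps \<mu> r B' * ennreal (r powr \<gamma>))"
    by (intro Limsup_mono always_eventually allI mult_right_mono max_mean_exit_steps_mono assms) simp
  then show "0 < \<gamma> \<and> Limsup (at_right 0) (\<lambda>r. max_mean_exit_steps \<mu> r B' * ennreal (r powr \<gamma>)) = \<infinity>"
    using \<gamma> by (simp add: top_unique)
qed simp

text \<open>Upper semicontinuity: a smaller ball around a nearby point lies in the given one.\<close>

lemma measurable_local_time_exponent: "local_time_exponent \<mu> \<in> borel_measurable borel"
proof (rule borel_measurableI_less)
  fix c
  have "open {x. local_time_exponent \<mu> x < c}"
    unfolding open_contains_ball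
  proof
    fix x assume "x \<in> {x. local_time_exponent \<mu> x < c}"
    then obtain R where R: "0 < R" "ball_time_exponent \<mu> (cball x R) < c"
      unfolding local_time_exponent_def by (auto simp: INF_less_iff)
    have "ball x (R / 2) \<subseteq> {x. local_time_exponent \<mu> x < c}"
    proof
      fix y assume y: "y \<in> ball x (R / 2)"
      have "cball y (R / 2) \<subseteq> cball x R"
      proof
        fix z assume "z \<in> cball y (R / 2)"
        then show "z \<in> cball x R" using y dist_triangle[of x z y] by auto
      qed
      then have "local_time_exponent \<mu> y \<le> ball_time_exponent \<mu> (cball x R)"
        unfolding local_time_exponent_def using R(1)
        by (intro INF_lower2[of "R / 2"] ball_time_exponent_mono) auto
      then show "y \<in> {x. local_time_exponent \<mu> x < c}" using R(2) by simp
    qed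
    then show "\<exists>e>0. ball x e \<subseteq> {x. local_time_exponent \<mu> x < c}" using R(1) by (intro exI[of _ "R / 2"]) simp
  qed
  then show "{x \<in> space borel. local_time_exponent \<mu> x < c} \<in> sets borel" by simp
qed

lemma measurable_time_exponent: "time_exponent \<mu> \<in> borel_measurable borel"
  unfolding time_exponent_def[abs_def] using measurable_local_time_exponent by measurable

lemma diameter_pos:
  assumes "compact (UNIV :: 'a::metric_space set)" "x \<noteq> (y :: 'a)"
  shows "0 < diameter (UNIV :: 'a set)"
  using diameter_bounded_bound[OF compact_imp_bounded[OF assms(1)], of x y] assms(2)
  by (auto intro: less_le_trans[of _ "dist x y"])

text \<open>Half the diameter is an admissible radius, and finitely many balls of this radius cover
  the compact space.\<close>

lemma variable_ahlfors_regular_finite: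
  fixes \<mu> :: "'a::metric_space measure"
  assumes "compact (UNIV :: 'a set)" "0 < diameter (UNIV :: 'a set)" "variable_ahlfors_regular \<mu>"
  shows "emeasure \<mu> UNIV < \<infinity>"
proof -
  let ?r = "diameter (UNIV :: 'a set) / 2"
  obtain \<alpha> C where sets: "sets \<mu> = sets borel"
    and le: "\<And>x. emeasure \<mu> (ball x ?r) \<le> ennreal (C * ?r powr \<alpha> x)"
    using assms(2,3) unfolding variable_ahlfors_regular_def by (metis half_gt_zero order_refl)
  obtain F :: "'a set" where F: "finite F" "UNIV \<subseteq> (\<Union>x\<in>F. ball x ?r)"
    using assms(1,2) unfolding compact_eq_totally_bounded by (metis half_gt_zero)
  have "emeasure \<mu> UNIV \<le> emeasure \<mu> (\<Union>x\<in>F. ball x ?r)"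
    using F sets by (intro emeasure_mono) auto
  also have "\<dots> \<le> (\<Sum>x\<in>F. emeasure \<mu> (ball x ?r))"
    using F sets by (intro emeasure_subadditive_finite) auto
  also have "\<dots> < \<infinity>"
    using F(1) le_less_trans[OF le ennreal_less_top] by simp
  finally show ?thesis .
qed

section \<open>The one-step kernels of the walk\<close>

lemma sets_ball_pair: "{p. dist (fst p) (snd p) < r} \<in> sets (borel \<Otimes>\<^sub>M (borel :: 'a::polish_space measure))"
  unfolding borel_prod by (intro borel_open open_Collect_less continuous_intros)

context
  fixes \<mu> :: "'a::polish_space measure" and g :: "'a \<Rightarrow> real" and r a b :: real
  assumes sets_mu: "sets \<mu> = sets borel" and finite_mu: "finite_measure \<mu>"
    and g_meas [measurable]: "g \<in> borel_measurable borel"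
    and g: "0 < a" "\<And>x. a \<le> g x" "\<And>x. g x \<le> b"
    and mass: "\<And>x. 0 < measure \<mu> (ball x r)"
begin

interpretation finite_measure \<mu> by (rule finite_mu)

lemma measurable_mu: "measurable \<mu> N = measurable borel N"
  by (rule measurable_cong_sets[OF sets_mu refl])

lemma space_mu: "space \<mu> = UNIV"
  using sets_eq_imp_space_eq[OF sets_mu] by simp

lemma measurable_pair_mu: "measurable (borel \<Otimes>\<^sub>M \<mu>) N = measurable (borel \<Otimes>\<^sub>M borel) N"
  by (rule measurable_cong_sets[OF sets_pair_measure_cong[OF refl sets_mu] refl])

lemma step_integrand_bound: "0 \<le> indicator (ball x r) y * (1 + g x / g y)" "indicator (ball x r) y * (1 + g x / g y) \<le> 1 + b / a"
proof -
  have "0 < g y" "0 < g x" using g(1,2) less_le_trans by blast+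
  then show "0 \<le> indicator (ball x r) y * (1 + g x / g y)" by (simp add: indicator_def)
  have "g x / g y \<le> b / a" using g(1) g(2)[of y] g(3)[of x] \<open>0 < g x\<close> by (intro frac_le) auto
  moreover have "0 \<le> b / a" using g(1) g(3)[of x] \<open>0 < g x\<close> by simp
  ultimately show "indicator (ball x r) y * (1 + g x / g y) \<le> 1 + b / a" by (simp add: indicator_def)
qed

lemma measurable_step_integrand:
  "(\<lambda>p. indicator (ball (fst p) r) (snd p) * (1 + g (fst p) / g (snd p))) \<in> borel_measurable (borel \<Otimes>\<^sub>M (borel :: 'a measure))"
proof -
  have "(\<lambda>p :: 'a \<times> 'a. indicator (ball (fst p) r) (snd p) :: real) = indicator {p. dist (fst p) (snd p) < r}"
    by (auto simp: indicator_def)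
  moreover have "(indicator {p. dist (fst p) (snd p) < r} :: _ \<Rightarrow> real) \<in> borel_measurable (borel \<Otimes>\<^sub>M (borel :: 'a measure))"
    using sets_ball_pair by simp
  ultimately have [measurable]: "(\<lambda>p. indicator (ball (fst p) r) (snd p) :: real) \<in> borel_measurable (borel \<Otimes>\<^sub>M (borel :: 'a measure))"
    by (simp only:)
  show ?thesis by measurable
qed

text \<open>The product of \<open>step_norm\<close> and \<open>ball_mass\<close>, so that the
  density is a bounded function divided by one positive number.\<close>

definition step_total :: "'a \<Rightarrow> real" where
  "step_total x = (\<integral>y. indicator (ball x r) y * (1 + g x / g y) \<partial>\<mu>)"

lemma measurable_step_total: "step_total \<in> borel_measurable borel"
proof -
  have "case_prod (\<lambda>x y. indicator (ball x r) y * (1 + g x / g y)) \<in> borel_measurable (borel \<Otimes>\<^sub>M \<mu>)"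
    using measurable_step_integrand by (simp add: case_prod_beta' measurable_pair_mu)
  then show ?thesis unfolding step_total_def by (rule borel_measurable_lebesgue_integral)
qed

lemma measurable_step_integrand_snd: "(\<lambda>y. indicator (ball x r) y * (1 + g x / g y)) \<in> borel_measurable \<mu>"
  unfolding measurable_mu
  by (intro borel_measurable_times borel_measurable_indicator borel_open open_ball) measurable

lemma integrable_step_integrand: "integrable \<mu> (\<lambda>y. indicator (ball x r) y * (1 + g x / g y))"
  using step_integrand_bound[of x] measurable_step_integrand_snd
  by (intro integrable_const_bound[of _ "1 + b / a"]) (auto simp del: mult_nonneg_nonneg)

lemma step_total_pos: "0 < step_total x"
proof -
  have "measure \<mu> (ball x r) = (\<integral>y. indicator (ball x r) y \<partial>\<mu>)" by (simp add: space_mu)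
  also have "\<dots> \<le> step_total x"
    unfolding step_total_def
  proof (rule integral_mono[OF _ integrable_step_integrand])
    show "integrable \<mu> (indicator (ball x r) :: _ \<Rightarrow> real)"
      by (rule integrable_const_bound[of _ 1]) (auto simp: indicator_def measurable_mu intro!: borel_measurable_indicator)
    fix y
    have "0 < g y" "0 < g x" using g(1,2) less_le_trans by blast+
    then show "indicator (ball x r) y \<le> indicator (ball x r) y * (1 + g x / g y)" by (simp add: indicator_def)
  qed
  finally show ?thesis using mass[of x] by linarith
qed

lemma step_density_eq: "step_density \<mu> g r x y = indicator (ball x r) y * (1 + g x / g y) / step_total x"
proof -
  have "step_norm \<mu> g r x * ball_mass \<mu> r x = step_total x"
    using mass[of x] by (simp add: step_norm_def ball_mass_def step_total_def set_lebesgue_integral_def)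
  then show ?thesis by (simp add: step_density_def)
qed

lemma measurable_step_density:
  "(\<lambda>p. step_density \<mu> g r (fst p) (snd p)) \<in> borel_measurable (borel \<Otimes>\<^sub>M (borel :: 'a measure))"
  unfolding step_density_eq
  by (intro borel_measurable_divide measurable_step_integrand measurable_compose[OF measurable_fst measurable_step_total])

lemma measurable_step_density_snd: "(\<lambda>y. step_density \<mu> g r x y) \<in> borel_measurable \<mu>"
  unfolding step_density_eq by (intro borel_measurable_divide measurable_step_integrand_snd borel_measurable_const)

lemma prob_space_step_kernel: "prob_space (step_kernel \<mu> g r x)"
proof (rule prob_spaceI)
  have "emeasure (step_kernel \<mu> g r x) (space (step_kernel \<mu> g r x)) = (\<integral>\<^sup>+y. ennreal (step_density \<mu> g r x y) \<partial>\<mu>)"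
    unfolding step_kernel_def using measurable_step_density_snd[of x]
    by (subst emeasure_density) (auto intro!: nn_integral_cong)
  also have "\<dots> = ennreal (\<integral>y. step_density \<mu> g r x y \<partial>\<mu>)"
    unfolding step_density_eq using integrable_step_integrand[of x] step_integrand_bound(1)[of x] step_total_pos[of x]
    by (intro nn_integral_eq_integral) (auto intro!: AE_I2 divide_nonneg_pos)
  also have "(\<integral>y. step_density \<mu> g r x y \<partial>\<mu>) = 1"
    unfolding step_density_eq using step_total_pos[of x] by (simp add: step_total_def)
  finally show "emeasure (step_kernel \<mu> g r x) (space (step_kernel \<mu> g r x)) = 1" by simp
qed

lemma markov_chain_step_kernel: "markov_chain (step_kernel \<mu> g r)"
proof (rule markov_chain.intro)
  show "prob_space (step_kernel \<mu> g r x)" for x by (rule prob_space_step_kernel)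
  show "step_kernel \<mu> g r \<in> borel \<rightarrow>\<^sub>M subprob_algebra borel"
  proof (rule measurable_subprob_algebra)
    show "subprob_space (step_kernel \<mu> g r x)" for x
      by (rule prob_space_imp_subprob_space[OF prob_space_step_kernel])
    show "sets (step_kernel \<mu> g r x) = sets borel" for x by (simp add: step_kernel_def sets_mu)
    fix A :: "'a set" assume A [measurable]: "A \<in> sets borel"
    have "case_prod (\<lambda>x y. ennreal (step_density \<mu> g r x y) * indicator A y) \<in> borel_measurable (borel \<Otimes>\<^sub>M \<mu>)"
    proof -
      have [measurable]: "(\<lambda>p. step_density \<mu> g r (fst p) (snd p)) \<in> borel_measurable (borel \<Otimes>\<^sub>M \<mu>)"
        using measurable_step_density by (simp only: measurable_pair_mu)
      have [measurable]: "(\<lambda>p. indicator A (snd p) :: ennreal) \<in> borel_measurable (borel \<Otimes>\<^sub>M \<mu>)"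
        unfolding measurable_pair_mu by measurable
      show ?thesis unfolding case_prod_beta' by measurable
    qed
    then have "(\<lambda>x. \<integral>\<^sup>+y. ennreal (step_density \<mu> g r x y) * indicator A y \<partial>\<mu>) \<in> borel_measurable borel"
      by (rule borel_measurable_nn_integral)
    also have "(\<lambda>x. \<integral>\<^sup>+y. ennreal (step_density \<mu> g r x y) * indicator A y \<partial>\<mu>) = (\<lambda>x. emeasure (step_kernel \<mu> g r x) A)"
      unfolding step_kernel_def using measurable_step_density_snd
      by (intro ext, subst emeasure_density) (auto simp: sets_mu)
    finally show "(\<lambda>x. emeasure (step_kernel \<mu> g r x) A) \<in> borel_measurable borel" .
  qed
qed

lemma AE_step_kernel: "AE z in step_kernel \<mu> g r x. dist x z \<le> r"
  unfolding step_kernel_def using measurable_step_density_snd[of x]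
  by (subst AE_density) (auto simp: step_density_eq indicator_def)

end

lemma measurable_ball_mass:
  assumes sets [measurable_cong]: "sets \<mu> = sets (borel :: 'a::polish_space measure)" and fin: "finite_measure \<mu>"
  shows "ball_mass \<mu> r \<in> borel_measurable borel"
proof -
  interpret finite_measure \<mu> by (rule fin)
  have "case_prod (\<lambda>x y :: 'a. indicator (ball x r) y :: ennreal) = indicator {p. dist (fst p) (snd p) < r}"
    by (auto simp: indicator_def)
  moreover have "{p. dist (fst p) (snd p) < r} \<in> sets (borel \<Otimes>\<^sub>M \<mu>)"
    using sets_ball_pair[of r] by (simp add: sets cong: sets_pair_measure_cong)
  ultimately have "case_prod (\<lambda>x y. indicator (ball x r) y :: ennreal) \<in> borel_measurable (borel \<Otimes>\<^sub>M \<mu>)" by simp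
  then have "(\<lambda>x. \<integral>\<^sup>+y. indicator (ball x r) y \<partial>\<mu>) \<in> borel_measurable borel"
    by (rule borel_measurable_nn_integral)
  then show ?thesis
    unfolding ball_mass_def[abs_def] measure_def by (simp add: sets)
qed

text \<open>For each fixed r the boundedness of \<alpha> and \<beta> confines the weight between
  positive constants, so its quotients are bounded and the densities integrable. No uniformity in r
  is claimed.\<close>

lemma walk_weight_bounds:
  fixes \<mu> :: "'a::polish_space measure"
  assumes "compact (UNIV :: 'a set)" "x \<noteq> (y :: 'a)" "variable_ahlfors_regular \<mu>"
    and \<beta>: "\<And>x. 0 \<le> \<beta> x" "\<And>x. \<beta> x \<le> b"
    and r: "0 < r" "r \<le> 1" "r \<le> diameter (UNIV :: 'a set) / 2"
  shows "finite_measure \<mu>" "\<And>x. 0 < measure \<mu> (ball x r)"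
    and "\<exists>a>0. \<forall>x. a \<le> walk_weight \<mu> \<beta> r x \<and> walk_weight \<mu> \<beta> r x \<le> measure \<mu> UNIV"
proof -
  have diam: "0 < diameter (UNIV :: 'a set)" by (rule diameter_pos[OF assms(1,2)])
  show fin: "finite_measure \<mu>"
  proof (rule finite_measureI)
    have "sets \<mu> = sets borel" using assms(3) by (simp add: variable_ahlfors_regular_def)
    then have "space \<mu> = UNIV" by (metis sets_eq_imp_space_eq space_borel)
    then show "emeasure \<mu> (space \<mu>) \<noteq> \<infinity>"
      using variable_ahlfors_regular_finite[OF assms(1) diam assms(3)] by simp
  qed
  interpret finite_measure \<mu> by (rule fin)
  obtain \<alpha> C where sets: "sets \<mu> = sets borel" and \<alpha>: "bounded (range \<alpha>)" and C: "1 < C"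
    and lower: "\<And>x. ennreal (1 / C * r powr \<alpha> x) \<le> emeasure \<mu> (ball x r)"
    using assms(3) r unfolding variable_ahlfors_regular_def by metis
  obtain A where A: "\<And>x. \<bar>\<alpha> x\<bar> \<le> A" using \<alpha> by (auto simp: bounded_iff)
  have m: "1 / C * r powr A \<le> measure \<mu> (ball x r)" for x
  proof -
    have "r powr A \<le> r powr \<alpha> x" using A[of x] r by (intro powr_mono') auto
    then have "1 / C * r powr A \<le> 1 / C * r powr \<alpha> x" using C by (intro mult_left_mono) auto
    also have "\<dots> \<le> measure \<mu> (ball x r)"
      using lower[of x] by (simp add: emeasure_eq_measure ennreal_le_iff)
    finally show ?thesis .
  qed
  have pos: "0 < 1 / C * r powr A" using C r by simp
  then show "0 < measure \<mu> (ball x r)" for x using m[of x] by linarith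
  show "\<exists>a>0. \<forall>x. a \<le> walk_weight \<mu> \<beta> r x \<and> walk_weight \<mu> \<beta> r x \<le> measure \<mu> UNIV"
  proof (intro exI[of _ "1 / C * r powr A * r powr b"] conjI allI)
    show "0 < 1 / C * r powr A * r powr b" by (rule mult_pos_pos[OF pos]) (use r in simp)
    fix x
    have "r powr b \<le> r powr \<beta> x" using \<beta>(2) r by (intro powr_mono') auto
    then show "1 / C * r powr A * r powr b \<le> walk_weight \<mu> \<beta> r x"
      unfolding walk_weight_def ball_mass_def using m[of x] pos by (intro mult_mono) auto
    have "r powr \<beta> x \<le> r powr 0" using \<beta>(1) r by (intro powr_mono') auto
    then have "r powr \<beta> x \<le> 1" using r by simp
    moreover have "measure \<mu> (ball x r) \<le> measure \<mu> UNIV"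
      using sets by (intro finite_measure_mono) auto
    ultimately have "measure \<mu> (ball x r) * r powr \<beta> x \<le> measure \<mu> UNIV * 1"
      by (intro mult_mono) auto
    then show "walk_weight \<mu> \<beta> r x \<le> measure \<mu> UNIV"
      by (simp add: walk_weight_def ball_mass_def)
  qed
qed

text \<open>As r \<le> 1 and \<beta> \<le> b, the number \<open>r powr b\<close> bounds all mean
  holding times from below.\<close>

lemma jump_walk_walk_law:
  fixes \<mu> :: "'a::polish_space measure"
  assumes "compact (UNIV :: 'a set)" "x \<noteq> (y :: 'a)" "variable_ahlfors_regular \<mu>"
    and \<beta>: "\<And>x. 0 \<le> \<beta> x" "\<And>x. \<beta> x \<le> b" and \<beta>m [measurable]: "\<beta> \<in> borel_measurable borel"
    and r: "0 < r" "r \<le> 1" "r \<le> diameter (UNIV :: 'a set) / 2"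
  shows "jump_walk (step_kernel \<mu> (walk_weight \<mu> \<beta> r) r) (\<lambda>z. r powr \<beta> z) (r powr b) r"
proof -
  note wb = walk_weight_bounds[where \<beta> = \<beta>, OF assms(1-3) \<beta> r]
  have sets: "sets \<mu> = sets borel" using assms(3) by (simp add: variable_ahlfors_regular_def)
  obtain a where a: "0 < a" "\<And>x. a \<le> walk_weight \<mu> \<beta> r x" "\<And>x. walk_weight \<mu> \<beta> r x \<le> measure \<mu> UNIV"
    using wb(3) by blast
  have gm: "walk_weight \<mu> \<beta> r \<in> borel_measurable borel"
    unfolding walk_weight_def[abs_def] using measurable_ball_mass[OF sets wb(1), of r] by measurable
  show ?thesis
  proof (intro jump_walk.intro jump_walk_axioms.intro)
    show "markov_chain (step_kernel \<mu> (walk_weight \<mu> \<beta> r) r)"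
      by (rule markov_chain_step_kernel[OF sets wb(1) gm a wb(2)])
    show "AE z in step_kernel \<mu> (walk_weight \<mu> \<beta> r) r x. dist x z \<le> r" for x
      by (rule AE_step_kernel[OF sets wb(1) gm a wb(2)])
    show "r powr b \<le> r powr \<beta> x" for x using \<beta>(2) r by (intro powr_mono') auto
    show "(\<lambda>z. r powr \<beta> z) \<in> borel_measurable borel" by measurable
  qed (use r in simp)
qed

section \<open>Tightness and the conclusion\<close>

lemma tight_walk_law:
  fixes \<mu> :: "'a::polish_space measure" and x\<^sub>0 :: 'a and \<beta> :: "'a \<Rightarrow> real"
  assumes sp: "compact (UNIV :: 'a set)" "x \<noteq> (y :: 'a)" "variable_ahlfors_regular \<mu>"
    and \<beta>: "\<And>x. 0 \<le> \<beta> x" "\<And>x. \<beta> x \<le> b" and \<beta>m: "\<beta> \<in> borel_measurable borel"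
    and reg: "strong_variable_time_regular \<mu> \<beta>" and comp: "time_comparable \<mu> \<beta>"
    and e: "0 < e" and \<eta>: "0 < \<eta>"
  shows "\<exists>d>0. \<exists>r'>0. \<forall>r. 0 < r \<longrightarrow> r < r' \<longrightarrow>
    measure (distr (walk_law \<mu> \<beta> r x\<^sub>0) borel on_rats) (oscillating N d e) \<le> \<eta>"
proof -
  let ?D = "diameter (UNIV :: 'a set)"
  have D: "0 < ?D" by (rule diameter_pos[OF sp(1,2)])
  obtain C r1 where C: "0 < C" "0 < r1" and lower: "\<And>x R r. 0 < R \<Longrightarrow> R < ?D / 2 \<Longrightarrow> 0 < r \<Longrightarrow> r < min r1 R \<Longrightarrow>
        ennreal (1 / C * R powr \<beta> x) \<le> max_mean_exit_time \<mu> \<beta> r (cball x R)"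
    and upper: "\<And>x R r. 0 < R \<Longrightarrow> R < ?D / 2 \<Longrightarrow> 0 < r \<Longrightarrow> r < min r1 R \<Longrightarrow>
        max_mean_exit_time \<mu> \<beta> r (cball x R) \<le> ennreal (C * R powr \<beta> x)"
    using reg unfolding strong_variable_time_regular_def by metis
  obtain r2 c0 where c0: "0 < r2" "0 < c0" and cmp: "\<And>r x R. 0 < r \<Longrightarrow> r < r2 \<Longrightarrow> 0 < R \<Longrightarrow> R < ?D / 2 \<Longrightarrow>
        ennreal c0 * max_mean_exit_time \<mu> \<beta> r (cball x R) \<le> mean_exit_time \<mu> \<beta> r (cball x R) x"
    using comp unfolding time_comparable_def by metis
  \<comment> \<open>Capping the constant at 1 keeps q = 1 - c / 2 positive.\<close>
  define c where "c = min c0 1"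
  have c: "0 < c" "c \<le> 1" "c \<le> c0" using c0 by (auto simp: c_def)
  define q where "q = 1 - c / 2"
  have q: "0 < q" "q < 1" using c by (auto simp: q_def)
  define \<epsilon> where "\<epsilon> = e / 4"
  have \<epsilon>: "0 < \<epsilon>" "e = 4 * \<epsilon>" using e by (auto simp: \<epsilon>_def)
  \<comment> \<open>The bound 1 makes powers decrease in the exponent; a third of the diameter stays
    strictly below the half at which time regularity ends.\<close>
  define \<kappa> where "\<kappa> = min (min \<epsilon> 1) (?D / 3)"
  have \<kappa>: "0 < \<kappa>" "\<kappa> \<le> \<epsilon>" "\<kappa> \<le> 1" "\<kappa> < ?D / 2" using \<epsilon> D by (auto simp: \<kappa>_def min_less_iff_disj)
  \<comment> \<open>The factor 2 leaves room for the overshoot, which is at most r < \<rho> M at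
    each of the Suc M exits.\<close>
  define \<rho> where "\<rho> M = \<kappa> / (2 * real (Suc M))" for M
  have \<rho>: "0 < \<rho> M" "\<rho> M \<le> \<kappa>" "real (Suc M) * (2 * \<rho> M) = \<kappa>" for M
  proof -
    show "0 < \<rho> M" using \<kappa> by (simp add: \<rho>_def)
    show "\<rho> M \<le> \<kappa>" unfolding \<rho>_def using \<kappa> by (subst pos_divide_le_eq) auto
    show "real (Suc M) * (2 * \<rho> M) = \<kappa>" by (simp add: \<rho>_def del: of_nat_Suc)
  qed
  \<comment> \<open>Since \<rho> M \<le> 1 and \<beta> \<le> b, time regularity bounds the maximal
    mean exit time below by \<rho>^b / C at every centre. This frequency thus works for all centres
    although \<beta> varies.\<close>
  define l where "l M = C * \<rho> M powr (- b)" for M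
  have l: "0 < l M" for M using C \<rho>(1)[of M] by (simp add: l_def)
  have laplace: "jump_walk.lap (step_kernel \<mu> (walk_weight \<mu> \<beta> r) r) (\<lambda>z. r powr \<beta> z) (l M) (cball z \<epsilon>) z \<le> ennreal (q ^ Suc M)"
    if r: "0 < r" "r < r1" "r < r2" "r < \<rho> M" for r M z
  proof -
    have r': "r \<le> 1" "r \<le> ?D / 2" using r(4) \<rho>(2)[of M] \<kappa> by linarith+
    interpret jump_walk "step_kernel \<mu> (walk_weight \<mu> \<beta> r) r" "\<lambda>z. r powr \<beta> z" "r powr b" r
      by (rule jump_walk_walk_law[where \<beta> = \<beta>, OF sp \<beta> \<beta>m r(1) r'])
    have law: "law = walk_law \<mu> \<beta> r" by (auto simp: law_def walk_law_def)
    have me: "mean_exit = mean_exit_time \<mu> \<beta> r"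
      by (auto simp: fun_eq_iff mean_exit_def mean_exit_time_def law)
    have R: "\<rho> M < ?D / 2" "r < min r1 (\<rho> M)" using \<rho>(2)[of M] \<kappa> r by auto
    have small: "lap (l M) (cball x (\<rho> M)) x \<le> ennreal q" for x
    proof -
      let ?B = "cball x (\<rho> M)"
      define \<Phi> where "\<Phi> = enn2real (max_mean_exit_time \<mu> \<beta> r ?B)"
      have max: "max_mean_exit_time \<mu> \<beta> r ?B = ennreal \<Phi>"
        using upper[OF \<rho>(1) R(1) r(1) R(2), of x] unfolding \<Phi>_def
        by (simp add: le_less_trans[OF _ ennreal_less_top])
      have \<Phi>0: "0 \<le> \<Phi>" by (simp add: \<Phi>_def)
      have \<Phi>1: "1 / C * \<rho> M powr \<beta> x \<le> \<Phi>"
        using lower[OF \<rho>(1) R(1) r(1) R(2), of x] \<Phi>0 unfolding max by (simp add: ennreal_le_iff)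
      have "\<rho> M powr b \<le> \<rho> M powr \<beta> x" using \<beta>(2) \<rho>(1,2)[of M] \<kappa> by (intro powr_mono') auto
      then have "1 / C * \<rho> M powr b \<le> 1 / C * \<rho> M powr \<beta> x" using C by (intro mult_left_mono) auto
      then have "1 / C * \<rho> M powr b \<le> \<Phi>" using \<Phi>1 by linarith
      then have "l M * (1 / C * \<rho> M powr b) \<le> l M * \<Phi>" using l[of M] by (intro mult_left_mono) auto
      moreover have "l M * (1 / C * \<rho> M powr b) = 1"
        using C(1) \<rho>(1)[of M] by (simp add: l_def powr_add[symmetric])
      ultimately have "1 \<le> l M * \<Phi>" by (simp only:)
      moreover have "mean_exit ?B z \<le> ennreal \<Phi>" for z
      proof (cases "z \<in> ?B")
        case True then show ?thesis unfolding max[symmetric] max_mean_exit_time_def me by (rule SUP_upper)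
      next
        case False then show ?thesis using mean_exit_step[of ?B z] by simp
      qed
      moreover have "ennreal (c * \<Phi>) \<le> mean_exit ?B x"
      proof -
        have "ennreal (c * \<Phi>) \<le> ennreal (c0 * \<Phi>)" using c \<Phi>0 by (intro ennreal_leI mult_right_mono)
        also have "\<dots> = ennreal c0 * max_mean_exit_time \<mu> \<beta> r ?B" unfolding max using c0 \<Phi>0 by (simp add: ennreal_mult)
        also have "\<dots> \<le> mean_exit ?B x" unfolding me by (rule cmp[OF r(1,3) \<rho>(1) R(1)])
        finally show ?thesis .
      qed
      ultimately show ?thesis
        unfolding q_def using l[of M] c by (intro lap_mean_exit) auto
    qed
    have "real (Suc M) * (\<rho> M + r) \<le> real (Suc M) * (2 * \<rho> M)"
      using r by (intro mult_left_mono) auto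
    also have "\<dots> \<le> \<epsilon>" using \<rho>(3)[of M] \<kappa> by simp
    finally have sub: "cball z (real (Suc M) * (\<rho> M + r)) \<subseteq> cball z \<epsilon>" by (simp add: subset_cball)
    have "lap (l M) (cball z \<epsilon>) z \<le> lap (l M) (cball z (real (Suc M) * (\<rho> M + r))) z"
      using l[of M] by (intro lap_antimono sub) auto
    also have "\<dots> \<le> ennreal q ^ Suc M"
      using l[of M] \<rho>(1)[of M] r small by (intro lap_chaining) auto
    also have "\<dots> = ennreal (q ^ Suc M)" using q by (intro ennreal_power) simp
    finally show ?thesis .
  qed
  \<comment> \<open>The exponential factor involves only the low rate \<open>l 0\<close> and so is
    independent of M; the high rate is cancelled by taking \<delta> = 1 / l M.\<close>
  have "(\<lambda>M. exp (l 0 * real N + 1) * (q ^ Suc M / (1 - q))) \<longlonglongrightarrow> exp (l 0 * real N + 1) * (0 / (1 - q))"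
    using q by (intro tendsto_intros LIMSEQ_Suc[OF LIMSEQ_power_zero]) auto
  then have "\<forall>\<^sub>F M in sequentially. exp (l 0 * real N + 1) * (q ^ Suc M / (1 - q)) < \<eta>"
    using \<eta> by (intro order_tendstoD) auto
  then obtain M where M: "exp (l 0 * real N + 1) * (q ^ Suc M / (1 - q)) < \<eta>"
    unfolding eventually_sequentially by blast
  define r' where "r' = min (min r1 r2) (min (\<rho> M) (\<rho> 0))"
  have "measure (distr (walk_law \<mu> \<beta> r x\<^sub>0) borel on_rats) (oscillating N (1 / l M) e) \<le> \<eta>"
    if r: "0 < r" "r < r'" for r
  proof -
    have rs: "r < r1" "r < r2" "r < \<rho> M" "r < \<rho> 0" using r by (auto simp: r'_def)
    have r1: "r \<le> 1" "r \<le> ?D / 2" "r \<le> \<epsilon>" using rs(3) \<rho>(2)[of M] \<kappa> by linarith+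
    interpret jump_walk "step_kernel \<mu> (walk_weight \<mu> \<beta> r) r" "\<lambda>z. r powr \<beta> z" "r powr b" r
      by (rule jump_walk_walk_law[where \<beta> = \<beta>, OF sp \<beta> \<beta>m r(1) r1(1,2)])
    have law: "law x\<^sub>0 = walk_law \<mu> \<beta> r x\<^sub>0" by (simp add: law_def walk_law_def)
    interpret P: prob_space "walk_law \<mu> \<beta> r x\<^sub>0" using prob_space_law[of x\<^sub>0] by (simp add: law)
    have sets: "sets (walk_law \<mu> \<beta> r x\<^sub>0) = sets borel" by (simp add: walk_law_def)
    \<comment> \<open>The solution of q^(M+1) + C' * q = C', where q bounds the transform at the low
      rate, the case M = 0 of \<open>laplace\<close>.\<close>
    define C' where "C' = q ^ Suc M / (1 - q)"
    have C'0: "0 \<le> C'" using q by (simp add: C'_def)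
    have C': "ennreal (q ^ Suc M) + ennreal C' * ennreal (q ^ Suc 0) \<le> ennreal C'"
    proof -
      have "q ^ Suc M + C' * q = C'" using q by (simp add: C'_def field_simps)
      then have "ennreal (q ^ Suc M) + ennreal (C' * q) = ennreal C'"
        using q C'0 by (subst ennreal_plus[symmetric]) (auto simp del: power_Suc)
      then show ?thesis using q C'0 by (simp add: ennreal_mult del: power_Suc)
    qed
    have "emeasure (law x\<^sub>0) (on_rats -` oscillating N (1 / l M) (4 * \<epsilon>)) \<le>
        ennreal (exp (l 0 * real N + l M * (1 / l M))) * ennreal C'"
      using l[of M] l[of 0] \<epsilon> r1
      by (intro law_oscillating_le[OF _ _ _ _ laplace laplace C'] r(1) rs) auto
    also have "\<dots> = ennreal (exp (l 0 * real N + 1) * C')"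
      using l[of M] C'0 by (simp add: ennreal_mult)
    also have "\<dots> \<le> ennreal \<eta>" using M by (intro ennreal_leI) (simp add: C'_def)
    finally have "measure (walk_law \<mu> \<beta> r x\<^sub>0) (on_rats -` oscillating N (1 / l M) e) \<le> \<eta>"
      using \<eta> by (simp add: law \<epsilon>(2) P.emeasure_eq_measure ennreal_le_iff)
    moreover have "on_rats \<in> walk_law \<mu> \<beta> r x\<^sub>0 \<rightarrow>\<^sub>M borel"
      unfolding measurable_cong_sets[OF sets refl] by (rule measurable_on_rats)
    moreover have "space (walk_law \<mu> \<beta> r x\<^sub>0) = UNIV" by (simp add: walk_law_def)
    ultimately show ?thesis by (simp add: measure_distr)
  qed
  moreover have "0 < r'" using C c0 \<rho>(1) by (simp add: r'_def)
  ultimately show ?thesis using l[of M] by (intro exI[of _ "1 / l M"] conjI exI[of _ r']) auto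
qed

theorem theorem5p2p8:
  fixes \<mu> :: "'a::polish_space measure" and x\<^sub>0 :: 'a and r :: "nat \<Rightarrow> real"
  assumes "compact (UNIV :: 'a set)"
    and "connected (UNIV :: 'a set)"
    and "\<exists>x y :: 'a. x \<noteq> y"
    and "variable_ahlfors_regular \<mu>"
    and "(SUP x. local_time_exponent \<mu> x) < \<infinity>"
    and "strong_variable_time_regular \<mu> (time_exponent \<mu>)"
    and "time_comparable \<mu> (time_exponent \<mu>)"
    and "\<And>k. 0 < r k" and "decseq r" and "r \<longlonglongrightarrow> 0"
  shows "\<exists>(s :: nat \<Rightarrow> nat) P. strict_mono s \<and>
           weakly_converges (\<lambda>j. walk_law \<mu> (time_exponent \<mu>) (r (s j)) x\<^sub>0) P \<and>
           emeasure P continuous_paths = 1"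
proof -
  let ?\<beta> = "time_exponent \<mu>" and ?D = "diameter (UNIV :: 'a set)"
  obtain x y :: 'a where xy: "x \<noteq> y" using assms(3) by blast
  note sp = assms(1) xy assms(4)
  have D: "0 < ?D" by (rule diameter_pos[OF sp(1,2)])
  obtain b where b: "(SUP x. local_time_exponent \<mu> x) = ennreal b" "0 \<le> b"
    using assms(5) by (cases "SUP x. local_time_exponent \<mu> x") auto
  have \<beta>: "0 \<le> ?\<beta> x" "?\<beta> x \<le> b" for x
  proof -
    have "local_time_exponent \<mu> x \<le> ennreal b" unfolding b(1)[symmetric] by (rule SUP_upper) simp
    then show "?\<beta> x \<le> b" unfolding time_exponent_def using enn2real_mono[of _ "ennreal b"] b(2) by simp
  qed (simp add: time_exponent_def)
  note \<beta>m = measurable_time_exponent[of \<mu>]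
  have "\<forall>\<^sub>F k in sequentially. r k < min 1 (?D / 2)"
    using assms(10) by (rule order_tendstoD) (use D in simp)
  then obtain k0 where k0: "\<And>k. k0 \<le> k \<Longrightarrow> r k < min 1 (?D / 2)"
    unfolding eventually_sequentially by blast
  \<comment> \<open>Finitely many terms are dropped so that every radius is below 1 and below half
    the diameter, as \<open>jump_walk_walk_law\<close> requires; the final subsequence carries the
    shift.\<close>
  define \<Lambda> where "\<Lambda> k = walk_law \<mu> ?\<beta> (r (k + k0)) x\<^sub>0" for k
  have prob: "prob_space (\<Lambda> k)" for k
  proof -
    interpret jump_walk "step_kernel \<mu> (walk_weight \<mu> ?\<beta> (r (k + k0))) (r (k + k0))" "\<lambda>z. r (k + k0) powr ?\<beta> z"
        "r (k + k0) powr b" "r (k + k0)"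
      using k0[of "k + k0"] assms(8) by (intro jump_walk_walk_law[where \<beta> = ?\<beta>, OF sp \<beta> \<beta>m]) auto
    show ?thesis using prob_space_law[of x\<^sub>0] by (simp add: law_def walk_law_def \<Lambda>_def)
  qed
  have sets: "sets (\<Lambda> k) = sets borel" for k by (simp add: \<Lambda>_def walk_law_def)
  have on_rats: "on_rats \<in> \<Lambda> k \<rightarrow>\<^sub>M borel" for k
    unfolding measurable_cong_sets[OF sets refl] by (rule measurable_on_rats)
  obtain s Q where s: "strict_mono s" and Q: "weakly_converges ((\<lambda>k. distr (\<Lambda> k) borel on_rats) \<circ> s) Q"
  proof (rule weakly_sequentially_compact)
    show "compact (UNIV :: (rat \<Rightarrow> 'a) set)" by (rule compact_UNIV_fun[OF assms(1)])
    show "prob_space (distr (\<Lambda> k) borel on_rats)" for k by (rule prob_space.prob_space_distr[OF prob on_rats])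
  qed auto
  have tight: "\<exists>d>0. \<forall>\<^sub>F k in sequentially. measure (distr (\<Lambda> (s k)) borel on_rats) (oscillating N d e) \<le> c"
    if "0 < e" "0 < c" for N e c
  proof -
    obtain d r' where d: "0 < d" "0 < r'" and le: "\<And>r. 0 < r \<Longrightarrow> r < r' \<Longrightarrow>
        measure (distr (walk_law \<mu> ?\<beta> r x\<^sub>0) borel on_rats) (oscillating N d e) \<le> c"
      using tight_walk_law[where \<beta> = ?\<beta>, OF sp \<beta> \<beta>m assms(6,7) \<open>0 < e\<close> \<open>0 < c\<close>, of x\<^sub>0 N] by blast
    have "(\<lambda>k. r (s k + k0)) \<longlonglongrightarrow> 0"
      using LIMSEQ_subseq_LIMSEQ[OF LIMSEQ_ignore_initial_segment[OF assms(10)] s] by (simp add: comp_def)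
    then have "\<forall>\<^sub>F k in sequentially. r (s k + k0) < r'" using d(2) by (rule order_tendstoD)
    then have "\<forall>\<^sub>F k in sequentially. measure (distr (\<Lambda> (s k)) borel on_rats) (oscillating N d e) \<le> c"
      unfolding \<Lambda>_def by eventually_elim (rule le[OF assms(8)])
    with d(1) show ?thesis by blast
  qed
  note lim = weak_limit_continuous_paths[of "\<lambda>k. \<Lambda> (s k)", OF prob sets Q[unfolded comp_def] tight]
  have "strict_mono (\<lambda>j. s j + k0)" using s by (simp add: strict_mono_def)
  then show ?thesis using lim unfolding \<Lambda>_def by blast
qed

end
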